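(* $\mathbf{IKP}(\mathcal{P})+\Sigma^{\mathcal P}\text{-Reflection}$ is conservative over $\mathbf{IKP}(\mathcal{P})$ for $\Sigma^{\mathcal P}$-sentences.
   Context: The language of $\mathbf{IKP}(\mathcal{P})$ is that of set theory with, in addition, primitive subset-bounded quantifiers $(\forall x\subseteq a)$, $(\exists x\subseteq a)$; $a\subseteq b$ abbreviates $(\forall x\in a)(x\in b)$. $\Delta_0^{\mathcal P}$-formulas are those without unbounded quantifiers. $\mathbf{IKP}(\mathcal P)$ has intuitionistic logic and axioms: Extensionality for $\Delta_0^{\mathcal P}$ formulas, Pair, Union, Infinity, $\Delta_0^{\mathcal P}$-Separation, $\Delta_0^{\mathcal P}$-Collection, Set Induction for all formulas, and Power Set $\exists z(\forall x\subseteq a)(x\in z)$. $\Sigma^{\mathcal P}$- and $\Pi^{\mathcal P}$-formulas: both contain the $\Delta_0^{\mathcal P}$-formulas and are closed under $\wedge,\vee$, $(\forall x\in s),(\exists x\in s),(\forall x\subseteq s),(\exists x\subseteq s)$; $\Sigma^{\mathcal P}$ is closed under $\exists x$, and contains $\neg C$, $C\to A$ whenever $A$ is $\Sigma^{\mathcal P}$ and $C$ is $\Pi^{\mathcal P}$; dually $\Pi^{\mathcal P}$ is closed under $\forall x$ and contains $\neg D$, $D\to A$ whenever $A$ is $\Pi^{\mathcal P}$ and $D$ is $\Sigma^{\mathcal P}$. $\Sigma^{\mathcal P}$-Reflection is the schema $A\to\exists z\,A^{z}$ for $\Sigma^{\mathcal P}$-formulas $A$, where $A^{z}$ restricts every unbounded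 quantifier of $A$ to $z$. *)

theory Defs
  imports Main
begin

text \<open>Variables are de Bruijn indices (nat). The only atomic formulas are membership
  statements; equality is the defined notion a = b :== (forall x in a)(x in b) and
  (forall x in b)(x in a). Bounded quantifiers (membership-bounded and subset-bounded)
  are primitive. In BAll i A, BEx i A, SAll i A, SEx i A the index i refers to the
  context outside the binder, while A lives in the context extended by the bound variable
  (index 0).\<close>

datatype fm =
    Mem nat nat
  | Bot
  | Conj fm fm
  | Disj fm fm
  | Imp fm fm
  | All fm
  | Ex fm
  | BAll nat fm
  | BEx nat fm
  | SAll nat fm
  | SEx nat fm

definition Neg :: "fm \<Rightarrow> fm" where "Neg A = Imp A Bot"
definition Iff :: "fm \<Rightarrow> fm \<Rightarrow> fm" where "Iff A B = Conj (Imp A B) (Imp B A)"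
definition Top :: fm where "Top = Imp Bot Bot"

definition Sub :: "nat \<Rightarrow> nat \<Rightarrow> fm" where "Sub a b = BAll a (Mem 0 (Suc b))"

definition Eqd :: "nat \<Rightarrow> nat \<Rightarrow> fm" where
  "Eqd a b = Conj (BAll a (Mem 0 (Suc b))) (BAll b (Mem 0 (Suc a)))"

definition lv :: "nat \<Rightarrow> nat \<Rightarrow> nat" where "lv k i = (if i < k then i else Suc i)"

fun lift :: "nat \<Rightarrow> fm \<Rightarrow> fm" where
  "lift k (Mem i j) = Mem (lv k i) (lv k j)"
| "lift k Bot = Bot"
| "lift k (Conj A B) = Conj (lift k A) (lift k B)"
| "lift k (Disj A B) = Disj (lift k A) (lift k B)"
| "lift k (Imp A B) = Imp (lift k A) (lift k B)"
| "lift k (All A) = All (lift (Suc k) A)"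
| "lift k (Ex A) = Ex (lift (Suc k) A)"
| "lift k (BAll i A) = BAll (lv k i) (lift (Suc k) A)"
| "lift k (BEx i A) = BEx (lv k i) (lift (Suc k) A)"
| "lift k (SAll i A) = SAll (lv k i) (lift (Suc k) A)"
| "lift k (SEx i A) = SEx (lv k i) (lift (Suc k) A)"

definition sv :: "nat \<Rightarrow> nat \<Rightarrow> nat \<Rightarrow> nat" where
  "sv k t i = (if i < k then i else if i = k then t else i - 1)"

fun subst :: "nat \<Rightarrow> nat \<Rightarrow> fm \<Rightarrow> fm" where
  "subst k t (Mem i j) = Mem (sv k t i) (sv k t j)"
| "subst k t Bot = Bot"
| "subst k t (Conj A B) = Conj (subst k t A) (subst k t B)"
| "subst k t (Disj A B) = Disj (subst k t A) (subst k t B)"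
| "subst k t (Imp A B) = Imp (subst k t A) (subst k t B)"
| "subst k t (All A) = All (subst (Suc k) (Suc t) A)"
| "subst k t (Ex A) = Ex (subst (Suc k) (Suc t) A)"
| "subst k t (BAll i A) = BAll (sv k t i) (subst (Suc k) (Suc t) A)"
| "subst k t (BEx i A) = BEx (sv k t i) (subst (Suc k) (Suc t) A)"
| "subst k t (SAll i A) = SAll (sv k t i) (subst (Suc k) (Suc t) A)"
| "subst k t (SEx i A) = SEx (sv k t i) (subst (Suc k) (Suc t) A)"

fun closed_at :: "nat \<Rightarrow> fm \<Rightarrow> bool" where
  "closed_at n (Mem i j) = (i < n \<and> j < n)"
| "closed_at n Bot = True"
| "closed_at n (Conj A B) = (closed_at n A \<and> closed_at n B)"
| "closed_at n (Disj A B) = (closed_at n A \<and> closed_at n B)"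
| "closed_at n (Imp A B) = (closed_at n A \<and> closed_at n B)"
| "closed_at n (All A) = closed_at (Suc n) A"
| "closed_at n (Ex A) = closed_at (Suc n) A"
| "closed_at n (BAll i A) = (i < n \<and> closed_at (Suc n) A)"
| "closed_at n (BEx i A) = (i < n \<and> closed_at (Suc n) A)"
| "closed_at n (SAll i A) = (i < n \<and> closed_at (Suc n) A)"
| "closed_at n (SEx i A) = (i < n \<and> closed_at (Suc n) A)"

definition sentence :: "fm \<Rightarrow> bool" where "sentence A = closed_at 0 A"

fun delta0 :: "fm \<Rightarrow> bool" where
  "delta0 (Mem i j) = True"
| "delta0 Bot = True"
| "delta0 (Conj A B) = (delta0 A \<and> delta0 B)"
| "delta0 (Disj A B) = (delta0 A \<and> delta0 B)"
| "delta0 (Imp A B) = (delta0 A \<and> delta0 B)"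
| "delta0 (All A) = False"
| "delta0 (Ex A) = False"
| "delta0 (BAll i A) = delta0 A"
| "delta0 (BEx i A) = delta0 A"
| "delta0 (SAll i A) = delta0 A"
| "delta0 (SEx i A) = delta0 A"

inductive SigmaP :: "fm \<Rightarrow> bool" and PiP :: "fm \<Rightarrow> bool" where
  S_d0: "delta0 A \<Longrightarrow> SigmaP A"
| S_conj: "SigmaP A \<Longrightarrow> SigmaP B \<Longrightarrow> SigmaP (Conj A B)"
| S_disj: "SigmaP A \<Longrightarrow> SigmaP B \<Longrightarrow> SigmaP (Disj A B)"
| S_ball: "SigmaP A \<Longrightarrow> SigmaP (BAll i A)"
| S_bex: "SigmaP A \<Longrightarrow> SigmaP (BEx i A)"
| S_sall: "SigmaP A \<Longrightarrow> SigmaP (SAll i A)"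
| S_sex: "SigmaP A \<Longrightarrow> SigmaP (SEx i A)"
| S_ex: "SigmaP A \<Longrightarrow> SigmaP (Ex A)"
| S_neg: "PiP C \<Longrightarrow> SigmaP (Neg C)"
| S_imp: "PiP C \<Longrightarrow> SigmaP A \<Longrightarrow> SigmaP (Imp C A)"
| P_d0: "delta0 A \<Longrightarrow> PiP A"
| P_conj: "PiP A \<Longrightarrow> PiP B \<Longrightarrow> PiP (Conj A B)"
| P_disj: "PiP A \<Longrightarrow> PiP B \<Longrightarrow> PiP (Disj A B)"
| P_ball: "PiP A \<Longrightarrow> PiP (BAll i A)"
| P_bex: "PiP A \<Longrightarrow> PiP (BEx i A)"
| P_sall: "PiP A \<Longrightarrow> PiP (SAll i A)"
| P_sex: "PiP A \<Longrightarrow> PiP (SEx i A)"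
| P_all: "PiP A \<Longrightarrow> PiP (All A)"
| P_neg: "SigmaP D \<Longrightarrow> PiP (Neg D)"
| P_imp: "SigmaP D \<Longrightarrow> PiP A \<Longrightarrow> PiP (Imp D A)"

text \<open>Axioms may contain free variables (read universally). Quantifier rules are the
  Bernays rules; the primitive bounded quantifiers are governed by their defining
  equivalences.\<close>

inductive prov :: "fm set \<Rightarrow> fm \<Rightarrow> bool" for T :: "fm set" where
  ax: "A \<in> T \<Longrightarrow> prov T A"
| K: "prov T (Imp A (Imp B A))"
| S: "prov T (Imp (Imp A (Imp B C)) (Imp (Imp A B) (Imp A C)))"
| conjE1: "prov T (Imp (Conj A B) A)"
| conjE2: "prov T (Imp (Conj A B) B)"
| conjI: "prov T (Imp A (Imp B (Conj A B)))"
| disjI1: "prov T (Imp A (Disj A B))"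
| disjI2: "prov T (Imp B (Disj A B))"
| disjE: "prov T (Imp (Imp A C) (Imp (Imp B C) (Imp (Disj A B) C)))"
| efq: "prov T (Imp Bot A)"
| allE: "prov T (Imp (All A) (subst 0 t A))"
| exI: "prov T (Imp (subst 0 t A) (Ex A))"
| ball_def: "prov T (Iff (BAll i A) (All (Imp (Mem 0 (Suc i)) A)))"
| bex_def: "prov T (Iff (BEx i A) (Ex (Conj (Mem 0 (Suc i)) A)))"
| sall_def: "prov T (Iff (SAll i A) (All (Imp (Sub 0 (Suc i)) A)))"
| sex_def: "prov T (Iff (SEx i A) (Ex (Conj (Sub 0 (Suc i)) A)))"
| mp: "prov T (Imp A B) \<Longrightarrow> prov T A \<Longrightarrow> prov T B"
| allI: "prov T (Imp (lift 0 B) A) \<Longrightarrow> prov T (Imp B (All A))"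
| exE: "prov T (Imp A (lift 0 B)) \<Longrightarrow> prov T (Imp (Ex A) B)"

definition Ext_ax :: "fm set" where
  "Ext_ax = {Imp (Conj (Eqd a b) (subst 0 a B)) (subst 0 b B) | a b B. delta0 B}"

definition Pair_ax :: "fm set" where
  "Pair_ax = {Ex (Conj (Mem (Suc a) 0) (Mem (Suc b) 0)) | a b. True}"

definition Union_ax :: "fm set" where
  "Union_ax = {Ex (BAll (Suc a) (BAll 0 (Mem 0 2))) | a. True}"

definition Inf_ax :: "fm set" where
  "Inf_ax = {Ex (Conj (Ex (Mem 0 1)) (BAll 0 (BEx 1 (Mem 1 0))))}"

text \<open>Delta_0^P Separation: \<exists>y \<forall>x (x \<in> y \<leftrightarrow> x \<in> a \<and> B(x)), B with var 0 = x\<close>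
definition Sep_ax :: "fm set" where
  "Sep_ax = {Ex (All (Iff (Mem 0 1) (Conj (Mem 0 (Suc (Suc a))) (lift 1 B)))) | a B. delta0 B}"

text \<open>Delta_0^P Collection: (\<forall>x\<in>a)\<exists>y B(x,y) \<longrightarrow> \<exists>z (\<forall>x\<in>a)(\<exists>y\<in>z) B(x,y),
  B with var 0 = y, var 1 = x\<close>
definition Coll_ax :: "fm set" where
  "Coll_ax = {Imp (BAll a (Ex B)) (Ex (BAll (Suc a) (BEx 1 (lift 2 B)))) | a B. delta0 B}"

definition Ind_ax :: "fm set" where
  "Ind_ax = {Imp (All (Imp (BAll 0 (lift 1 A)) A)) (All A) | A. True}"

definition Pow_ax :: "fm set" where
  "Pow_ax = {Ex (SAll (Suc a) (Mem 0 1)) | a. True}"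

definition IKPP :: "fm set" where
  "IKPP = Ext_ax \<union> Pair_ax \<union> Union_ax \<union> Inf_ax \<union> Sep_ax \<union> Coll_ax \<union> Ind_ax \<union> Pow_ax"

fun rel :: "nat \<Rightarrow> fm \<Rightarrow> fm" where
  "rel z (Mem i j) = Mem i j"
| "rel z Bot = Bot"
| "rel z (Conj A B) = Conj (rel z A) (rel z B)"
| "rel z (Disj A B) = Disj (rel z A) (rel z B)"
| "rel z (Imp A B) = Imp (rel z A) (rel z B)"
| "rel z (All A) = BAll z (rel (Suc z) A)"
| "rel z (Ex A) = BEx z (rel (Suc z) A)"
| "rel z (BAll i A) = BAll i (rel (Suc z) A)"
| "rel z (BEx i A) = BEx i (rel (Suc z) A)"
| "rel z (SAll i A) = SAll i (rel (Suc z) A)"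
| "rel z (SEx i A) = SEx i (rel (Suc z) A)"

definition SigmaRefl :: "fm set" where
  "SigmaRefl = {Imp A (Ex (rel 0 (lift 0 A))) | A. SigmaP A}"

end

theory Submission
  imports Defs "HOL-Library.Countable" "HOL-Library.Infinite_Set"
begin

text \<open>
  Suppose \<open>A\<close> is not provable in \<open>IKPP\<close>. By completeness there is a Kripke model \<open>M\<close> of \<open>IKPP\<close>
  whose root does not force \<open>A\<close>. Over \<open>M\<close> we interpret \<open>IKPP\<close> with reflection by a forcing in the
  style of Coquand and Hofmann. A condition \<open>p\<close> is a set of \<open>M\<close> coding a family of \<open>\<Pi>\<close>-formulas
  with parameters; write \<open>p\<^sup>z\<close> for the conjunction of these formulas restricted to \<open>z\<close>. A
  \<open>\<Sigma>\<close>-formula \<open>B\<close> is to be forced by \<open>p\<close> iff \<open>M\<close> satisfies \<open>\<exists>z (p\<^sup>z \<longrightarrow> B\<^sup>z)\<close>, and a \<open>\<Pi>\<close>-formula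
  \<open>C\<close> iff \<open>M\<close> satisfies \<open>\<forall>y \<exists>z (p\<^sup>z \<longrightarrow> C\<^sup>y)\<close>. Then reflection is forced for trivial reasons: in the
  critical case of \<open>C \<longrightarrow> B\<close> one adds \<open>C\<close> itself to the condition and reads off a bound \<open>z\<close> for
  \<open>C\<^sup>z \<longrightarrow> B\<^sup>z\<close>. Conversely a \<open>\<Sigma>\<close>-sentence forced by the empty condition is true in \<open>M\<close>.

  Implication and universal quantification are interpreted as usual. Disjunction and existence are
  coded impredicatively, with elimination only into goals, i.e. \<open>\<Sigma>\<close>-formulas with parameters; this
  replaces an appeal to collection for arbitrary formulas, which \<open>IKPP\<close> lacks. Since a proof uses
  finitely many axioms, only finitely many formulas have to be coded as conditions and goals, and a
  single \<open>\<Delta>\<^sub>0\<close>-formula is universal for them. Hence forcing is definable in \<open>M\<close>, and set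
  induction for the forcing relation reduces to set induction in \<open>M\<close>.
\<close>

text \<open>The obstacle is intuitionistic implication. Classically the \<Sigma>-formula
  \<open>C \<longrightarrow> B\<close> is a disjunction of \<Sigma>-formulas and collection bounds
  it. Intuitionistically the witness for \<open>B\<close> may depend on the unbounded hypothesis
  \<open>C\<close>, which collection for Delta_0-formulas cannot handle. A condition carries
  \<open>C\<close> as a hypothesis restricted to the very bound that is sought.

  In the clause for \<Pi>-formulas \<open>y\<close> and \<open>z\<close> are independent:
  \<open>C\<close> restricted to a given \<open>y\<close> may use more of the condition, namely its
  restriction to a later \<open>z\<close>.

  Since the bound stands outside the implication \<open>p^z \<longrightarrow> B^z\<close>, a forced
  disjunction is decided only under the hypothesis \<open>p^z\<close>, so that the Kripke clause for
  disjunction would be too strong. Gluing such local choices for arbitrary formulas would collect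
  statements of arbitrary complexity. A goal asks for nothing but a bound, and bounds are found by
  Delta_0-collection. Every interpreted formula is determined by the goals that it implies, so that
  elimination into goals yields elimination into all formulas.\<close>

hide_fact (open) prov.exI prov.exE prov.allI prov.allE prov.conjI prov.mp prov.disjE prov.disjI1 prov.disjI2

instance fm :: countable by countable_datatype

section \<open>Environments, renamings and free variables\<close>

abbreviation econs :: "'a \<Rightarrow> (nat \<Rightarrow> 'a) \<Rightarrow> nat \<Rightarrow> 'a" (infixr "##" 65) where
  "x ## v \<equiv> case_nat x v"

lemma econs_comp: "f \<circ> (x ## v) = f x ## (f \<circ> v)"
  by (auto simp: fun_eq_iff split: nat.splits)

definition up :: "(nat \<Rightarrow> nat) \<Rightarrow> nat \<Rightarrow> nat" where
  "up \<rho> = 0 ## (\<lambda>i. Suc (\<rho> i))"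

lemma up_simps [simp]: "up \<rho> 0 = 0" "up \<rho> (Suc i) = Suc (\<rho> i)"
  by (simp_all add: up_def)

lemma up_comp: "up \<rho> \<circ> up \<sigma> = up (\<rho> \<circ> \<sigma>)"
  by (auto simp: fun_eq_iff up_def split: nat.splits)

lemma econs_up: "(x ## v) \<circ> up \<rho> = x ## (v \<circ> \<rho>)"
  by (auto simp: fun_eq_iff up_def split: nat.splits)

text \<open>Variables are the only terms, so lifting and substitution are both renamings. Their
  commutation laws all become composition of maps on indices.\<close>

primrec ren :: "(nat \<Rightarrow> nat) \<Rightarrow> fm \<Rightarrow> fm" where
  "ren \<rho> (Mem i j) = Mem (\<rho> i) (\<rho> j)"
| "ren \<rho> Bot = Bot"
| "ren \<rho> (Conj A B) = Conj (ren \<rho> A) (ren \<rho> B)"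
| "ren \<rho> (Disj A B) = Disj (ren \<rho> A) (ren \<rho> B)"
| "ren \<rho> (Imp A B) = Imp (ren \<rho> A) (ren \<rho> B)"
| "ren \<rho> (All A) = All (ren (up \<rho>) A)"
| "ren \<rho> (Ex A) = Ex (ren (up \<rho>) A)"
| "ren \<rho> (BAll i A) = BAll (\<rho> i) (ren (up \<rho>) A)"
| "ren \<rho> (BEx i A) = BEx (\<rho> i) (ren (up \<rho>) A)"
| "ren \<rho> (SAll i A) = SAll (\<rho> i) (ren (up \<rho>) A)"
| "ren \<rho> (SEx i A) = SEx (\<rho> i) (ren (up \<rho>) A)"

lemma delta0_ren: "delta0 (ren \<rho> A) = delta0 A"
  by (induction A arbitrary: \<rho>) auto

lemma up_lv: "up (lv k) = lv (Suc k)"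
  by (auto simp: fun_eq_iff up_def lv_def split: nat.splits)

lemma up_sv: "up (sv k t) = sv (Suc k) (Suc t)"
  by (auto simp: fun_eq_iff up_def sv_def split: nat.splits)

lemma lift_ren: "lift k A = ren (lv k) A"
  by (induction A arbitrary: k) (simp_all add: up_lv)

lemma subst_ren: "subst k t A = ren (sv k t) A"
  by (induction A arbitrary: k t) (simp_all add: up_sv)

lemma lv_0: "lv 0 = Suc"
  by (auto simp: fun_eq_iff lv_def)

lemma sv_0: "sv 0 t = t ## id"
  by (auto simp: fun_eq_iff sv_def split: nat.splits)

lemma lift0_ren: "lift 0 A = ren Suc A"
  by (simp add: lift_ren lv_0)

lemma subst0_ren: "subst 0 t A = ren (t ## id) A"
  by (simp add: subst_ren sv_0)

lemma ren_ren: "ren \<rho> (ren \<sigma> A) = ren (\<rho> \<circ> \<sigma>) A"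
  by (induction A arbitrary: \<rho> \<sigma>) (simp_all add: up_comp)

lemma ren_up_lift: "ren (up \<rho>) (lift 0 A) = lift 0 (ren \<rho> A)"
  by (simp add: lift0_ren ren_ren comp_def)

lemma ren_subst0: "ren \<rho> (subst 0 t A) = subst 0 (\<rho> t) (ren (up \<rho>) A)"
  by (simp add: subst0_ren ren_ren econs_up econs_comp)

lemma subst0_ren_up: "subst 0 t (ren (up \<rho>) A) = ren (t ## \<rho>) A"
  by (simp add: subst0_ren ren_ren econs_up)

lemma ren_Eqd: "ren \<rho> (Eqd a b) = Eqd (\<rho> a) (\<rho> b)"
  by (simp add: Eqd_def)

primrec fv :: "fm \<Rightarrow> nat set" where
  "fv (Mem i j) = {i, j}"
| "fv Bot = {}"
| "fv (Conj A B) = fv A \<union> fv B"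
| "fv (Disj A B) = fv A \<union> fv B"
| "fv (Imp A B) = fv A \<union> fv B"
| "fv (All A) = {i. Suc i \<in> fv A}"
| "fv (Ex A) = {i. Suc i \<in> fv A}"
| "fv (BAll i A) = insert i {i. Suc i \<in> fv A}"
| "fv (BEx i A) = insert i {i. Suc i \<in> fv A}"
| "fv (SAll i A) = insert i {i. Suc i \<in> fv A}"
| "fv (SEx i A) = insert i {i. Suc i \<in> fv A}"

lemma finite_fv [simp]: "finite (fv A)"
  by (induction A) (auto simp: vimage_def[symmetric] intro!: finite_vimageI)

lemma up_eq_on: "(\<And>i. Suc i \<in> S \<Longrightarrow> \<rho> i = \<sigma> i) \<Longrightarrow> i \<in> S \<Longrightarrow> up \<rho> i = up \<sigma> i"
  by (cases i) auto

lemma ren_cong: "(\<And>i. i \<in> fv A \<Longrightarrow> \<rho> i = \<sigma> i) \<Longrightarrow> ren \<rho> A = ren \<sigma> A"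
proof (induction A arbitrary: \<rho> \<sigma>)
  case (All A)
  have "ren (up \<rho>) A = ren (up \<sigma>) A"
    by (rule All.IH, rule up_eq_on[where S = "fv A"]) (use All.prems in auto)
  then show ?case by simp
next
  case (Ex A)
  have "ren (up \<rho>) A = ren (up \<sigma>) A"
    by (rule Ex.IH, rule up_eq_on[where S = "fv A"]) (use Ex.prems in auto)
  then show ?case by simp
next
  case (BAll k A)
  have "ren (up \<rho>) A = ren (up \<sigma>) A"
    by (rule BAll.IH, rule up_eq_on[where S = "fv A"]) (use BAll.prems in auto)
  then show ?case using BAll.prems by simp
next
  case (BEx k A)
  have "ren (up \<rho>) A = ren (up \<sigma>) A"
    by (rule BEx.IH, rule up_eq_on[where S = "fv A"]) (use BEx.prems in auto)
  then show ?case using BEx.prems by simp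
next
  case (SAll k A)
  have "ren (up \<rho>) A = ren (up \<sigma>) A"
    by (rule SAll.IH, rule up_eq_on[where S = "fv A"]) (use SAll.prems in auto)
  then show ?case using SAll.prems by simp
next
  case (SEx k A)
  have "ren (up \<rho>) A = ren (up \<sigma>) A"
    by (rule SEx.IH, rule up_eq_on[where S = "fv A"]) (use SEx.prems in auto)
  then show ?case using SEx.prems by simp
next
  case (Conj A B)
  have "ren \<rho> A = ren \<sigma> A" "ren \<rho> B = ren \<sigma> B"
    by (rule Conj.IH, use Conj.prems in simp)+
  then show ?case by simp
next
  case (Disj A B)
  have "ren \<rho> A = ren \<sigma> A" "ren \<rho> B = ren \<sigma> B"
    by (rule Disj.IH, use Disj.prems in simp)+
  then show ?case by simp
next
  case (Imp A B)
  have "ren \<rho> A = ren \<sigma> A" "ren \<rho> B = ren \<sigma> B"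
    by (rule Imp.IH, use Imp.prems in simp)+
  then show ?case by simp
qed simp_all

lemma up_id: "up (\<lambda>i. i) = (\<lambda>i. i)"
  by (auto simp: fun_eq_iff up_def split: nat.splits)

lemma ren_id: "ren id A = A"
  by (induction A) (simp_all add: up_id id_def)

lemma Suc_vimage_up: "{i. Suc i \<in> up \<rho> ` S} = \<rho> ` {i. Suc i \<in> S}"
proof -
  have "Suc i \<in> up \<rho> ` S \<longleftrightarrow> i \<in> \<rho> ` {i. Suc i \<in> S}" for i
  proof
    assume "Suc i \<in> up \<rho> ` S"
    then obtain j where "j \<in> S" "Suc i = up \<rho> j" by auto
    then show "i \<in> \<rho> ` {i. Suc i \<in> S}" by (cases j) auto
  next
    assume "i \<in> \<rho> ` {i. Suc i \<in> S}"
    then obtain j where "Suc j \<in> S" "i = \<rho> j" by auto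
    then show "Suc i \<in> up \<rho> ` S" by (auto intro!: image_eqI[of _ _ "Suc j"])
  qed
  then show ?thesis by auto
qed

lemma fv_ren: "fv (ren \<rho> A) = \<rho> ` fv A"
  by (induction A arbitrary: \<rho>) (simp_all add: image_Un Suc_vimage_up)

lemma fv_subst0: "fv (subst 0 t A) \<subseteq> insert t (fv (All A))"
  by (auto simp: subst0_ren fv_ren split: nat.splits)

lemma fv_closed_at: "closed_at n A \<Longrightarrow> fv A \<subseteq> {..<n}"
  by (induction A arbitrary: n) (simp_all, (auto dest: subsetD)+)

section \<open>Derivations from hypotheses\<close>

text \<open>Closure under renaming makes provability stable under a change of free variables. This
  is what lets free variables act as fresh constants in the Henkin construction.\<close>

definition renclosed :: "fm set \<Rightarrow> bool" where
  "renclosed T \<longleftrightarrow> (\<forall>A\<in>T. \<forall>\<rho>. ren \<rho> A \<in> T)"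

lemma prov_ren:
  assumes T: "renclosed T" and "prov T A"
  shows "prov T (ren \<rho> A)"
  using assms(2)
proof (induction arbitrary: \<rho> rule: prov.induct)
  case (ax A)
  then show ?case using T by (auto simp: renclosed_def intro: prov.ax)
next
  case (mp A B)
  then show ?case using prov.mp by fastforce
next
  case (allI B A)
  from allI.IH[of "up \<rho>"] show ?case
    by (simp add: ren_up_lift prov.allI)
next
  case (exE A B)
  from exE.IH[of "up \<rho>"] show ?case
    by (simp add: ren_up_lift prov.exE)
next
  case (ball_def i A)
  show ?case using prov.ball_def[of T "\<rho> i" "ren (up \<rho>) A"] by (simp add: Iff_def)
next
  case (bex_def i A)
  show ?case using prov.bex_def[of T "\<rho> i" "ren (up \<rho>) A"] by (simp add: Iff_def)
next
  case (sall_def i A)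
  show ?case using prov.sall_def[of T "\<rho> i" "ren (up \<rho>) A"] by (simp add: Iff_def Sub_def)
next
  case (sex_def i A)
  show ?case using prov.sex_def[of T "\<rho> i" "ren (up \<rho>) A"] by (simp add: Iff_def Sub_def)
qed (auto simp: ren_subst0 intro: prov.intros)

text \<open>The quantifier rules occur only inside \<open>prov\<close>, that is, without hypotheses.
  Hence the deduction theorem \<open>ded_Imp\<close> holds without a condition on free
  variables.\<close>

inductive ded :: "fm set \<Rightarrow> fm set \<Rightarrow> fm \<Rightarrow> bool" for T G where
  hyp: "A \<in> G \<Longrightarrow> ded T G A"
| dax: "prov T A \<Longrightarrow> ded T G A"
| dmp: "ded T G (Imp A B) \<Longrightarrow> ded T G A \<Longrightarrow> ded T G B"

lemma prov_I: "prov T (Imp A A)"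
  by (meson prov.K prov.S prov.mp)

lemma ded_mono: "ded T G A \<Longrightarrow> G \<subseteq> H \<Longrightarrow> ded T H A"
  by (induction rule: ded.induct) (auto intro: ded.intros)

lemma ded_cut: "ded T G A \<Longrightarrow> (\<And>B. B \<in> G \<Longrightarrow> ded T H B) \<Longrightarrow> ded T H A"
  by (induction rule: ded.induct) (auto intro: ded.intros)

lemma ded_Imp: "ded T (insert B G) A \<Longrightarrow> ded T G (Imp B A)"
proof (induction rule: ded.induct)
  case (hyp A)
  then show ?case
    by (metis ded.dmp ded.hyp ded.dax insert_iff prov.K prov_I)
next
  case (dax A)
  then show ?case by (meson ded.dax prov.K prov.mp)
next
  case (dmp A C)
  then show ?case by (meson ded.dmp ded.dax prov.S)
qed

lemma ded_Imp_iff: "ded T G (Imp B A) \<longleftrightarrow> ded T (insert B G) A"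
  by (meson ded.dmp ded.hyp ded_Imp ded_mono insertI1 subset_insertI)

lemma ded_conj: "ded T G (Conj A B) \<longleftrightarrow> ded T G A \<and> ded T G B"
  by (meson ded.dmp ded.dax prov.conjE1 prov.conjE2 prov.conjI)

lemma ded_disjE: "ded T G (Disj A B) \<Longrightarrow> ded T (insert A G) C \<Longrightarrow> ded T (insert B G) C \<Longrightarrow> ded T G C"
  by (meson ded.dmp ded.dax ded_Imp prov.disjE)

lemma ded_Iff: "prov T (Iff A B) \<Longrightarrow> ded T G A \<longleftrightarrow> ded T G B"
  unfolding Iff_def by (meson ded.dmp ded.dax ded_conj)

lemma ded_finite: "ded T G A \<Longrightarrow> \<exists>H. finite H \<and> H \<subseteq> G \<and> ded T H A"
proof (induction rule: ded.induct)
  case (hyp A)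
  then show ?case by (intro exI[of _ "{A}"]) (auto intro: ded.hyp)
next
  case (dax A)
  then show ?case by (intro exI[of _ "{}"]) (auto intro: ded.dax)
next
  case (dmp A B)
  then obtain H1 H2 where "finite H1" "H1 \<subseteq> G" "ded T H1 (Imp A B)"
    "finite H2" "H2 \<subseteq> G" "ded T H2 A" by auto
  then show ?case
    by (intro exI[of _ "H1 \<union> H2"]) (auto intro: ded.dmp[of _ _ A] ded_mono)
qed

text \<open>The Bernays rules have an implication with a single antecedent as premise. The
  hypotheses that a derivation uses are therefore gathered into one formula \<open>H\<close>,
  without new free variables.\<close>

lemma ded_single: "ded T G B \<Longrightarrow> \<exists>H. fv H \<subseteq> \<Union> (fv ` G) \<and> ded T G H \<and> prov T (Imp H B)"
proof (induction rule: ded.induct)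
  case (hyp A)
  then show ?case by (intro exI[of _ A]) (auto intro: ded.hyp prov_I)
next
  case (dax A)
  then show ?case
    by (intro exI[of _ Top]) (auto simp: Top_def intro: ded.dax prov_I prov.mp[OF prov.K])
next
  case (dmp A B)
  then obtain H1 H2 where *: "fv H1 \<subseteq> \<Union> (fv ` G)" "ded T G H1" "prov T (Imp H1 (Imp A B))"
    "fv H2 \<subseteq> \<Union> (fv ` G)" "ded T G H2" "prov T (Imp H2 A)" by auto
  have "ded T {Conj H1 H2} H1" "ded T {Conj H1 H2} H2"
    using ded_conj[of T "{Conj H1 H2}" H1 H2] by (auto intro: ded.hyp)
  then have "ded T {Conj H1 H2} B"
    using * by (meson ded.dmp ded.dax)
  then have "ded T {} (Imp (Conj H1 H2) B)" by (simp add: ded_Imp)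
  moreover have "ded T {} A \<Longrightarrow> prov T A" for A
    by (induction rule: ded.induct) (auto intro: prov.mp)
  ultimately show ?case using *
    by (intro exI[of _ "Conj H1 H2"]) (auto simp: ded_conj)
qed

lemma ded_empty: "ded T {} A \<longleftrightarrow> prov T A"
proof
  show "ded T {} A \<Longrightarrow> prov T A"
    by (induction rule: ded.induct) (auto intro: prov.mp)
qed (rule ded.dax)

lemma prov_Imp_cut: "prov T (Imp A B) \<longleftrightarrow> ded T {A} B"
  by (metis ded_Imp_iff ded_empty)

lemma ded_AllI:
  assumes T: "renclosed T" and d: "ded T G (subst 0 c A)"
    and c: "c \<notin> \<Union> (fv ` G)" "c \<notin> fv (All A)"
  shows "ded T G (All A)"
proof -
  obtain H where H: "fv H \<subseteq> \<Union> (fv ` G)" "ded T G H" "prov T (Imp H (subst 0 c A))"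
    using ded_single[OF d] by auto
  \<comment> \<open>The fresh variable \<open>c\<close> becomes index 0, which the quantifier will
    bind, and all others are lifted. This turns the provable implication into the premise of the
    rule \<open>prov.allI\<close>.\<close>
  define \<rho> where "\<rho> i = (if i = c then 0 else Suc i)" for i
  have "prov T (ren \<rho> (Imp H (subst 0 c A)))"
    by (rule prov_ren[OF T H(3)])
  moreover have "ren \<rho> H = lift 0 H"
    unfolding lift0_ren by (rule ren_cong) (use H(1) c in \<open>auto simp: \<rho>_def\<close>)
  moreover have "ren \<rho> (subst 0 c A) = ren id A"
    unfolding subst0_ren ren_ren
    by (rule ren_cong) (use c(2) in \<open>auto simp: \<rho>_def split: nat.splits\<close>)
  ultimately have "prov T (Imp (lift 0 H) A)" by (simp add: ren_id)
  then show ?thesis using H(2) by (meson ded.dmp ded.dax prov.allI)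
qed

lemma ded_AllE: "ded T G (All A) \<Longrightarrow> ded T G (subst 0 c A)"
  by (meson ded.dmp ded.dax prov.allE)

lemma ded_ExI: "ded T G (subst 0 c A) \<Longrightarrow> ded T G (Ex A)"
  by (meson ded.dmp ded.dax prov.exI)

lemma ded_ExE:
  assumes T: "renclosed T" and e: "ded T G (Ex A)" and d: "ded T (insert (subst 0 c A) G) B"
    and c: "c \<notin> \<Union> (fv ` G)" "c \<notin> fv (All A)" "c \<notin> fv B"
  shows "ded T G B"
proof -
  obtain H where H: "fv H \<subseteq> \<Union> (fv ` G)" "ded T G H" "prov T (Imp H (Imp (subst 0 c A) B))"
    using ded_single[OF ded_Imp[OF d]] by auto
  \<comment> \<open>The antecedents are exchanged, since \<open>prov.exE\<close> wants the instance
    of \<open>A\<close> outermost; \<open>H\<close> moves into the conclusion.\<close>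
  from H(3) have "ded T {subst 0 c A} (Imp H B)"
    by (simp add: prov_Imp_cut ded_Imp_iff insert_commute)
  then have H3: "prov T (Imp (subst 0 c A) (Imp H B))" by (simp add: prov_Imp_cut)
  define \<rho> where "\<rho> i = (if i = c then 0 else Suc i)" for i
  have "prov T (ren \<rho> (Imp (subst 0 c A) (Imp H B)))"
    by (rule prov_ren[OF T H3])
  moreover have "ren \<rho> (Imp H B) = lift 0 (Imp H B)"
    unfolding lift0_ren by (rule ren_cong) (use H(1) c in \<open>auto simp: \<rho>_def\<close>)
  moreover have "ren \<rho> (subst 0 c A) = ren id A"
    unfolding subst0_ren ren_ren
    by (rule ren_cong) (use c(2) in \<open>auto simp: \<rho>_def split: nat.splits\<close>)
  ultimately have "prov T (Imp A (lift 0 (Imp H B)))" by (simp add: ren_id)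
  then have "prov T (Imp (Ex A) (Imp H B))" by (rule prov.exE)
  then show ?thesis using H(2) e by (meson ded.dmp ded.dax)
qed

section \<open>Kripke models\<close>

text \<open>The relation \<open>\<preceq>\<close> need not be reflexive on the whole type: \<open>r \<preceq> w\<close> also expresses that \<open>w\<close> is
  a world of the model.\<close>

locale kripke =
  fixes le :: "'w \<Rightarrow> 'w \<Rightarrow> bool" (infix "\<preceq>" 50)
    and D :: "'w \<Rightarrow> 'd set"
    and E :: "'w \<Rightarrow> 'd \<Rightarrow> 'd \<Rightarrow> bool"
    and r :: 'w
  assumes le_root: "r \<preceq> r"
    and le_refl: "r \<preceq> w \<Longrightarrow> w \<preceq> w"
    and le_trans: "w \<preceq> w' \<Longrightarrow> w' \<preceq> w'' \<Longrightarrow> w \<preceq> w''"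
    and D_mono: "w \<preceq> w' \<Longrightarrow> x \<in> D w \<Longrightarrow> x \<in> D w'"
    and E_mono: "w \<preceq> w' \<Longrightarrow> E w x y \<Longrightarrow> E w' x y"
begin

definition sub :: "'w \<Rightarrow> 'd \<Rightarrow> 'd \<Rightarrow> bool" where
  "sub w x y \<longleftrightarrow> (\<forall>w'. w \<preceq> w' \<longrightarrow> (\<forall>u\<in>D w'. E w' u x \<longrightarrow> E w' u y))"

primrec forces :: "'w \<Rightarrow> (nat \<Rightarrow> 'd) \<Rightarrow> fm \<Rightarrow> bool" where
  "forces w v (Mem i j) = E w (v i) (v j)"
| "forces w v Bot = False"
| "forces w v (Conj A B) = (forces w v A \<and> forces w v B)"
| "forces w v (Disj A B) = (forces w v A \<or> forces w v B)"
| "forces w v (Imp A B) = (\<forall>w'. w \<preceq> w' \<longrightarrow> forces w' v A \<longrightarrow> forces w' v B)"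
| "forces w v (All A) = (\<forall>w'. w \<preceq> w' \<longrightarrow> (\<forall>x\<in>D w'. forces w' (x ## v) A))"
| "forces w v (Ex A) = (\<exists>x\<in>D w. forces w (x ## v) A)"
| "forces w v (BAll i A) = (\<forall>w'. w \<preceq> w' \<longrightarrow> (\<forall>x\<in>D w'. E w' x (v i) \<longrightarrow> forces w' (x ## v) A))"
| "forces w v (BEx i A) = (\<exists>x\<in>D w. E w x (v i) \<and> forces w (x ## v) A)"
| "forces w v (SAll i A) = (\<forall>w'. w \<preceq> w' \<longrightarrow> (\<forall>x\<in>D w'. sub w' x (v i) \<longrightarrow> forces w' (x ## v) A))"
| "forces w v (SEx i A) = (\<exists>x\<in>D w. sub w x (v i) \<and> forces w (x ## v) A)"

lemma sub_mono: "w \<preceq> w' \<Longrightarrow> sub w x y \<Longrightarrow> sub w' x y"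
  unfolding sub_def by (meson le_trans)

lemma forces_mono: "w \<preceq> w' \<Longrightarrow> forces w v A \<Longrightarrow> forces w' v A"
proof (induction A arbitrary: v)
  case (SEx i A)
  then show ?case by (auto dest: D_mono sub_mono)
qed (auto dest: le_trans D_mono E_mono)

lemma forces_ren: "forces w v (ren \<rho> A) \<longleftrightarrow> forces w (v \<circ> \<rho>) A"
  by (induction A arbitrary: w v \<rho>) (simp_all add: econs_up)

lemma forces_Sub: "forces w v (Sub i j) \<longleftrightarrow> sub w (v i) (v j)"
  by (simp add: Sub_def sub_def)

text \<open>Reflexivity of the order is available only from the root upwards, hence the formulation
  at \<open>r\<close>. As \<open>forces\<close> does not depend on the root, the lemma applies at
  any world of the canonical model, which can itself be taken as root
  (\<open>kripke_canon\<close>).\<close>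

lemma forces_bounded:
  shows "forces r v (BAll i A) \<longleftrightarrow> forces r v (All (Imp (Mem 0 (Suc i)) A))"
    and "forces r v (BEx i A) \<longleftrightarrow> forces r v (Ex (Conj (Mem 0 (Suc i)) A))"
    and "forces r v (SAll i A) \<longleftrightarrow> forces r v (All (Imp (Sub 0 (Suc i)) A))"
    and "forces r v (SEx i A) \<longleftrightarrow> forces r v (Ex (Conj (Sub 0 (Suc i)) A))"
proof -
  have *: "(\<forall>w'. r \<preceq> w' \<longrightarrow> (\<forall>x\<in>D w'. P w' x \<longrightarrow> Q w' x)) \<longleftrightarrow>
    (\<forall>w'. r \<preceq> w' \<longrightarrow> (\<forall>x\<in>D w'. \<forall>w''. w' \<preceq> w'' \<longrightarrow> P w'' x \<longrightarrow> Q w'' x))" for P Q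
    using le_refl le_trans D_mono by blast
  show "forces r v (BAll i A) \<longleftrightarrow> forces r v (All (Imp (Mem 0 (Suc i)) A))"
    by (simp add: *[of "\<lambda>w x. E w x (v i)"])
  show "forces r v (SAll i A) \<longleftrightarrow> forces r v (All (Imp (Sub 0 (Suc i)) A))"
    by (simp add: *[of "\<lambda>w x. sub w x (v i)"] forces_Sub)
qed (simp_all add: forces_Sub)

end

section \<open>Completeness\<close>

locale canon =
  fixes T :: "fm set"
  assumes renT: "renclosed T"
begin

text \<open>Prime Henkin theories \<open>H\<close> in the variables \<open>X\<close>, which serve as constants. Infinitely many
  variables are left out of \<open>X\<close> to serve as witnesses in later worlds.\<close>

definition worlds :: "(nat set \<times> fm set) set" where
  "worlds = {(X, H). infinite (- X) \<and> (\<forall>A\<in>H. fv A \<subseteq> X)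
     \<and> (\<forall>A. ded T H A \<longrightarrow> fv A \<subseteq> X \<longrightarrow> A \<in> H) \<and> Bot \<notin> H
     \<and> (\<forall>A B. Disj A B \<in> H \<longrightarrow> A \<in> H \<or> B \<in> H)
     \<and> (\<forall>A. Ex A \<in> H \<longrightarrow> (\<exists>c\<in>X. subst 0 c A \<in> H))}"

definition wle :: "nat set \<times> fm set \<Rightarrow> nat set \<times> fm set \<Rightarrow> bool" where
  "wle a b \<longleftrightarrow> a \<in> worlds \<and> b \<in> worlds \<and> fst a \<subseteq> fst b \<and> snd a \<subseteq> snd b"

text \<open>The trigger is derivability from \<open>H\<close> and not membership in
  \<open>H\<close>, because the stages of the construction are not closed under deduction; only
  their limit will be.\<close>

definition handled :: "nat set \<Rightarrow> fm \<Rightarrow> fm set \<Rightarrow> fm set \<Rightarrow> bool" where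
  "handled X f H H' \<longleftrightarrow> H \<subseteq> H' \<and> (fv f \<subseteq> X \<longrightarrow> ded T H f \<longrightarrow>
     (\<forall>B C. f = Disj B C \<longrightarrow> B \<in> H' \<or> C \<in> H') \<and> (\<forall>B. f = Ex B \<longrightarrow> (\<exists>c\<in>X. subst 0 c B \<in> H')))"

text \<open>If both disjuncts made \<open>A\<close> derivable, so would their disjunction, hence one
  of them may be added. For an existential formula a fresh witness exists because only finitely many
  variables of \<open>Y\<close> have been spent.\<close>

lemma extend_step:
  assumes H: "\<forall>B\<in>H. fv B \<subseteq> X \<union> Y" "finite (\<Union>(fv ` H) \<inter> Y)" "\<not> ded T H A"
    and Y: "infinite Y" "fv A \<subseteq> X" "X \<inter> Y = {}"
  shows "\<exists>H'. (\<forall>B\<in>H'. fv B \<subseteq> X \<union> Y) \<and> finite (\<Union>(fv ` H') \<inter> Y) \<and> \<not> ded T H' A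
           \<and> handled (X \<union> Y) f H H'"
proof -
  consider "\<not> (fv f \<subseteq> X \<union> Y \<and> ded T H f)"
    | (disj) B C where "f = Disj B C" "fv f \<subseteq> X \<union> Y" "ded T H f"
    | (ex) B where "f = Ex B" "fv f \<subseteq> X \<union> Y" "ded T H f"
    | (other) "\<forall>B C. f \<noteq> Disj B C" "\<forall>B. f \<noteq> Ex B" by blast
  then show ?thesis
  proof cases
    case 1
    then show ?thesis using H by (intro exI[of _ H]) (auto simp: handled_def)
  next
    case disj
    then obtain F where F: "F = B \<or> F = C" "\<not> ded T (insert F H) A"
      using ded_disjE[of T H B C A] H(3) disj by auto
    then have "fv F \<subseteq> X \<union> Y" using disj by auto
    then show ?thesis using H F disj
      by (intro exI[of _ "insert F H"]) (auto simp: handled_def Int_Un_distrib2)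
  next
    case ex
    have "infinite (Y - (\<Union>(fv ` H) \<inter> Y \<union> fv f))"
      using Y(1) H(2) by (simp add: Diff_infinite_finite)
    then obtain c where c: "c \<in> Y" "c \<notin> \<Union>(fv ` H)" "c \<notin> fv f"
      using infinite_imp_nonempty by blast
    have "\<not> ded T (insert (subst 0 c B) H) A"
      using ded_ExE[OF renT, of H B c A] ex c H(3) Y by auto
    moreover have "fv (subst 0 c B) \<subseteq> X \<union> Y"
      using fv_subst0[of c B] ex c by auto
    moreover have "finite (fv (subst 0 c B) \<inter> Y)" by simp
    ultimately show ?thesis using H c ex
      by (intro exI[of _ "insert (subst 0 c B) H"]) (auto simp: handled_def Int_Un_distrib2)
  next
    case other
    then show ?thesis using H by (intro exI[of _ H]) (auto simp: handled_def)
  qed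
qed

text \<open>The Lindenbaum-Henkin construction: a theory that does not derive \<open>A\<close>
  extends to a prime theory with witnesses that omits \<open>A\<close>.\<close>

lemma extend:
  assumes X: "infinite (- X)" and H: "\<forall>B\<in>H. fv B \<subseteq> X" and A: "fv A \<subseteq> X" "\<not> ded T H A"
  shows "\<exists>X' H'. (X', H') \<in> worlds \<and> X \<subseteq> X' \<and> H \<subseteq> H' \<and> A \<notin> H'"
proof -
  define e where "e = enumerate (- X)"
  have e: "inj e" "range e = - X"
    using X unfolding e_def
    by (auto simp: range_enumerate strict_mono_imp_inj_on strict_mono_enumerate)
  define Y where "Y = e ` {n. even n}"
  define Z where "Z = e ` {n. odd n}"
  have ev: "infinite {n::nat. even n}" "infinite {n::nat. odd n}"
    unfolding infinite_nat_iff_unbounded_le by (metis even_Suc le_Suc_eq le_refl mem_Collect_eq)+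
  have inf: "infinite Y" "infinite Z"
    unfolding Y_def Z_def using ev e(1) by (meson finite_imageD inj_on_subset subset_UNIV)+
  have "Y \<inter> Z = {}" unfolding Y_def Z_def using e(1) by (auto dest: injD)
  moreover have YX: "X \<inter> Y = {}" "X \<inter> Z = {}" using e(2) unfolding Y_def Z_def by auto
  ultimately have "Z \<subseteq> - (X \<union> Y)" by auto
  then have inf': "infinite (- (X \<union> Y))" using inf(2) finite_subset by blast
  let ?P = "\<lambda>H'. (\<forall>B\<in>H'. fv B \<subseteq> X \<union> Y) \<and> finite (\<Union>(fv ` H') \<inter> Y) \<and> \<not> ded T H' A \<and> H \<subseteq> H'"
  \<comment> \<open>The second component of the decoded pair makes every formula come up infinitely
    often. This matters since a disjunction or existential formula may become derivable only at a
    late stage.\<close>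
  define task :: "nat \<Rightarrow> fm" where "task n = from_nat (fst (prod_decode n))" for n
  have "\<exists>S. \<forall>n. ?P (S n) \<and> handled (X \<union> Y) (task n) (S n) (S (Suc n))"
  proof (rule dependent_nat_choice)
    have "\<Union> (fv ` H) \<inter> Y = {}" using H YX by blast
    then show "\<exists>x. ?P x" using H A by (intro exI[of _ H]) auto
  next
    fix H' n assume P: "?P H'"
    then obtain H'' where "\<forall>B\<in>H''. fv B \<subseteq> X \<union> Y" "finite (\<Union>(fv ` H'') \<inter> Y)" "\<not> ded T H'' A"
      "handled (X \<union> Y) (task n) H' H''"
      using extend_step[of H' X Y A "task n"] inf A YX by auto
    then show "\<exists>y. ?P y \<and> handled (X \<union> Y) (task n) H' y"
      using P by (intro exI[of _ H'']) (auto simp: handled_def)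
  qed
  then obtain S where S: "\<And>n. ?P (S n)" "\<And>n. handled (X \<union> Y) (task n) (S n) (S (Suc n))" by blast
  have mono: "m \<le> n \<Longrightarrow> S m \<subseteq> S n" for m n
    by (rule lift_Suc_mono_le) (use S(2) in \<open>auto simp: handled_def\<close>)
  let ?S = "\<Union>n. S n"
  \<comment> \<open>The deductive closure is taken only in the limit. A formula in \<open>K\<close>
    is derivable from some stage on, and a later stage handles it.\<close>
  define K where "K = {f. fv f \<subseteq> X \<union> Y \<and> ded T ?S f}"
  have stage: "\<exists>m. ded T (S m) f" if "ded T ?S f" for f
  proof -
    obtain F where F: "finite F" "F \<subseteq> ?S" "ded T F f" using ded_finite[OF \<open>ded T ?S f\<close>] by auto
    have "\<exists>m. F \<subseteq> S m" using F(1,2)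
    proof (induction F)
      case (insert x F)
      then obtain m k where "F \<subseteq> S m" "x \<in> S k" by auto
      then have "insert x F \<subseteq> S (max m k)"
        using mono[of m "max m k"] mono[of k "max m k"] by auto
      then show ?case by blast
    qed simp
    then show ?thesis using F(3) ded_mono by blast
  qed
  have late: "\<exists>n\<ge>m. task n = f" for f m
    unfolding task_def
    by (intro exI[of _ "prod_encode (to_nat f, m)"]) (simp add: le_prod_encode_2)
  have SK: "S n \<subseteq> K" for n
    using S(1) by (auto simp: K_def intro: ded.hyp)
  have dK: "ded T K f \<Longrightarrow> ded T ?S f" for f
    by (rule ded_cut) (auto simp: K_def)
  have "A \<notin> K"
    using stage[of A] S(1) by (auto simp: K_def)
  have hK: "\<exists>n. ded T (S n) f \<and> handled (X \<union> Y) f (S n) (S (Suc n))" if "f \<in> K" for f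
  proof -
    obtain m where "ded T (S m) f" using \<open>f \<in> K\<close> stage[of f] by (auto simp: K_def)
    moreover obtain n where "n \<ge> m" "task n = f" using late by blast
    ultimately show ?thesis using S(2)[of n] ded_mono[OF _ mono[of m n]] by auto
  qed
  have "(X \<union> Y, K) \<in> worlds"
    unfolding worlds_def mem_Collect_eq prod.case
  proof (intro conjI allI impI ballI)
    show "Bot \<notin> K"
    proof
      assume "Bot \<in> K"
      then have "A \<in> K" using A(1) by (auto simp: K_def intro: ded.dmp[OF ded.dax[OF prov.efq]])
      then show False using \<open>A \<notin> K\<close> by simp
    qed
  next
    fix B C assume a: "Disj B C \<in> K"
    then have "fv (Disj B C) \<subseteq> X \<union> Y" by (simp add: K_def)
    then show "B \<in> K \<or> C \<in> K" using hK[OF a] SK by (auto simp: handled_def)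
  next
    fix B assume a: "Ex B \<in> K"
    then have "fv (Ex B) \<subseteq> X \<union> Y" by (simp add: K_def)
    then show "\<exists>c\<in>X \<union> Y. subst 0 c B \<in> K" using hK[OF a] SK by (fastforce simp: handled_def)
  next
    show "infinite (- (X \<union> Y))" by (rule inf')
  next
    fix A assume "A \<in> K" then show "fv A \<subseteq> X \<union> Y" by (simp add: K_def)
  next
    fix A assume "ded T K A" "fv A \<subseteq> X \<union> Y"
    then show "A \<in> K" using dK by (simp add: K_def)
  qed
  moreover have "H \<subseteq> K" using S(1)[of 0] SK[of 0] by blast
  ultimately show ?thesis using \<open>A \<notin> K\<close> by blast
qed

lemma world_ded: "(X, H) \<in> worlds \<Longrightarrow> fv A \<subseteq> X \<Longrightarrow> A \<in> H \<longleftrightarrow> ded T H A"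
  by (auto simp: worlds_def intro: ded.hyp)

lemma world_fv: "(X, H) \<in> worlds \<Longrightarrow> A \<in> H \<Longrightarrow> fv A \<subseteq> X"
  by (auto simp: worlds_def)

lemma in_Conj: "w \<in> worlds \<Longrightarrow> fv (Conj A B) \<subseteq> fst w \<Longrightarrow> Conj A B \<in> snd w \<longleftrightarrow> A \<in> snd w \<and> B \<in> snd w"
  by (cases w) (simp add: world_ded ded_conj)

lemma in_Disj: "w \<in> worlds \<Longrightarrow> fv (Disj A B) \<subseteq> fst w \<Longrightarrow> Disj A B \<in> snd w \<longleftrightarrow> A \<in> snd w \<or> B \<in> snd w"
proof (cases w)
  case (Pair X H)
  assume a: "w \<in> worlds" "fv (Disj A B) \<subseteq> fst w"
  have "Disj A B \<in> H \<Longrightarrow> A \<in> H \<or> B \<in> H" using a Pair by (auto simp: worlds_def)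
  moreover have "A \<in> H \<or> B \<in> H \<Longrightarrow> Disj A B \<in> H"
    using a Pair by (auto simp: world_ded intro: ded.dmp[OF ded.dax[OF prov.disjI1]] ded.dmp[OF ded.dax[OF prov.disjI2]])
  ultimately show ?thesis using Pair by auto
qed

text \<open>If the implication is missing, then by the deduction theorem \<open>B\<close> is not
  derivable after adding \<open>A\<close>, and \<open>extend\<close> gives a later world that
  contains \<open>A\<close> but not \<open>B\<close>.\<close>

lemma in_Imp:
  assumes "w \<in> worlds" "fv (Imp A B) \<subseteq> fst w"
  shows "Imp A B \<in> snd w \<longleftrightarrow> (\<forall>w'. wle w w' \<longrightarrow> A \<in> snd w' \<longrightarrow> B \<in> snd w')"
proof (cases w)
  case (Pair X H)
  show ?thesis
  proof
    assume a: "Imp A B \<in> snd w"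
    show "\<forall>w'. wle w w' \<longrightarrow> A \<in> snd w' \<longrightarrow> B \<in> snd w'"
    proof (intro allI impI)
      fix w' assume w': "wle w w'" "A \<in> snd w'"
      obtain X' H' where [simp]: "w' = (X', H')" by force
      have "ded T H' (Imp A B)" "ded T H' A" using a w' by (auto simp: wle_def intro: ded.hyp)
      then have "ded T H' B" by (rule ded.dmp)
      then show "B \<in> snd w'" using assms w' by (auto simp: wle_def worlds_def)
    qed
  next
    assume a: "\<forall>w'. wle w w' \<longrightarrow> A \<in> snd w' \<longrightarrow> B \<in> snd w'"
    have "ded T (insert A H) B"
    proof (rule ccontr)
      assume "\<not> ded T (insert A H) B"
      then obtain X' H' where "(X', H') \<in> worlds" "X \<subseteq> X'" "insert A H \<subseteq> H'" "B \<notin> H'"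
        using extend[of X "insert A H" B] assms Pair by (auto simp: worlds_def)
      then show False using a[rule_format, of "(X', H')"] assms Pair by (auto simp: wle_def)
    qed
    then show "Imp A B \<in> snd w" using assms Pair by (simp add: world_ded ded_Imp)
  qed
qed

text \<open>A missing universal formula is refuted at a later world whose domain has a new variable
  \<open>c\<close>. Infinitely many variables being left over, \<open>c\<close> can be added before
  extending.\<close>

lemma in_All:
  assumes "w \<in> worlds" "fv (All A) \<subseteq> fst w"
  shows "All A \<in> snd w \<longleftrightarrow> (\<forall>w'. wle w w' \<longrightarrow> (\<forall>c\<in>fst w'. subst 0 c A \<in> snd w'))"
proof (cases w)
  case (Pair X H)
  show ?thesis
  proof
    assume a: "All A \<in> snd w"
    show "\<forall>w'. wle w w' \<longrightarrow> (\<forall>c\<in>fst w'. subst 0 c A \<in> snd w')"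
    proof (intro allI impI ballI)
      fix w' c assume w': "wle w w'" "c \<in> fst w'"
      obtain X' H' where [simp]: "w' = (X', H')" by force
      have "ded T H' (All A)" using a w' by (auto simp: wle_def intro: ded.hyp)
      then have "ded T H' (subst 0 c A)" by (rule ded_AllE)
      moreover have "fv (subst 0 c A) \<subseteq> X'" using fv_subst0[of c A] assms w' by (auto simp: wle_def)
      ultimately show "subst 0 c A \<in> snd w'" using w' by (auto simp: wle_def worlds_def)
    qed
  next
    assume a: "\<forall>w'. wle w w' \<longrightarrow> (\<forall>c\<in>fst w'. subst 0 c A \<in> snd w')"
    have "infinite (- X)" using assms Pair by (auto simp: worlds_def)
    then obtain c where c: "c \<notin> X" using infinite_imp_nonempty by blast
    have "- X = insert c (- insert c X)" using c by auto
    then have inf: "infinite (- insert c X)" using \<open>infinite (- X)\<close> by (metis finite_insert)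
    have "ded T H (subst 0 c A)"
    proof (rule ccontr)
      assume n: "\<not> ded T H (subst 0 c A)"
      have f: "fv (subst 0 c A) \<subseteq> insert c X" using fv_subst0[of c A] assms Pair by auto
      have "\<forall>B\<in>H. fv B \<subseteq> insert c X" using assms Pair world_fv by blast
      from extend[OF inf this f n]
      obtain X' H' where "(X', H') \<in> worlds" "insert c X \<subseteq> X'" "H \<subseteq> H'" "subst 0 c A \<notin> H'"
        by auto
      then show False using a[rule_format, of "(X', H')" c] assms Pair by (auto simp: wle_def)
    qed
    moreover have "c \<notin> \<Union> (fv ` H)" using c assms Pair world_fv by blast
    moreover have "c \<notin> fv (All A)" using c assms Pair by auto
    ultimately have "ded T H (All A)" by (intro ded_AllI[OF renT])
    then show "All A \<in> snd w" using assms Pair by (simp add: world_ded)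
  qed
qed

lemma in_Ex:
  assumes "w \<in> worlds" "fv (Ex A) \<subseteq> fst w"
  shows "Ex A \<in> snd w \<longleftrightarrow> (\<exists>c\<in>fst w. subst 0 c A \<in> snd w)"
proof (cases w)
  case (Pair X H)
  have "Ex A \<in> H \<Longrightarrow> \<exists>c\<in>X. subst 0 c A \<in> H" using assms Pair by (auto simp: worlds_def)
  moreover have "subst 0 c A \<in> H \<Longrightarrow> Ex A \<in> H" for c
    using assms Pair ded_ExI[OF ded.hyp, where T = T and c = c and A = A and G = H] by (auto simp: world_ded)
  ultimately show ?thesis using Pair by auto
qed

lemma in_Iff:
  assumes "w \<in> worlds" "prov T (Iff A B)" "fv A \<subseteq> fst w" "fv B \<subseteq> fst w"
  shows "A \<in> snd w \<longleftrightarrow> B \<in> snd w"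
  using assms by (cases w) (auto simp: world_ded ded_Iff)

definition mem :: "nat set \<times> fm set \<Rightarrow> nat \<Rightarrow> nat \<Rightarrow> bool" where
  "mem w i j \<longleftrightarrow> Mem i j \<in> snd w"

lemma kripke_canon: "r \<in> worlds \<Longrightarrow> kripke wle fst mem r"
  by unfold_locales (auto simp: wle_def mem_def)

definition truth :: "fm \<Rightarrow> bool" where
  "truth A \<longleftrightarrow> (\<forall>w v. w \<in> worlds \<longrightarrow> (\<forall>i. v i \<in> fst w) \<longrightarrow>
    (kripke.forces wle fst mem w v A \<longleftrightarrow> ren v A \<in> snd w))"

lemma truthI:
  assumes "\<And>w v. kripke wle fst mem w \<Longrightarrow> w \<in> worlds \<Longrightarrow> (\<And>i. v i \<in> fst w) \<Longrightarrow> fv (ren v A) \<subseteq> fst w \<Longrightarrow>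
    kripke.forces wle fst mem w v A \<longleftrightarrow> ren v A \<in> snd w"
  shows "truth A"
  unfolding truth_def by (intro allI impI assms kripke_canon) (auto simp: fv_ren)

lemma truthD: "truth A \<Longrightarrow> w \<in> worlds \<Longrightarrow> (\<And>i. v i \<in> fst w) \<Longrightarrow>
    kripke.forces wle fst mem w v A \<longleftrightarrow> ren v A \<in> snd w"
  unfolding truth_def by blast

lemma truthD_le: "truth A \<Longrightarrow> wle w w' \<Longrightarrow> (\<And>i. v i \<in> fst w) \<Longrightarrow>
    kripke.forces wle fst mem w' v A \<longleftrightarrow> ren v A \<in> snd w'"
  by (rule truthD) (auto simp: wle_def)

lemma truthD_econs: "truth A \<Longrightarrow> wle w w' \<Longrightarrow> (\<And>i. v i \<in> fst w) \<Longrightarrow> c \<in> fst w' \<Longrightarrow>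
    kripke.forces wle fst mem w' (c ## v) A \<longleftrightarrow> subst 0 c (ren (up v) A) \<in> snd w'"
  unfolding subst0_ren_up by (rule truthD) (auto simp: wle_def split: nat.splits)

lemma wle_refl: "w \<in> worlds \<Longrightarrow> wle w w"
  by (simp add: wle_def)

lemma truth_Mem: "truth (Mem i j)"
  by (rule truthI) (simp add: kripke.forces.simps mem_def)

lemma truth_Conj: "truth A \<Longrightarrow> truth B \<Longrightarrow> truth (Conj A B)"
  by (rule truthI) (simp add: kripke.forces.simps in_Conj truthD)

lemma truth_Imp: "truth A \<Longrightarrow> truth B \<Longrightarrow> truth (Imp A B)"
  by (rule truthI) (simp add: kripke.forces.simps in_Imp truthD_le del: split_paired_All)

lemma truth_All: "truth A \<Longrightarrow> truth (All A)"
  by (rule truthI)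
    (simp add: kripke.forces.simps in_All truthD_econs del: split_paired_All cong: ball_cong)

lemma truth_Ex: "truth A \<Longrightarrow> truth (Ex A)"
  by (rule truthI) (simp add: kripke.forces.simps in_Ex truthD_econs[OF _ wle_refl] cong: bex_cong)

text \<open>Reduces each bounded quantifier to its defining equivalence, which is provable on the
  syntactic side and valid by \<open>forces_bounded\<close> on the semantic side.\<close>

lemma truth_Iff:
  assumes "truth B" "fv B \<subseteq> fv A" "\<And>v. prov T (Iff (ren v A) (ren v B))"
    and "\<And>w v. kripke wle fst mem w \<Longrightarrow> kripke.forces wle fst mem w v A \<longleftrightarrow> kripke.forces wle fst mem w v B"
  shows "truth A"
proof (rule truthI)
  fix w v assume *: "kripke wle fst mem w" "w \<in> worlds" "\<And>i. v i \<in> fst w" "fv (ren v A) \<subseteq> fst w"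
  have "fv (ren v B) \<subseteq> fst w" using *(3) by (auto simp: fv_ren)
  then show "kripke.forces wle fst mem w v A \<longleftrightarrow> ren v A \<in> snd w"
    using in_Iff[OF *(2) assms(3) *(4)] truthD[OF assms(1) *(2,3)] assms(4)[OF *(1)] by simp
qed

lemma truth_BAll: "truth A \<Longrightarrow> truth (BAll i A)"
proof (rule truth_Iff)
  show "truth A \<Longrightarrow> truth (All (Imp (Mem 0 (Suc i)) A))"
    by (intro truth_All truth_Imp truth_Mem)
  show "prov T (Iff (ren v (BAll i A)) (ren v (All (Imp (Mem 0 (Suc i)) A))))" for v
    using prov.ball_def[of T "v i" "ren (up v) A"] by (simp)
qed (auto simp: kripke.forces_bounded simp del: kripke.forces.simps)

lemma truth_BEx: "truth A \<Longrightarrow> truth (BEx i A)"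
proof (rule truth_Iff)
  show "truth A \<Longrightarrow> truth (Ex (Conj (Mem 0 (Suc i)) A))"
    by (intro truth_Ex truth_Conj truth_Mem)
  show "prov T (Iff (ren v (BEx i A)) (ren v (Ex (Conj (Mem 0 (Suc i)) A))))" for v
    using prov.bex_def[of T "v i" "ren (up v) A"] by (simp)
qed (auto simp: kripke.forces_bounded simp del: kripke.forces.simps)

lemma truth_SAll: "truth A \<Longrightarrow> truth (SAll i A)"
proof (rule truth_Iff)
  show "truth A \<Longrightarrow> truth (All (Imp (Sub 0 (Suc i)) A))"
    unfolding Sub_def by (intro truth_All truth_Imp truth_BAll truth_Mem)
  show "prov T (Iff (ren v (SAll i A)) (ren v (All (Imp (Sub 0 (Suc i)) A))))" for v
    using prov.sall_def[of T "v i" "ren (up v) A"] by (simp add: Sub_def)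
qed (auto simp: Sub_def kripke.forces_bounded simp del: kripke.forces.simps)

lemma truth_SEx: "truth A \<Longrightarrow> truth (SEx i A)"
proof (rule truth_Iff)
  show "truth A \<Longrightarrow> truth (Ex (Conj (Sub 0 (Suc i)) A))"
    unfolding Sub_def by (intro truth_Ex truth_Conj truth_BAll truth_Mem)
  show "prov T (Iff (ren v (SEx i A)) (ren v (Ex (Conj (Sub 0 (Suc i)) A))))" for v
    using prov.sex_def[of T "v i" "ren (up v) A"] by (simp add: Sub_def)
qed (auto simp: Sub_def kripke.forces_bounded simp del: kripke.forces.simps)

lemma truth: "truth A"
proof (induction A)
  case Bot
  show ?case by (rule truthI) (auto simp: kripke.forces.simps worlds_def)
next
  case (Disj A B)
  then show ?case by (intro truthI) (simp add: kripke.forces.simps in_Disj truthD)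
qed (simp_all add: truth_Mem truth_Conj truth_Imp truth_All truth_Ex truth_BAll truth_BEx truth_SAll truth_SEx)

lemma completeness:
  assumes "fv A = {}" "\<not> prov T A"
  shows "\<exists>r v. kripke wle fst mem r \<and> (\<forall>i. v i \<in> fst r) \<and> \<not> kripke.forces wle fst mem r v A
    \<and> (\<forall>w v B. wle r w \<longrightarrow> (\<forall>i. v i \<in> fst w) \<longrightarrow> B \<in> T \<longrightarrow> kripke.forces wle fst mem w v B)"
proof -
  have "\<not> ded T {Top} A"
    using assms(2) by (metis Top_def ded.dax ded.dmp ded_Imp ded_empty prov_I)
  then obtain X H where w: "(X, H) \<in> worlds" "A \<notin> H"
    using extend[of "{}" "{Top}" A] assms by (auto simp: Top_def)
  \<comment> \<open>The witness of \<open>Ex Top\<close> shows that the domain of the root is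
    inhabited, so that an environment exists.\<close>
  have "ded T H (Ex Top)"
    by (rule ded_ExI[of _ _ 0]) (auto simp: Top_def intro: ded.dax prov_I)
  then have "Ex Top \<in> H" using w by (auto simp: worlds_def Top_def)
  then obtain c where c: "c \<in> X" using w by (auto simp: worlds_def)
  have "ren v A = A" for v using ren_cong[of A v id] assms(1) ren_id by simp
  then have "\<not> kripke.forces wle fst mem (X, H) (\<lambda>_. c) A"
    using truthD[OF truth w(1)] w c by simp
  moreover have "kripke.forces wle fst mem w v B" if "wle (X, H) w" "\<forall>i. v i \<in> fst w" "B \<in> T" for w v B
  proof -
    obtain Y K where [simp]: "w = (Y, K)" by force
    have "ren v B \<in> T" using renT that(3) by (auto simp: renclosed_def)
    then have "ded T K (ren v B)" by (intro ded.dax prov.ax)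
    moreover have "fv (ren v B) \<subseteq> Y" using that by (auto simp: fv_ren)
    ultimately have "ren v B \<in> snd w" using that by (auto simp: wle_def worlds_def)
    then show ?thesis using that by (subst truthD[OF truth]) (auto simp: wle_def)
  qed
  ultimately show ?thesis using kripke_canon[OF w(1)] c
    by (intro exI[of _ "(X, H)"] exI[of _ "\<lambda>_. c"]) auto
qed

end

section \<open>Set theory inside a Kripke model\<close>

context kripke
begin

text \<open>A term is a variable or a parameter from \<open>D w0\<close>, and \<open>definable d w0\<close> means definable with
  such parameters on all worlds above \<open>w0\<close>, by a \<open>\<Delta>\<^sub>0\<close>-formula if \<open>d\<close> holds.\<close>

definition tm :: "'w \<Rightarrow> ((nat \<Rightarrow> 'd) \<Rightarrow> 'd) \<Rightarrow> bool" where
  "tm w0 t \<longleftrightarrow> (\<exists>i. t = (\<lambda>u. u i)) \<or> (\<exists>c\<in>D w0. t = (\<lambda>_. c))"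

definition definable :: "bool \<Rightarrow> 'w \<Rightarrow> ('w \<Rightarrow> (nat \<Rightarrow> 'd) \<Rightarrow> bool) \<Rightarrow> bool" where
  "definable d w0 Q \<longleftrightarrow> (\<exists>A \<tau>. (d \<longrightarrow> delta0 A) \<and> (\<forall>i. tm w0 (\<tau> i)) \<and>
     (\<forall>w u. w0 \<preceq> w \<longrightarrow> (\<forall>i. u i \<in> D w) \<longrightarrow> (Q w u \<longleftrightarrow> forces w (\<lambda>i. \<tau> i u) A)))"

lemma tm_var: "tm w0 (\<lambda>u. u i)"
  by (auto simp: tm_def)

lemma tm_const: "c \<in> D w0 \<Longrightarrow> tm w0 (\<lambda>u. c)"
  by (auto simp: tm_def)

lemma tm_in: "tm w0 t \<Longrightarrow> w0 \<preceq> w \<Longrightarrow> (\<And>i. u i \<in> D w) \<Longrightarrow> t u \<in> D w"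
  by (auto simp: tm_def intro: D_mono)

lemma tm_comp: "tm w0 t \<Longrightarrow> (\<And>i. tm w0 (\<sigma> i)) \<Longrightarrow> tm w0 (\<lambda>u. t (\<lambda>i. \<sigma> i u))"
  by (auto simp: tm_def)

lemma tm_shift: "tm w0 t \<Longrightarrow> tm w0 (\<lambda>u. t (\<lambda>i. u (f i)))"
  by (auto simp: tm_def)

lemma tm_econs: "tm w0 t \<Longrightarrow> (\<And>i. tm w0 (\<sigma> i)) \<Longrightarrow> tm w0 ((t ## \<sigma>) i)"
  by (cases i) auto

lemma econs_app: "(\<lambda>i. (t ## \<sigma>) i u) = t u ## (\<lambda>i. \<sigma> i u)"
  by (auto simp: fun_eq_iff split: nat.splits)

lemma econs_in: "x \<in> D w \<Longrightarrow> (\<And>i. u i \<in> D w) \<Longrightarrow> (x ## u) i \<in> D w"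
  by (cases i) auto

lemma definable_forces: "(\<And>i. tm w0 (\<tau> i)) \<Longrightarrow> (d \<Longrightarrow> delta0 A) \<Longrightarrow> definable d w0 (\<lambda>w u. forces w (\<lambda>i. \<tau> i u) A)"
  unfolding definable_def by blast

lemma definable_cong:
  assumes "definable d w0 Q" "\<And>w u. w0 \<preceq> w \<Longrightarrow> (\<And>i. u i \<in> D w) \<Longrightarrow> Q' w u \<longleftrightarrow> Q w u"
  shows "definable d w0 Q'"
  using assms unfolding definable_def by metis

lemma definable_weaken: "definable True w0 Q \<Longrightarrow> definable d w0 Q"
  unfolding definable_def by blast

lemma definable_base: "definable d w0 Q \<Longrightarrow> w0 \<preceq> w1 \<Longrightarrow> definable d w1 Q"
proof -
  assume a: "definable d w0 Q" "w0 \<preceq> w1"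
  then obtain A \<tau> where A: "d \<longrightarrow> delta0 A" "\<forall>i. tm w0 (\<tau> i)"
    "\<And>w u. w0 \<preceq> w \<Longrightarrow> (\<forall>i. u i \<in> D w) \<Longrightarrow> (Q w u \<longleftrightarrow> forces w (\<lambda>i. \<tau> i u) A)"
    unfolding definable_def by blast
  have "tm w1 (\<tau> i)" for i using A(2)[rule_format, of i] a(2) unfolding tm_def by (blast intro: D_mono)
  moreover have "Q w u \<longleftrightarrow> forces w (\<lambda>i. \<tau> i u) A" if "w1 \<preceq> w" "\<forall>i. u i \<in> D w" for w u
    using A(3) that a(2) le_trans by blast
  ultimately show ?thesis unfolding definable_def using A(1) by blast
qed

lemma definable_mono:
  assumes "definable d w0 Q" "w0 \<preceq> w" "w \<preceq> w'" "\<And>i. u i \<in> D w" "Q w u"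
  shows "Q w' u"
proof -
  obtain A \<tau> where A: "d \<longrightarrow> delta0 A" "\<forall>i. tm w0 (\<tau> i)"
    "\<And>w u. w0 \<preceq> w \<Longrightarrow> (\<forall>i. u i \<in> D w) \<Longrightarrow> (Q w u \<longleftrightarrow> forces w (\<lambda>i. \<tau> i u) A)"
    using assms(1) unfolding definable_def by blast
  have "w0 \<preceq> w'" "\<forall>i. u i \<in> D w'" using assms le_trans D_mono by blast+
  then show ?thesis using A(3)[of w u] A(3)[of w' u] assms forces_mono by blast
qed

lemma definable_subst:
  assumes "definable d w0 Q" "\<And>i. tm w0 (\<sigma> i)"
  shows "definable d w0 (\<lambda>w u. Q w (\<lambda>i. \<sigma> i u))"
proof -
  obtain A \<tau> where A: "d \<longrightarrow> delta0 A" "\<forall>i. tm w0 (\<tau> i)"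
    "\<And>w u. w0 \<preceq> w \<Longrightarrow> (\<forall>i. u i \<in> D w) \<Longrightarrow> (Q w u \<longleftrightarrow> forces w (\<lambda>i. \<tau> i u) A)"
    using assms(1) unfolding definable_def by blast
  have "definable d w0 (\<lambda>w u. forces w (\<lambda>i. \<tau> i (\<lambda>j. \<sigma> j u)) A)"
    by (rule definable_forces) (use A assms(2) tm_comp in auto)
  then show ?thesis
  proof (rule definable_cong)
    fix w and u :: "nat \<Rightarrow> 'd" assume w: "w0 \<preceq> w" "\<And>i. u i \<in> D w"
    have "\<forall>i. \<sigma> i u \<in> D w" using tm_in[OF assms(2) w(1)] w(2) by blast
    then show "Q w (\<lambda>i. \<sigma> i u) \<longleftrightarrow> forces w (\<lambda>i. \<tau> i (\<lambda>j. \<sigma> j u)) A" by (rule A(3)[OF w(1)])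
  qed
qed

lemma definable_mem: "tm w0 s \<Longrightarrow> tm w0 t \<Longrightarrow> definable d w0 (\<lambda>w u. E w (s u) (t u))"
  using definable_forces[of w0 "s ## (\<lambda>_. t)" d "Mem 0 1"] by (simp add: tm_econs)

lemma definable_sub: "tm w0 s \<Longrightarrow> tm w0 t \<Longrightarrow> definable d w0 (\<lambda>w u. sub w (s u) (t u))"
  using definable_forces[of w0 "s ## (\<lambda>_. t)" d "Sub 0 1"] by (simp add: tm_econs forces_Sub) (simp add: Sub_def)

lemma definable_bot: "definable d w0 (\<lambda>w u. False)"
  using definable_forces[of w0 "\<lambda>_ u. u 0" d Bot] by (simp add: tm_var)

text \<open>The parameters of the two formulas are interleaved at even and odd indices, so that a
  connective can join formulas over one common environment.\<close>

lemma definable_merge: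
  assumes "definable d w0 P" "definable d w0 Q"
  obtains A B \<tau> where "d \<longrightarrow> delta0 A" "d \<longrightarrow> delta0 B" "\<And>i. tm w0 (\<tau> i)"
    "\<And>w u. w0 \<preceq> w \<Longrightarrow> (\<forall>i. u i \<in> D w) \<Longrightarrow> (P w u \<longleftrightarrow> forces w (\<lambda>i. \<tau> i u) A)"
    "\<And>w u. w0 \<preceq> w \<Longrightarrow> (\<forall>i. u i \<in> D w) \<Longrightarrow> (Q w u \<longleftrightarrow> forces w (\<lambda>i. \<tau> i u) B)"
proof -
  obtain A \<tau> where A: "d \<longrightarrow> delta0 A" "\<forall>i. tm w0 (\<tau> i)"
    "\<And>w u. w0 \<preceq> w \<Longrightarrow> (\<forall>i. u i \<in> D w) \<Longrightarrow> (P w u \<longleftrightarrow> forces w (\<lambda>i. \<tau> i u) A)"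
    using assms(1) unfolding definable_def by blast
  obtain B \<sigma> where B: "d \<longrightarrow> delta0 B" "\<forall>i. tm w0 (\<sigma> i)"
    "\<And>w u. w0 \<preceq> w \<Longrightarrow> (\<forall>i. u i \<in> D w) \<Longrightarrow> (Q w u \<longleftrightarrow> forces w (\<lambda>i. \<sigma> i u) B)"
    using assms(2) unfolding definable_def by blast
  show ?thesis
    by (rule that[of "ren (\<lambda>i. 2 * i) A" "ren (\<lambda>i. 2 * i + 1) B"
          "\<lambda>n. if even n then \<tau> (n div 2) else \<sigma> (n div 2)"])
      (use A B in \<open>simp_all add: delta0_ren forces_ren comp_def\<close>)
qed

lemma definable_connectives:
  assumes "definable d w0 P" "definable d w0 Q"
  shows definable_conj: "definable d w0 (\<lambda>w u. P w u \<and> Q w u)"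
    and definable_disj: "definable d w0 (\<lambda>w u. P w u \<or> Q w u)"
    and definable_imp: "definable d w0 (\<lambda>w u. \<forall>w'. w \<preceq> w' \<longrightarrow> P w' u \<longrightarrow> Q w' u)"
proof -
  obtain A B \<tau> where *: "d \<longrightarrow> delta0 A" "d \<longrightarrow> delta0 B" "\<And>i. tm w0 (\<tau> i)"
    "\<And>w u. w0 \<preceq> w \<Longrightarrow> (\<forall>i. u i \<in> D w) \<Longrightarrow> (P w u \<longleftrightarrow> forces w (\<lambda>i. \<tau> i u) A)"
    "\<And>w u. w0 \<preceq> w \<Longrightarrow> (\<forall>i. u i \<in> D w) \<Longrightarrow> (Q w u \<longleftrightarrow> forces w (\<lambda>i. \<tau> i u) B)"
    by (rule definable_merge[OF assms]) blast
  note rule = definable_cong[OF definable_forces[where \<tau> = \<tau>]]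
  show "definable d w0 (\<lambda>w u. P w u \<and> Q w u)"
    by (rule rule[of w0 d "Conj A B"]) (use * in auto)
  show "definable d w0 (\<lambda>w u. P w u \<or> Q w u)"
    by (rule rule[of w0 d "Disj A B"]) (use * in auto)
  show "definable d w0 (\<lambda>w u. \<forall>w'. w \<preceq> w' \<longrightarrow> P w' u \<longrightarrow> Q w' u)"
  proof (rule rule[of w0 d "Imp A B"])
    fix w and u :: "nat \<Rightarrow> 'd" assume w: "w0 \<preceq> w" "\<And>i. u i \<in> D w"
    have "w0 \<preceq> w'" "\<forall>i. u i \<in> D w'" if "w \<preceq> w'" for w'
      using w that le_trans D_mono by blast+
    then show "(\<forall>w'. w \<preceq> w' \<longrightarrow> P w' u \<longrightarrow> Q w' u) \<longleftrightarrow> forces w (\<lambda>i. \<tau> i u) (Imp A B)"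
      using *(4,5) by simp
  qed (use * in auto)
qed

text \<open>One free slot \<open>s\<close> is reserved for the bounding set of a bounded quantifier.\<close>

lemma definable_binder:
  assumes "definable d w0 (\<lambda>w u. Q w (u 0) (\<lambda>i. u (Suc i)))"
  obtains A \<tau> where "d \<longrightarrow> delta0 A" "\<And>i. tm w0 (\<tau> i)"
    "\<And>w u x s. w0 \<preceq> w \<Longrightarrow> (\<forall>i. u i \<in> D w) \<Longrightarrow> x \<in> D w \<Longrightarrow>
      (Q w x u \<longleftrightarrow> forces w (x ## (s ## (\<lambda>i. \<tau> i u))) A)"
proof -
  obtain A \<tau> where A: "d \<longrightarrow> delta0 A" "\<forall>i. tm w0 (\<tau> i)"
    "\<And>w u. w0 \<preceq> w \<Longrightarrow> (\<forall>i. u i \<in> D w) \<Longrightarrow> (Q w (u 0) (\<lambda>i. u (Suc i)) \<longleftrightarrow> forces w (\<lambda>i. \<tau> i u) A)"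
    using assms unfolding definable_def by blast
  \<comment> \<open>A term evaluated in \<open>x ## u\<close> is either \<open>x\<close> itself,
    recorded by \<open>k\<close>, or a term that depends on \<open>u\<close> alone.\<close>
  have "\<exists>t' k. tm w0 t' \<and> (\<forall>u x. \<tau> i (x ## u) = (if k then x else t' u))" for i
    using A(2)[rule_format, of i] unfolding tm_def[of _ "\<tau> i"]
  proof (elim disjE exE bexE)
    fix j assume j: "\<tau> i = (\<lambda>u. u j)"
    then show ?thesis
    proof (cases j)
      case 0
      then show ?thesis using j by (intro exI[of _ "\<lambda>u. u 0"] exI[of _ True]) (auto simp: tm_var)
    next
      case (Suc l)
      then show ?thesis using j by (intro exI[of _ "\<lambda>u. u l"] exI[of _ False]) (auto simp: tm_var)
    qed
  next
    fix c assume "c \<in> D w0" "\<tau> i = (\<lambda>_. c)"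
    then show ?thesis by (intro exI[of _ "\<lambda>u. c"] exI[of _ False]) (auto simp: tm_const)
  qed
  then obtain \<sigma> k where \<sigma>: "\<And>i. tm w0 (\<sigma> i)" "\<And>i u x. \<tau> i (x ## u) = (if k i then x else \<sigma> i u)"
    by metis
  show ?thesis
  \<comment> \<open>Occurrences of \<open>x\<close> go to index 0, and index 1 is skipped to leave
    room for the bounding set.\<close>
  proof (rule that[of "ren (\<lambda>i. if k i then 0 else Suc (Suc i)) A" \<sigma>])
    fix w x s and u :: "nat \<Rightarrow> 'd" assume w: "w0 \<preceq> w" "\<forall>i. u i \<in> D w" "x \<in> D w"
    have "Q w x u \<longleftrightarrow> forces w (\<lambda>i. \<tau> i (x ## u)) A"
      using A(3)[of w "x ## u"] w econs_in by auto
    also have "(\<lambda>i. \<tau> i (x ## u)) = (x ## (s ## (\<lambda>i. \<sigma> i u))) \<circ> (\<lambda>i. if k i then 0 else Suc (Suc i))"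
      by (auto simp: \<sigma>(2))
    finally show "Q w x u \<longleftrightarrow>
      forces w (x ## (s ## (\<lambda>i. \<sigma> i u))) (ren (\<lambda>i. if k i then 0 else Suc (Suc i)) A)"
      by (simp only: forces_ren)
  qed (use A \<sigma> in \<open>simp_all add: delta0_ren\<close>)
qed

lemma definable_quantifier:
  assumes Q: "definable d w0 (\<lambda>w u. Q w (u 0) (\<lambda>i. u (Suc i)))"
  shows definable_all: "\<not> d \<Longrightarrow> definable d w0 (\<lambda>w u. \<forall>w'. w \<preceq> w' \<longrightarrow> (\<forall>x\<in>D w'. Q w' x u))"
    and definable_ex: "\<not> d \<Longrightarrow> definable d w0 (\<lambda>w u. \<exists>x\<in>D w. Q w x u)"
    and definable_ball: "tm w0 t \<Longrightarrow>
      definable d w0 (\<lambda>w u. \<forall>w'. w \<preceq> w' \<longrightarrow> (\<forall>x\<in>D w'. E w' x (t u) \<longrightarrow> Q w' x u))"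
    and definable_bex: "tm w0 t \<Longrightarrow> definable d w0 (\<lambda>w u. \<exists>x\<in>D w. E w x (t u) \<and> Q w x u)"
    and definable_sall: "tm w0 t \<Longrightarrow>
      definable d w0 (\<lambda>w u. \<forall>w'. w \<preceq> w' \<longrightarrow> (\<forall>x\<in>D w'. sub w' x (t u) \<longrightarrow> Q w' x u))"
    and definable_sex: "tm w0 t \<Longrightarrow> definable d w0 (\<lambda>w u. \<exists>x\<in>D w. sub w x (t u) \<and> Q w x u)"
proof -
  obtain A \<tau> where A: "d \<longrightarrow> delta0 A" "\<And>i. tm w0 (\<tau> i)"
    "\<And>w u x s. w0 \<preceq> w \<Longrightarrow> (\<forall>i. u i \<in> D w) \<Longrightarrow> x \<in> D w \<Longrightarrow>
      (Q w x u \<longleftrightarrow> forces w (x ## (s ## (\<lambda>i. \<tau> i u))) A)"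
    by (rule definable_binder[OF Q]) blast
  have key: "Q w' x u \<longleftrightarrow> forces w' (x ## (s ## (\<lambda>i. \<tau> i u))) A"
    if "w0 \<preceq> w" "\<And>i. u i \<in> D w" "w \<preceq> w'" "x \<in> D w'" for w w' x s and u :: "nat \<Rightarrow> 'd"
  proof -
    have "w0 \<preceq> w'" "\<forall>i. u i \<in> D w'" using that le_trans D_mono by blast+
    then show ?thesis using A(3) that by blast
  qed
  note rules = definable_forces[where \<tau> = "t ## \<tau>" for t]
  show "definable d w0 (\<lambda>w u. \<forall>w'. w \<preceq> w' \<longrightarrow> (\<forall>x\<in>D w'. Q w' x u))" if "\<not> d"
  proof (rule definable_cong[OF rules[of w0 "\<tau> 0" d "All A"]])
    fix w and u :: "nat \<Rightarrow> 'd" assume w: "w0 \<preceq> w" "\<And>i. u i \<in> D w"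
    show "(\<forall>w'. w \<preceq> w' \<longrightarrow> (\<forall>x\<in>D w'. Q w' x u)) \<longleftrightarrow> forces w (\<lambda>i. (\<tau> 0 ## \<tau>) i u) (All A)"
      by (simp add: econs_app key[OF w, where s = "\<tau> 0 u"] A(3)[of w u _ "\<tau> 0 u", OF w(1)] w(2) cong: ball_cong bex_cong)
  qed (use A that in \<open>simp_all add: tm_econs\<close>)
  show "definable d w0 (\<lambda>w u. \<exists>x\<in>D w. Q w x u)" if "\<not> d"
  proof (rule definable_cong[OF rules[of w0 "\<tau> 0" d "Ex A"]])
    fix w and u :: "nat \<Rightarrow> 'd" assume w: "w0 \<preceq> w" "\<And>i. u i \<in> D w"
    show "(\<exists>x\<in>D w. Q w x u) \<longleftrightarrow> forces w (\<lambda>i. (\<tau> 0 ## \<tau>) i u) (Ex A)"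
      by (simp add: econs_app key[OF w, where s = "\<tau> 0 u"] A(3)[of w u _ "\<tau> 0 u", OF w(1)] w(2) cong: ball_cong bex_cong)
  qed (use A that in \<open>simp_all add: tm_econs\<close>)
  show "definable d w0 (\<lambda>w u. \<forall>w'. w \<preceq> w' \<longrightarrow> (\<forall>x\<in>D w'. E w' x (t u) \<longrightarrow> Q w' x u))" if "tm w0 t"
  proof (rule definable_cong[OF rules[of w0 "t" d "BAll 0 A"]])
    fix w and u :: "nat \<Rightarrow> 'd" assume w: "w0 \<preceq> w" "\<And>i. u i \<in> D w"
    show "(\<forall>w'. w \<preceq> w' \<longrightarrow> (\<forall>x\<in>D w'. E w' x (t u) \<longrightarrow> Q w' x u)) \<longleftrightarrow> forces w (\<lambda>i. (t ## \<tau>) i u) (BAll 0 A)"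
      by (simp add: econs_app key[OF w, where s = "t u"] A(3)[of w u _ "t u", OF w(1)] w(2) cong: ball_cong bex_cong)
  qed (use A that in \<open>simp_all add: tm_econs\<close>)
  show "definable d w0 (\<lambda>w u. \<exists>x\<in>D w. E w x (t u) \<and> Q w x u)" if "tm w0 t"
  proof (rule definable_cong[OF rules[of w0 "t" d "BEx 0 A"]])
    fix w and u :: "nat \<Rightarrow> 'd" assume w: "w0 \<preceq> w" "\<And>i. u i \<in> D w"
    show "(\<exists>x\<in>D w. E w x (t u) \<and> Q w x u) \<longleftrightarrow> forces w (\<lambda>i. (t ## \<tau>) i u) (BEx 0 A)"
      by (simp add: econs_app key[OF w, where s = "t u"] A(3)[of w u _ "t u", OF w(1)] w(2) cong: ball_cong bex_cong)
  qed (use A that in \<open>simp_all add: tm_econs\<close>)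
  show "definable d w0 (\<lambda>w u. \<forall>w'. w \<preceq> w' \<longrightarrow> (\<forall>x\<in>D w'. sub w' x (t u) \<longrightarrow> Q w' x u))" if "tm w0 t"
  proof (rule definable_cong[OF rules[of w0 "t" d "SAll 0 A"]])
    fix w and u :: "nat \<Rightarrow> 'd" assume w: "w0 \<preceq> w" "\<And>i. u i \<in> D w"
    show "(\<forall>w'. w \<preceq> w' \<longrightarrow> (\<forall>x\<in>D w'. sub w' x (t u) \<longrightarrow> Q w' x u)) \<longleftrightarrow> forces w (\<lambda>i. (t ## \<tau>) i u) (SAll 0 A)"
      by (simp add: econs_app key[OF w, where s = "t u"] A(3)[of w u _ "t u", OF w(1)] w(2) cong: ball_cong bex_cong)
  qed (use A that in \<open>simp_all add: tm_econs\<close>)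
  show "definable d w0 (\<lambda>w u. \<exists>x\<in>D w. sub w x (t u) \<and> Q w x u)" if "tm w0 t"
  proof (rule definable_cong[OF rules[of w0 "t" d "SEx 0 A"]])
    fix w and u :: "nat \<Rightarrow> 'd" assume w: "w0 \<preceq> w" "\<And>i. u i \<in> D w"
    show "(\<exists>x\<in>D w. sub w x (t u) \<and> Q w x u) \<longleftrightarrow> forces w (\<lambda>i. (t ## \<tau>) i u) (SEx 0 A)"
      by (simp add: econs_app key[OF w, where s = "t u"] A(3)[of w u _ "t u", OF w(1)] w(2) cong: ball_cong bex_cong)
  qed (use A that in \<open>simp_all add: tm_econs\<close>)
qed

lemmas definable_intros = tm_var tm_const definable_mem definable_sub definable_bot definable_conj
  definable_disj definable_ball definable_bex definable_sall definable_sex definable_imp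

text \<open>The normal form in which the axiom schemes are applied: one formula whose first two
  variables are the arguments and whose other variables are parameters. The predicate depends on two
  slots only, so \<open>c\<close> can fill all others.\<close>

lemma definable_inst2:
  assumes "definable d w0 (\<lambda>w u. P w (u 0) (u 1))" "c \<in> D w0"
  obtains A v where "d \<longrightarrow> delta0 A" "\<And>i. v i \<in> D w0"
    "\<And>w x y. w0 \<preceq> w \<Longrightarrow> x \<in> D w \<Longrightarrow> y \<in> D w \<Longrightarrow> P w x y \<longleftrightarrow> forces w (x ## (y ## v)) A"
proof -
  obtain A \<tau> where A: "d \<longrightarrow> delta0 A" "\<forall>i. tm w0 (\<tau> i)"
    "\<And>w u. w0 \<preceq> w \<Longrightarrow> (\<forall>i. u i \<in> D w) \<Longrightarrow> (P w (u 0) (u 1) \<longleftrightarrow> forces w (\<lambda>i. \<tau> i u) A)"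
    using assms unfolding definable_def by blast
  have "\<exists>(j::nat) t. t \<in> D w0 \<and> (\<forall>x y. \<tau> i (x ## (y ## (\<lambda>_. c))) = (if j = 0 then x else if j = 1 then y else t))" for i
    using A(2)[rule_format, of i] unfolding tm_def[of _ "\<tau> i"]
  proof (elim disjE exE bexE)
    fix j assume "\<tau> i = (\<lambda>u. u j)"
    then show ?thesis using assms(2)
      by (intro exI[of _ j] exI[of _ c]) (auto split: nat.splits)
  next
    fix e assume "e \<in> D w0" "\<tau> i = (\<lambda>_. e)"
    then show ?thesis by (intro exI[of _ "2::nat"] exI[of _ e]) auto
  qed
  then obtain j v where *: "\<And>i. v i \<in> D w0"
    "\<And>i x y. \<tau> i (x ## (y ## (\<lambda>_. c))) = (if j i = (0::nat) then x else if j i = 1 then y else v i)"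
    by metis
  show ?thesis
  proof (rule that[of "ren (\<lambda>i. if j i = 0 then 0 else if j i = 1 then 1 else Suc (Suc i)) A" v])
    fix w x y assume w: "w0 \<preceq> w" "x \<in> D w" "y \<in> D w"
    have "c \<in> D w" using assms(2) w(1) D_mono by blast
    then have "\<forall>i. (x ## (y ## (\<lambda>_. c))) i \<in> D w" using w by (auto split: nat.splits)
    then have "P w x y \<longleftrightarrow> forces w (\<lambda>i. \<tau> i (x ## (y ## (\<lambda>_. c)))) A"
      using A(3)[of w "x ## (y ## (\<lambda>_. c))"] w by auto
    also have "(\<lambda>i. \<tau> i (x ## (y ## (\<lambda>_. c)))) =
        (x ## (y ## v)) \<circ> (\<lambda>i. if j i = 0 then 0 else if j i = 1 then 1 else Suc (Suc i))"
      by (auto simp: *(2))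
    finally show "P w x y \<longleftrightarrow>
      forces w (x ## (y ## v)) (ren (\<lambda>i. if j i = 0 then 0 else if j i = 1 then 1 else Suc (Suc i)) A)"
      by (simp only: forces_ren)
  qed (use A * in \<open>simp_all add: delta0_ren\<close>)
qed

lemma forces_mp: "w \<preceq> w \<Longrightarrow> forces w v (Imp A B) \<Longrightarrow> forces w v A \<Longrightarrow> forces w v B"
  unfolding forces.simps by blast

lemma forces_IffD: "w \<preceq> w \<Longrightarrow> forces w v (Iff A B) \<Longrightarrow> forces w v A \<longleftrightarrow> forces w v B"
  unfolding Iff_def forces.simps by blast

definition eq :: "'w \<Rightarrow> 'd \<Rightarrow> 'd \<Rightarrow> bool" where
  "eq w x y \<longleftrightarrow> sub w x y \<and> sub w y x"

lemma forces_Eqd: "forces w v (Eqd i j) \<longleftrightarrow> eq w (v i) (v j)"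
  by (simp add: Eqd_def eq_def sub_def)

end

section \<open>Consequences of the axioms in a Kripke model\<close>

locale ikpp_model = kripke le D E r
  for le :: "'w \<Rightarrow> 'w \<Rightarrow> bool" (infix "\<preceq>" 50) and D :: "'w \<Rightarrow> 'd set" and E r +
  assumes ikpp: "r \<preceq> w \<Longrightarrow> (\<And>i. v i \<in> D w) \<Longrightarrow> A \<in> IKPP \<Longrightarrow> forces w v A"
begin

lemma sub_refl: "sub w x x"
  by (simp add: sub_def)

lemma sub_trans: "sub w x y \<Longrightarrow> sub w y z \<Longrightarrow> sub w x z"
  by (simp add: sub_def)

lemma subD: "r \<preceq> w \<Longrightarrow> sub w x y \<Longrightarrow> u \<in> D w \<Longrightarrow> E w u x \<Longrightarrow> E w u y"
  by (auto simp: sub_def dest: le_refl)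

lemma eq_refl: "eq w x x"
  by (simp add: eq_def sub_refl)

lemma eq_sym: "eq w x y \<Longrightarrow> eq w y x"
  by (simp add: eq_def)

lemma eq_trans: "eq w x y \<Longrightarrow> eq w y z \<Longrightarrow> eq w x z"
  unfolding eq_def by (meson sub_trans)

lemma definable_eq: "tm w0 s \<Longrightarrow> tm w0 t \<Longrightarrow> definable d w0 (\<lambda>w u. eq w (s u) (t u))"
  unfolding eq_def by (intro definable_intros)

lemma ext:
  assumes P: "definable True w0 (\<lambda>w u. P w (u 0))" and w: "r \<preceq> w0" "w0 \<preceq> w" "x \<in> D w" "y \<in> D w"
    and "eq w x y" "P w x"
  shows "P w y"
proof -
  have P': "definable True w (\<lambda>w u. P w (u 0))" by (rule definable_base[OF P w(2)])
  have rw: "r \<preceq> w" using w le_trans by blast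
  obtain A v where A: "True \<longrightarrow> delta0 A" "\<And>i. v i \<in> D w"
    "\<And>w' x y. w \<preceq> w' \<Longrightarrow> x \<in> D w' \<Longrightarrow> y \<in> D w' \<Longrightarrow> P w' x \<longleftrightarrow> forces w' (x ## (y ## v)) A"
    by (rule definable_inst2[of True w "\<lambda>w x y. P w x", OF P' w(3)]) blast
  \<comment> \<open>Index 0 of \<open>B\<close> is replaced by \<open>x\<close> or by
    \<open>y\<close> in the axiom, under the environment \<open>x ## (y ## v)\<close>. The shift by
    3 makes the parameters of \<open>A\<close> skip \<open>x\<close> and \<open>y\<close> and still
    point into \<open>v\<close>.\<close>
  define B where "B = ren (0 ## (1 ## (\<lambda>i. i + 3))) A"
  have "Imp (Conj (Eqd 0 1) (subst 0 0 B)) (subst 0 1 B) \<in> IKPP"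
    unfolding IKPP_def Ext_ax_def B_def using A(1) delta0_ren by blast
  then have "forces w (x ## (y ## v)) (Imp (Conj (Eqd 0 1) (subst 0 0 B)) (subst 0 1 B))"
    by (intro ikpp rw econs_in w A)
  moreover have *: "(x ## (y ## v)) \<circ> ((0 ## id) \<circ> (0 ## (1 ## (\<lambda>i. i + 3)))) = x ## (x ## v)"
    "(x ## (y ## v)) \<circ> ((1 ## id) \<circ> (0 ## (1 ## (\<lambda>i. i + 3)))) = y ## (x ## v)"
    by (auto simp: fun_eq_iff eval_nat_numeral split: nat.splits)
  ultimately show ?thesis
    using assms(6,7) A(3)[of w x x] A(3)[of w y x] le_refl[OF rw] w
    by (simp add: forces_Eqd subst0_ren forces_ren B_def ren_ren comp_assoc)
qed

lemma separation:
  assumes P: "definable True w (\<lambda>w u. P w (u 0))" and w: "r \<preceq> w" "a \<in> D w"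
  obtains y where "y \<in> D w"
    "\<And>w' x. w \<preceq> w' \<Longrightarrow> x \<in> D w' \<Longrightarrow> E w' x y \<longleftrightarrow> E w' x a \<and> P w' x"
proof -
  obtain A v where A: "True \<longrightarrow> delta0 A" "\<And>i. v i \<in> D w"
    "\<And>w' x y. w \<preceq> w' \<Longrightarrow> x \<in> D w' \<Longrightarrow> y \<in> D w' \<Longrightarrow> P w' x \<longleftrightarrow> forces w' (x ## (y ## v)) A"
    by (rule definable_inst2[of True w "\<lambda>w x y. P w x", OF P w(2)]) blast
  have "Ex (All (Iff (Mem 0 1) (Conj (Mem 0 (Suc (Suc 0))) (lift 1 A)))) \<in> IKPP"
    unfolding IKPP_def Sep_ax_def using A(1) by blast
  then have "forces w (a ## v) (Ex (All (Iff (Mem 0 1) (Conj (Mem 0 (Suc (Suc 0))) (lift 1 A)))))"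
    by (intro ikpp econs_in w A)
  then obtain y where y: "y \<in> D w"
    "forces w (y ## (a ## v)) (All (Iff (Mem 0 1) (Conj (Mem 0 (Suc (Suc 0))) (lift 1 A))))"
    unfolding forces.simps(7) by (rule bexE)
  show ?thesis
  proof (rule that[OF y(1)])
    fix w' x assume w': "w \<preceq> w'" "x \<in> D w'"
    have a: "a \<in> D w'" "w' \<preceq> w'" using w' w D_mono le_refl le_trans by blast+
    have "(x ## (y ## (a ## v))) \<circ> lv 1 = x ## (a ## v)"
      by (auto simp: fun_eq_iff lv_def split: nat.splits)
    then have *: "forces w' (x ## (y ## (a ## v))) (lift 1 A) \<longleftrightarrow> P w' x"
      using A(3)[of w' x a] w' a by (simp add: lift_ren forces_ren)
    have "forces w' (x ## (y ## (a ## v))) (Iff (Mem 0 1) (Conj (Mem 0 (Suc (Suc 0))) (lift 1 A)))"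
      using y(2) w' unfolding forces.simps(6) by blast
    from forces_IffD[OF a(2) this] have "E w' x y \<longleftrightarrow> E w' x a \<and> forces w' (x ## (y ## (a ## v))) (lift 1 A)"
      by simp
    with * show "E w' x y \<longleftrightarrow> E w' x a \<and> P w' x" by blast
  qed
qed

lemma collection:
  assumes P: "definable True w (\<lambda>w u. P w (u 0) (u 1))" and w: "r \<preceq> w" "a \<in> D w"
    and ex: "\<And>w' x. w \<preceq> w' \<Longrightarrow> x \<in> D w' \<Longrightarrow> E w' x a \<Longrightarrow> \<exists>y\<in>D w'. P w' y x"
  obtains z where "z \<in> D w"
    "\<And>w' x. w \<preceq> w' \<Longrightarrow> x \<in> D w' \<Longrightarrow> E w' x a \<Longrightarrow> \<exists>y\<in>D w'. E w' y z \<and> P w' y x"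
proof -
  obtain A v where A: "True \<longrightarrow> delta0 A" "\<And>i. v i \<in> D w"
    "\<And>w' x y. w \<preceq> w' \<Longrightarrow> x \<in> D w' \<Longrightarrow> y \<in> D w' \<Longrightarrow> P w' x y \<longleftrightarrow> forces w' (x ## (y ## v)) A"
    by (rule definable_inst2[OF P w(2)]) blast
  \<comment> \<open>In the axiom \<open>B\<close> is evaluated at
    \<open>y ## (x ## (a ## v))\<close>, so the parameters of \<open>A\<close> have to skip
    \<open>a\<close>.\<close>
  define B where "B = ren (0 ## (1 ## (\<lambda>i. i + 3))) A"
  have "Imp (BAll 0 (Ex B)) (Ex (BAll (Suc 0) (BEx 1 (lift 2 B)))) \<in> IKPP"
    unfolding IKPP_def Coll_ax_def using A(1) by (auto simp: B_def delta0_ren)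
  then have imp: "forces w (a ## v) (Imp (BAll 0 (Ex B)) (Ex (BAll (Suc 0) (BEx 1 (lift 2 B)))))"
    by (intro ikpp econs_in w A)
  have B1: "forces w' (y ## (x ## (a ## v))) B \<longleftrightarrow> P w' y x"
    if "w \<preceq> w'" "x \<in> D w'" "y \<in> D w'" for w' x y
  proof -
    have "(y ## (x ## (a ## v))) \<circ> (0 ## (1 ## (\<lambda>i. i + 3))) = y ## (x ## v)"
      by (auto simp: fun_eq_iff eval_nat_numeral split: nat.splits)
    then show ?thesis using A(3)[of w' y x] that by (simp add: B_def forces_ren)
  qed
  have B2: "forces w' (y ## (x ## (z ## (a ## v)))) (lift 2 B) \<longleftrightarrow> P w' y x"
    if "w \<preceq> w'" "x \<in> D w'" "y \<in> D w'" for w' x y z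
  proof -
    have "(y ## (x ## (z ## (a ## v)))) \<circ> lv 2 = y ## (x ## (a ## v))"
      by (auto simp: fun_eq_iff eval_nat_numeral lv_def split: nat.splits)
    then show ?thesis using B1 that by (simp add: lift_ren forces_ren)
  qed
  have "forces w (a ## v) (BAll 0 (Ex B))"
    using ex by (simp add: B1 cong: ball_cong bex_cong)
  then have "forces w (a ## v) (Ex (BAll (Suc 0) (BEx 1 (lift 2 B))))"
    by (rule forces_mp[OF le_refl[OF w(1)] imp])
  then have "\<exists>z\<in>D w. \<forall>w'. w \<preceq> w' \<longrightarrow> (\<forall>x\<in>D w'. E w' x a \<longrightarrow> (\<exists>y\<in>D w'. E w' y z \<and> P w' y x))"
    by (simp add: B2 cong: ball_cong bex_cong)
  then show ?thesis using that by blast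
qed

lemma induction:
  assumes P: "definable False w (\<lambda>w u. P w (u 0))" and w: "r \<preceq> w"
    and step: "\<And>w' x. w \<preceq> w' \<Longrightarrow> x \<in> D w' \<Longrightarrow>
      (\<And>w'' y. w' \<preceq> w'' \<Longrightarrow> y \<in> D w'' \<Longrightarrow> E w'' y x \<Longrightarrow> P w'' y) \<Longrightarrow> P w' x"
    and x: "x \<in> D w"
  shows "P w x"
proof -
  obtain A v where A: "False \<longrightarrow> delta0 A" "\<And>i. v i \<in> D w"
    "\<And>w' x y. w \<preceq> w' \<Longrightarrow> x \<in> D w' \<Longrightarrow> y \<in> D w' \<Longrightarrow> P w' x \<longleftrightarrow> forces w' (x ## (y ## v)) A"
    by (rule definable_inst2[of False w "\<lambda>w x y. P w x", OF P x]) blast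
  have "Imp (All (Imp (BAll 0 (lift 1 A)) A)) (All A) \<in> IKPP"
    unfolding IKPP_def Ind_ax_def by blast
  then have f: "forces w (x ## v) (Imp (All (Imp (BAll 0 (lift 1 A)) A)) (All A))"
    by (intro ikpp econs_in w A x)
  have A': "forces w' (y ## (x ## v)) A \<longleftrightarrow> P w' y" if "w \<preceq> w'" "y \<in> D w'" for w' y
    using A(3)[of w' y x] that D_mono[OF that(1) x] by simp
  have "(y ## (z ## (x ## v))) \<circ> lv 1 = y ## (x ## v)" for y z
    by (auto simp: fun_eq_iff lv_def split: nat.splits)
  then have A'': "forces w' (y ## (z ## (x ## v))) (lift 1 A) \<longleftrightarrow> P w' y" if "w \<preceq> w'" "y \<in> D w'" for w' y z
    using A' that by (simp add: lift_ren forces_ren)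
  have "forces w (x ## v) (All (Imp (BAll 0 (lift 1 A)) A))"
    unfolding forces.simps nat.case
  proof (intro allI impI ballI)
    fix w1 y w2
    assume w1: "w \<preceq> w1" "y \<in> D w1" "w1 \<preceq> w2"
      and IH: "\<forall>w'. w2 \<preceq> w' \<longrightarrow> (\<forall>u\<in>D w'. E w' u y \<longrightarrow> forces w' (u ## (y ## (x ## v))) (lift 1 A))"
    have w2: "w \<preceq> w2" "y \<in> D w2" using w1 le_trans D_mono by blast+
    have "P w2 y"
      by (rule step[OF w2]) (use IH A'' le_trans[OF w2(1)] in blast)
    then show "forces w2 (y ## (x ## v)) A" using A' w2 by blast
  qed
  then show ?thesis using f A'[of w x] x le_refl[OF w] by simp
qed

lemma pairing:
  assumes "r \<preceq> w" "a \<in> D w" "b \<in> D w"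
  obtains y where "y \<in> D w" "E w a y" "E w b y"
proof -
  have "Ex (Conj (Mem (Suc 0) 0) (Mem (Suc 1) 0)) \<in> IKPP"
    unfolding IKPP_def Pair_ax_def by blast
  then have "forces w (a ## (\<lambda>_. b)) (Ex (Conj (Mem (Suc 0) 0) (Mem (Suc 1) 0)))"
    by (intro ikpp econs_in assms)
  then show ?thesis using that by auto
qed

lemma union:
  assumes "r \<preceq> w" "a \<in> D w"
  obtains y where "y \<in> D w" "\<And>w' x. w \<preceq> w' \<Longrightarrow> x \<in> D w' \<Longrightarrow> E w' x a \<Longrightarrow> sub w' x y"
proof -
  have "Ex (BAll (Suc 0) (BAll 0 (Mem 0 2))) \<in> IKPP"
    unfolding IKPP_def Union_ax_def by blast
  then have "forces w (\<lambda>_. a) (Ex (BAll (Suc 0) (BAll 0 (Mem 0 2))))"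
    by (intro ikpp econs_in assms)
  then obtain y where y: "y \<in> D w" "\<forall>w'. w \<preceq> w' \<longrightarrow> (\<forall>x\<in>D w'. E w' x a \<longrightarrow>
    (\<forall>w''. w' \<preceq> w'' \<longrightarrow> (\<forall>u\<in>D w''. E w'' u x \<longrightarrow> E w'' u y)))" by auto
  show ?thesis
    by (rule that[OF y(1)]) (use y(2) in \<open>simp add: sub_def\<close>)
qed

lemma powerset:
  assumes "r \<preceq> w" "a \<in> D w"
  obtains y where "y \<in> D w" "\<And>w' x. w \<preceq> w' \<Longrightarrow> x \<in> D w' \<Longrightarrow> sub w' x a \<Longrightarrow> E w' x y"
proof -
  have "Ex (SAll (Suc 0) (Mem 0 1)) \<in> IKPP"
    unfolding IKPP_def Pow_ax_def by blast
  then have "forces w (\<lambda>_. a) (Ex (SAll (Suc 0) (Mem 0 1)))"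
    by (intro ikpp econs_in assms)
  then show ?thesis using that by auto
qed

lemma infinity:
  assumes "r \<preceq> w" "a \<in> D w"
  obtains z x where "z \<in> D w" "x \<in> D w" "E w x z"
    "\<And>w' x. w \<preceq> w' \<Longrightarrow> x \<in> D w' \<Longrightarrow> E w' x z \<Longrightarrow> \<exists>y\<in>D w'. E w' y z \<and> E w' x y"
proof -
  have "Ex (Conj (Ex (Mem 0 1)) (BAll 0 (BEx 1 (Mem 1 0)))) \<in> IKPP"
    unfolding IKPP_def Inf_ax_def by blast
  then have "forces w (\<lambda>_. a) (Ex (Conj (Ex (Mem 0 1)) (BAll 0 (BEx 1 (Mem 1 0)))))"
    by (intro ikpp econs_in assms)
  then obtain z x where "z \<in> D w" "x \<in> D w" "E w x z"
    "\<forall>w'. w \<preceq> w' \<longrightarrow> (\<forall>x\<in>D w'. E w' x z \<longrightarrow> (\<exists>y\<in>D w'. E w' y z \<and> E w' x y))" by auto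
  then show ?thesis using that by blast
qed

text \<open>Separating by \<open>P\<close> from an inhabited set turns a Delta_0-statement into a
  set that is inhabited exactly where \<open>P\<close> holds. Statements thereby become parameters,
  and implications become bounded quantifiers.\<close>

lemma truth_value:
  assumes P: "definable True w (\<lambda>w u. P w)" and w: "r \<preceq> w" "a \<in> D w"
  obtains c where "c \<in> D w" "\<And>w'. w \<preceq> w' \<Longrightarrow> (\<exists>x\<in>D w'. E w' x c) \<longleftrightarrow> P w'"
proof -
  obtain z x where z: "z \<in> D w" "x \<in> D w" "E w x z" by (rule infinity[OF w])
  obtain c where c: "c \<in> D w" "\<And>w' x. w \<preceq> w' \<Longrightarrow> x \<in> D w' \<Longrightarrow> E w' x c \<longleftrightarrow> E w' x z \<and> P w'"
    by (rule separation[OF P w(1) z(1)]) blast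
  show ?thesis
    by (rule that[OF c(1)]) (use c(2) z D_mono E_mono in blast)
qed

lemma join:
  assumes "r \<preceq> w" "a \<in> D w" "b \<in> D w"
  obtains c where "c \<in> D w" "sub w a c" "sub w b c"
proof -
  obtain y where y: "y \<in> D w" "E w a y" "E w b y" by (rule pairing[OF assms])
  obtain c where c: "c \<in> D w" "\<And>w' x. w \<preceq> w' \<Longrightarrow> x \<in> D w' \<Longrightarrow> E w' x y \<Longrightarrow> sub w' x c"
    by (rule union[OF assms(1) y(1)]) blast
  show ?thesis
    by (rule that[OF c(1)]) (rule c(2)[OF le_refl[OF assms(1)]], use y assms in simp_all)+
qed

lemma empty:
  assumes "r \<preceq> w" "a \<in> D w"
  obtains e where "e \<in> D w" "\<And>w' x. w \<preceq> w' \<Longrightarrow> x \<in> D w' \<Longrightarrow> \<not> E w' x e"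
proof -
  obtain y where "y \<in> D w" "\<And>w' x. w \<preceq> w' \<Longrightarrow> x \<in> D w' \<Longrightarrow> E w' x y \<longleftrightarrow> E w' x a \<and> False"
    by (rule separation[OF definable_bot assms]) blast
  then show ?thesis using that by blast
qed

text \<open>Pairing and union yield only supersets, so the exact set is separated from a large one.
  Extensionality is what puts sets equal to \<open>s\<close> into the large set.\<close>

lemma insertion:
  assumes w: "r \<preceq> w" "p \<in> D w" "s \<in> D w"
  obtains q where "q \<in> D w"
    "\<And>w' x. w \<preceq> w' \<Longrightarrow> x \<in> D w' \<Longrightarrow> E w' x q \<longleftrightarrow> E w' x p \<or> eq w' x s"
proof -
  obtain y where y: "y \<in> D w" "E w s y" "E w s y" by (rule pairing[OF w(1) w(3) w(3)])
  obtain b where b: "b \<in> D w" "sub w p b" "sub w y b" by (rule join[OF w(1,2) y(1)])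
  have sb: "E w s b" using subD[OF w(1) b(3) w(3)] y by blast
  have "definable True w (\<lambda>w' u. E w' (u 0) p \<or> eq w' (u 0) s)"
    by (intro definable_intros definable_eq w)
  then obtain q where q: "q \<in> D w" "\<And>w' x. w \<preceq> w' \<Longrightarrow> x \<in> D w' \<Longrightarrow>
      E w' x q \<longleftrightarrow> E w' x b \<and> (E w' x p \<or> eq w' x s)"
    by (rule separation[where P = "\<lambda>w' x. E w' x p \<or> eq w' x s", OF _ w(1) b(1)]) blast
  have "E w' x b" if x: "w \<preceq> w'" "x \<in> D w'" "E w' x p \<or> eq w' x s" for w' x
    using x(3)
  proof
    assume "E w' x p"
    then show ?thesis using b(2) x(1,2) unfolding sub_def by blast
  next
    assume e: "eq w' x s"
    have s: "s \<in> D w'" "E w' s b" "b \<in> D w'" "r \<preceq> w'" using D_mono E_mono sb x w b le_trans by blast+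
    have "definable True w (\<lambda>w u. E w (u 0) b)" by (intro definable_intros b)
    from ext[of w "\<lambda>w x. E w x b", OF this w(1) x(1) s(1) x(2) eq_sym[OF e] s(2)]
    show ?thesis .
  qed
  then show ?thesis using that[OF q(1)] q(2) by blast
qed

text \<open>The union of a collecting set includes every collected witness, so for monotone
  \<open>P\<close> this one set is a witness for all \<open>x\<close>.\<close>

lemma collection_mono:
  assumes P: "definable True w (\<lambda>w u. P w (u 0) (u 1))" and w: "r \<preceq> w" "a \<in> D w"
    and mono: "\<And>w' x y y'. w \<preceq> w' \<Longrightarrow> x \<in> D w' \<Longrightarrow> y \<in> D w' \<Longrightarrow> y' \<in> D w' \<Longrightarrow>
      sub w' y y' \<Longrightarrow> P w' y x \<Longrightarrow> P w' y' x"
    and ex: "\<And>w' x. w \<preceq> w' \<Longrightarrow> x \<in> D w' \<Longrightarrow> E w' x a \<Longrightarrow> \<exists>y\<in>D w'. P w' y x"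
  obtains z where "z \<in> D w" "\<And>w' x. w \<preceq> w' \<Longrightarrow> x \<in> D w' \<Longrightarrow> E w' x a \<Longrightarrow> P w' z x"
proof -
  obtain b where b: "b \<in> D w"
    "\<And>w' x. w \<preceq> w' \<Longrightarrow> x \<in> D w' \<Longrightarrow> E w' x a \<Longrightarrow> \<exists>y\<in>D w'. E w' y b \<and> P w' y x"
    by (rule collection[OF P w ex]) auto
  obtain z where z: "z \<in> D w" "\<And>w' x. w \<preceq> w' \<Longrightarrow> x \<in> D w' \<Longrightarrow> E w' x b \<Longrightarrow> sub w' x z"
    by (rule union[OF w(1) b(1)]) blast
  show ?thesis
  proof (rule that[OF z(1)])
    fix w' x assume x: "w \<preceq> w'" "x \<in> D w'" "E w' x a"
    then obtain y where y: "y \<in> D w'" "E w' y b" "P w' y x" using b(2) by blast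
    have "sub w' y z" by (rule z(2)[OF x(1) y(1,2)])
    then show "P w' z x" using mono y x z(1) D_mono by blast
  qed
qed

text \<open>The subsets of \<open>a\<close> form a set by power set and separation, which reduces
  this form to collection over members.\<close>

lemma collection_mono_sub:
  assumes P: "definable True w (\<lambda>w u. P w (u 0) (u 1))" and w: "r \<preceq> w" "a \<in> D w"
    and mono: "\<And>w' x y y'. w \<preceq> w' \<Longrightarrow> x \<in> D w' \<Longrightarrow> y \<in> D w' \<Longrightarrow> y' \<in> D w' \<Longrightarrow>
      sub w' y y' \<Longrightarrow> P w' y x \<Longrightarrow> P w' y' x"
    and ex: "\<And>w' x. w \<preceq> w' \<Longrightarrow> x \<in> D w' \<Longrightarrow> sub w' x a \<Longrightarrow> \<exists>y\<in>D w'. P w' y x"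
  obtains z where "z \<in> D w" "\<And>w' x. w \<preceq> w' \<Longrightarrow> x \<in> D w' \<Longrightarrow> sub w' x a \<Longrightarrow> P w' z x"
proof -
  obtain b where b: "b \<in> D w" "\<And>w' x. w \<preceq> w' \<Longrightarrow> x \<in> D w' \<Longrightarrow> sub w' x a \<Longrightarrow> E w' x b"
    by (rule powerset[OF w]) blast
  have "definable True w (\<lambda>w u. sub w (u 0) a)" by (intro definable_intros w)
  then obtain c where c: "c \<in> D w"
    "\<And>w' x. w \<preceq> w' \<Longrightarrow> x \<in> D w' \<Longrightarrow> E w' x c \<longleftrightarrow> E w' x b \<and> sub w' x a"
    by (rule separation[where P = "\<lambda>w x. sub w x a", OF _ w(1) b(1)]) blast
  show ?thesis
  proof (rule collection_mono[OF P w(1) c(1)])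
    fix w' x assume "w \<preceq> w'" "x \<in> D w'" "E w' x c"
    then show "\<exists>y\<in>D w'. P w' y x" using c(2) ex by blast
  next
    fix z assume "z \<in> D w" "\<And>w' x. w \<preceq> w' \<Longrightarrow> x \<in> D w' \<Longrightarrow> E w' x c \<Longrightarrow> P w' z x"
    then show thesis using that[of z] b c by blast
  qed (rule mono)
qed

text \<open>An implication with a Delta_0 antecedent is a quantifier over the members of its truth
  value. Collection thus gives a witness that no longer depends on the world at which
  \<open>C\<close> becomes true.\<close>

lemma implication_mono:
  assumes P: "definable True w (\<lambda>w u. P w (u 0))" and C: "definable True w (\<lambda>w u. C w)"
    and w: "r \<preceq> w" "a \<in> D w"
    and mono: "\<And>w' y y'. w \<preceq> w' \<Longrightarrow> y \<in> D w' \<Longrightarrow> y' \<in> D w' \<Longrightarrow> sub w' y y' \<Longrightarrow> P w' y \<Longrightarrow> P w' y'"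
    and ex: "\<And>w'. w \<preceq> w' \<Longrightarrow> C w' \<Longrightarrow> \<exists>y\<in>D w'. P w' y"
  obtains z where "z \<in> D w" "\<And>w'. w \<preceq> w' \<Longrightarrow> C w' \<Longrightarrow> P w' z"
proof -
  obtain c where c: "c \<in> D w" "\<And>w'. w \<preceq> w' \<Longrightarrow> (\<exists>x\<in>D w'. E w' x c) \<longleftrightarrow> C w'"
    by (rule truth_value[OF C w]) blast
  show ?thesis
  proof (rule collection_mono[where P = "\<lambda>w y x. P w y", OF P w(1) c(1)])
    fix w' x assume "w \<preceq> w'" "x \<in> D w'" "E w' x c"
    then show "\<exists>y\<in>D w'. P w' y" using c(2) ex by blast
  next
    fix z assume "z \<in> D w" "\<And>w' x. w \<preceq> w' \<Longrightarrow> x \<in> D w' \<Longrightarrow> E w' x c \<Longrightarrow> P w' z"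
    then show thesis using that[of z] c by blast
  qed (rule mono)
qed

end

section \<open>Goal-based semantics of intuitionistic logic\<close>

text \<open>\<open>GL s g\<close>: the goal with code \<open>g\<close> holds at stage \<open>s\<close>.\<close>

locale goal_frame =
  fixes ext :: "'s \<Rightarrow> 's \<Rightarrow> bool" (infix "\<sqsubseteq>" 50)
    and Dm :: "'s \<Rightarrow> 'd set"
    and Mm :: "'s \<Rightarrow> 'd \<Rightarrow> 'd \<Rightarrow> bool"
    and Fl :: "'s \<Rightarrow> bool"
    and GL :: "'s \<Rightarrow> 'd \<Rightarrow> bool"
  assumes ext_refl: "s \<sqsubseteq> t \<Longrightarrow> t \<sqsubseteq> t"
    and ext_trans: "s \<sqsubseteq> t \<Longrightarrow> t \<sqsubseteq> u \<Longrightarrow> s \<sqsubseteq> u"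
    and Dm_mono: "s \<sqsubseteq> t \<Longrightarrow> x \<in> Dm s \<Longrightarrow> x \<in> Dm t"
    and Mm_mono: "s \<sqsubseteq> t \<Longrightarrow> Mm s x y \<Longrightarrow> Mm t x y"
    and Fl_mono: "s \<sqsubseteq> t \<Longrightarrow> Fl s \<Longrightarrow> Fl t"
    and Mm_goal: "s \<sqsubseteq> s \<Longrightarrow> x \<in> Dm s \<Longrightarrow> y \<in> Dm s \<Longrightarrow> \<exists>g\<in>Dm s. \<forall>t. s \<sqsubseteq> t \<longrightarrow> (GL t g \<longleftrightarrow> Mm t x y)"
    and Fl_goal: "s \<sqsubseteq> s \<Longrightarrow> \<exists>g\<in>Dm s. \<forall>t. s \<sqsubseteq> t \<longrightarrow> (GL t g \<longleftrightarrow> Fl t)"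
    and Fl_GL: "s \<sqsubseteq> s \<Longrightarrow> Fl s \<Longrightarrow> g \<in> Dm s \<Longrightarrow> GL s g"
begin

text \<open>Disjunction and existence are coded impredicatively, but only goals may be eliminated into.\<close>

definition gclosed :: "('s \<Rightarrow> bool) \<Rightarrow> 's \<Rightarrow> bool" where
  "gclosed P s \<longleftrightarrow> ((\<forall>t. s \<sqsubseteq> t \<longrightarrow> (\<forall>g\<in>Dm t. (\<forall>u. t \<sqsubseteq> u \<longrightarrow> P u \<longrightarrow> GL u g) \<longrightarrow> GL t g)) \<longrightarrow> P s)"

definition gor :: "('s \<Rightarrow> bool) \<Rightarrow> ('s \<Rightarrow> bool) \<Rightarrow> 's \<Rightarrow> bool" where
  "gor A B s \<longleftrightarrow> (\<forall>t. s \<sqsubseteq> t \<longrightarrow> (\<forall>g\<in>Dm t. (\<forall>u. t \<sqsubseteq> u \<longrightarrow> A u \<longrightarrow> GL u g) \<longrightarrow>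
     (\<forall>u. t \<sqsubseteq> u \<longrightarrow> B u \<longrightarrow> GL u g) \<longrightarrow> GL t g))"

definition gex :: "('d \<Rightarrow> 's \<Rightarrow> bool) \<Rightarrow> 's \<Rightarrow> bool" where
  "gex F s \<longleftrightarrow> (\<forall>t. s \<sqsubseteq> t \<longrightarrow> (\<forall>g\<in>Dm t. (\<forall>u. t \<sqsubseteq> u \<longrightarrow> (\<forall>x\<in>Dm u. F x u \<longrightarrow> GL u g)) \<longrightarrow> GL t g))"

definition gimp :: "('s \<Rightarrow> bool) \<Rightarrow> ('s \<Rightarrow> bool) \<Rightarrow> 's \<Rightarrow> bool" where
  "gimp A B s \<longleftrightarrow> (\<forall>t. s \<sqsubseteq> t \<longrightarrow> A t \<longrightarrow> B t)"

definition gall :: "('d \<Rightarrow> 's \<Rightarrow> bool) \<Rightarrow> 's \<Rightarrow> bool" where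
  "gall F s \<longleftrightarrow> (\<forall>t. s \<sqsubseteq> t \<longrightarrow> (\<forall>x\<in>Dm t. F x t))"

definition gsub :: "'d \<Rightarrow> 'd \<Rightarrow> 's \<Rightarrow> bool" where
  "gsub x y = gall (\<lambda>z. gimp (\<lambda>s. Mm s z x) (\<lambda>s. Mm s z y))"

primrec N :: "fm \<Rightarrow> (nat \<Rightarrow> 'd) \<Rightarrow> 's \<Rightarrow> bool" where
  "N (Mem i j) v = (\<lambda>s. Mm s (v i) (v j))"
| "N Bot v = Fl"
| "N (Conj A B) v = (\<lambda>s. N A v s \<and> N B v s)"
| "N (Disj A B) v = gor (N A v) (N B v)"
| "N (Imp A B) v = gimp (N A v) (N B v)"
| "N (All A) v = gall (\<lambda>x. N A (x ## v))"
| "N (Ex A) v = gex (\<lambda>x. N A (x ## v))"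
| "N (BAll i A) v = gall (\<lambda>x. gimp (\<lambda>s. Mm s x (v i)) (N A (x ## v)))"
| "N (BEx i A) v = gex (\<lambda>x s. Mm s x (v i) \<and> N A (x ## v) s)"
| "N (SAll i A) v = gall (\<lambda>x. gimp (gsub x (v i)) (N A (x ## v)))"
| "N (SEx i A) v = gex (\<lambda>x s. gsub x (v i) s \<and> N A (x ## v) s)"

lemma gor_mono: "s \<sqsubseteq> t \<Longrightarrow> gor A B s \<Longrightarrow> gor A B t"
  unfolding gor_def using ext_trans by metis

lemma gex_mono: "s \<sqsubseteq> t \<Longrightarrow> gex A s \<Longrightarrow> gex A t"
  unfolding gex_def using ext_trans by metis

lemma gimp_mono: "s \<sqsubseteq> t \<Longrightarrow> gimp A B s \<Longrightarrow> gimp A B t"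
  unfolding gimp_def using ext_trans by metis

lemma gall_mono: "s \<sqsubseteq> t \<Longrightarrow> gall A s \<Longrightarrow> gall A t"
  unfolding gall_def using ext_trans by metis

lemma N_mono: "s \<sqsubseteq> t \<Longrightarrow> N A v s \<Longrightarrow> N A v t"
  by (induction A arbitrary: v)
    (auto intro: Mm_mono Fl_mono gor_mono gex_mono gimp_mono gall_mono)

lemma N_ren: "N (ren \<rho> A) v = N A (v \<circ> \<rho>)"
  by (induction A arbitrary: v \<rho>) (simp_all add: econs_up)

text \<open>\<open>gor A B\<close> speaks only of goals, and a goal that follows from
  \<open>A\<close> and from \<open>B\<close> follows from \<open>gor A B\<close> at every later
  stage.\<close>

lemma gor_closed: "gclosed (gor A B) s"
  unfolding gclosed_def
proof
  assume h: "\<forall>t. s \<sqsubseteq> t \<longrightarrow> (\<forall>g\<in>Dm t. (\<forall>u. t \<sqsubseteq> u \<longrightarrow> gor A B u \<longrightarrow> GL u g) \<longrightarrow> GL t g)"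
  show "gor A B s"
    unfolding gor_def
  proof (intro allI ballI impI)
    fix t g assume t: "s \<sqsubseteq> t" "g \<in> Dm t"
      and a: "\<forall>u. t \<sqsubseteq> u \<longrightarrow> A u \<longrightarrow> GL u g" "\<forall>u. t \<sqsubseteq> u \<longrightarrow> B u \<longrightarrow> GL u g"
    have "GL u g" if u: "t \<sqsubseteq> u" "gor A B u" for u
    proof -
      have "u \<sqsubseteq> u" "g \<in> Dm u" using u t ext_refl Dm_mono by blast+
      then show ?thesis
        using u(2)[unfolded gor_def, rule_format, of u g] a ext_trans[OF u(1)] by blast
    qed
    then show "GL t g" using h t by blast
  qed
qed

lemma gex_closed: "gclosed (gex F) s"
  unfolding gclosed_def
proof
  assume h: "\<forall>t. s \<sqsubseteq> t \<longrightarrow> (\<forall>g\<in>Dm t. (\<forall>u. t \<sqsubseteq> u \<longrightarrow> gex F u \<longrightarrow> GL u g) \<longrightarrow> GL t g)"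
  show "gex F s"
    unfolding gex_def
  proof (intro allI ballI impI)
    fix t g assume t: "s \<sqsubseteq> t" "g \<in> Dm t" and a: "\<forall>u. t \<sqsubseteq> u \<longrightarrow> (\<forall>x\<in>Dm u. F x u \<longrightarrow> GL u g)"
    have "GL u g" if u: "t \<sqsubseteq> u" "gex F u" for u
    proof -
      have "u \<sqsubseteq> u" "g \<in> Dm u" using u t ext_refl Dm_mono by blast+
      then show ?thesis
        using u(2)[unfolded gex_def, rule_format, of u g] a ext_trans[OF u(1)] by blast
    qed
    then show "GL t g" using h t by blast
  qed
qed

text \<open>Where \<open>A\<close> holds, the implication gives \<open>B\<close>, so any goal that
  follows from \<open>B\<close> follows from the implication as well.\<close>

lemma gimp_closed:
  assumes "\<And>t. s \<sqsubseteq> t \<Longrightarrow> gclosed B t" and A: "\<And>t u. s \<sqsubseteq> t \<Longrightarrow> t \<sqsubseteq> u \<Longrightarrow> A t \<Longrightarrow> A u"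
  shows "gclosed (gimp A B) s"
  unfolding gclosed_def
proof
  assume h: "\<forall>t. s \<sqsubseteq> t \<longrightarrow> (\<forall>g\<in>Dm t. (\<forall>u. t \<sqsubseteq> u \<longrightarrow> gimp A B u \<longrightarrow> GL u g) \<longrightarrow> GL t g)"
  show "gimp A B s"
    unfolding gimp_def
  proof (intro allI impI)
    fix t assume t: "s \<sqsubseteq> t" "A t"
    have "GL t' g" if t': "t \<sqsubseteq> t'" "g \<in> Dm t'" "\<forall>u. t' \<sqsubseteq> u \<longrightarrow> B u \<longrightarrow> GL u g" for t' g
    proof -
      have "GL u g" if u: "t' \<sqsubseteq> u" "gimp A B u" for u
      proof -
        have "A u" using A t t' u ext_trans by blast
        then have "B u" using u ext_refl unfolding gimp_def by blast
        then show ?thesis using t' u by blast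
      qed
      then show ?thesis using h ext_trans t(1) t' by blast
    qed
    then show "B t" using assms(1)[OF t(1)] unfolding gclosed_def by blast
  qed
qed

lemma gall_closed:
  assumes "\<And>t x. s \<sqsubseteq> t \<Longrightarrow> x \<in> Dm t \<Longrightarrow> gclosed (F x) t"
  shows "gclosed (gall F) s"
  unfolding gclosed_def
proof
  assume h: "\<forall>t. s \<sqsubseteq> t \<longrightarrow> (\<forall>g\<in>Dm t. (\<forall>u. t \<sqsubseteq> u \<longrightarrow> gall F u \<longrightarrow> GL u g) \<longrightarrow> GL t g)"
  show "gall F s"
    unfolding gall_def
  proof (intro allI impI ballI)
    fix t x assume t: "s \<sqsubseteq> t" "x \<in> Dm t"
    have "GL t' g" if t': "t \<sqsubseteq> t'" "g \<in> Dm t'" "\<forall>u. t' \<sqsubseteq> u \<longrightarrow> F x u \<longrightarrow> GL u g" for t' g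
    proof -
      have "GL u g" if u: "t' \<sqsubseteq> u" "gall F u" for u
      proof -
        have "x \<in> Dm u" using t t' u Dm_mono by blast
        then have "F x u" using u ext_refl unfolding gall_def by blast
        then show ?thesis using t' u by blast
      qed
      then show ?thesis using h ext_trans t(1) t' by blast
    qed
    then show "F x t" using assms[OF t] unfolding gclosed_def by blast
  qed
qed

lemma gclosed_goal: "s \<sqsubseteq> s \<Longrightarrow> g \<in> Dm s \<Longrightarrow> \<forall>t. s \<sqsubseteq> t \<longrightarrow> (GL t g \<longleftrightarrow> P t) \<Longrightarrow> gclosed P s"
  unfolding gclosed_def by blast

text \<open>The analogue of stability in a double-negation translation, with all goals in place of
  falsity: a formula is recovered from the goals that it implies. Atoms and falsity are goals, and
  the clauses preserve the property. It is what allows elimination of disjunctions and existentials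
  into arbitrary formulas.\<close>

lemma N_closed:
  assumes "s \<sqsubseteq> s" "\<And>i. v i \<in> Dm s"
  shows "gclosed (N A v) s"
  using assms
proof (induction A arbitrary: s v)
  case (Mem i j)
  then show ?case using Mm_goal[of s "v i" "v j"] gclosed_goal by auto
next
  case Bot
  then show ?case using Fl_goal[of s] gclosed_goal by auto
next
  case (Conj A B)
  have "gclosed (N A v) s" "gclosed (N B v) s" using Conj by auto
  then show ?case unfolding gclosed_def N.simps by blast
next
  case (Imp A B)
  show ?case unfolding N.simps
  proof (rule gimp_closed)
    fix t assume "s \<sqsubseteq> t"
    then show "gclosed (N B v) t"
      using Imp.prems Dm_mono[of s t] by (intro Imp.IH) (auto intro: ext_refl)
  qed (rule N_mono)
next
  case (All A)
  show ?case unfolding N.simps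
  proof (rule gall_closed)
    fix t x assume "s \<sqsubseteq> t" "x \<in> Dm t"
    then show "gclosed (N A (x ## v)) t"
      using All Dm_mono[of s t] by (intro All.IH) (auto intro: ext_refl split: nat.splits)
  qed
next
  case (BAll i A)
  show ?case unfolding N.simps
  proof (intro gall_closed gimp_closed)
    fix t x u assume "s \<sqsubseteq> t" "x \<in> Dm t" "t \<sqsubseteq> u"
    then show "gclosed (N A (x ## v)) u"
      using BAll Dm_mono[of s t] Dm_mono[of t u] by (intro BAll.IH) (auto intro: ext_refl split: nat.splits)
  qed (blast intro: Mm_mono)
next
  case (SAll i A)
  show ?case unfolding N.simps
  proof (intro gall_closed gimp_closed)
    fix t x u assume "s \<sqsubseteq> t" "x \<in> Dm t" "t \<sqsubseteq> u"
    then show "gclosed (N A (x ## v)) u"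
      using SAll Dm_mono[of s t] Dm_mono[of t u] by (intro SAll.IH) (auto intro: ext_refl split: nat.splits)
  qed (auto simp: gsub_def intro: gall_mono)
qed (simp_all add: gor_closed gex_closed)

lemma gexE:
  assumes "gex F s" "s \<sqsubseteq> s" "gclosed P s" "\<And>t x. s \<sqsubseteq> t \<Longrightarrow> x \<in> Dm t \<Longrightarrow> F x t \<Longrightarrow> P t"
  shows "P s"
  using assms ext_trans unfolding gclosed_def gex_def by metis

lemma gorE:
  assumes "gor A B s" "s \<sqsubseteq> s" "gclosed P s" "\<And>t. s \<sqsubseteq> t \<Longrightarrow> A t \<Longrightarrow> P t" "\<And>t. s \<sqsubseteq> t \<Longrightarrow> B t \<Longrightarrow> P t"
  shows "P s"
proof -
  have "GL t g" if t: "s \<sqsubseteq> t" "g \<in> Dm t" "\<forall>u. t \<sqsubseteq> u \<longrightarrow> P u \<longrightarrow> GL u g" for t g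
    using assms(1)[unfolded gor_def, rule_format, OF t(1,2)] t(3) assms(4,5) ext_trans[OF t(1)] by blast
  then show ?thesis using assms(3) unfolding gclosed_def by blast
qed

lemma gexI:
  assumes "x \<in> Dm s" "\<And>t. s \<sqsubseteq> t \<Longrightarrow> F x t"
  shows "gex F s"
  unfolding gex_def using assms ext_refl Dm_mono by blast

lemma gorI1: "(\<And>t. s \<sqsubseteq> t \<Longrightarrow> A t) \<Longrightarrow> gor A B s"
  unfolding gor_def using ext_refl by blast

lemma gorI2: "(\<And>t. s \<sqsubseteq> t \<Longrightarrow> B t) \<Longrightarrow> gor A B s"
  unfolding gor_def using ext_refl by blast

lemma Fl_closed: "s \<sqsubseteq> s \<Longrightarrow> gclosed P s \<Longrightarrow> Fl s \<Longrightarrow> P s"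
  unfolding gclosed_def using Fl_GL Fl_mono ext_refl by blast

lemma gimpI: "(\<And>t. s \<sqsubseteq> t \<Longrightarrow> A t \<Longrightarrow> B t) \<Longrightarrow> gimp A B s"
  by (simp add: gimp_def)

lemma gallI: "(\<And>t x. s \<sqsubseteq> t \<Longrightarrow> x \<in> Dm t \<Longrightarrow> F x t) \<Longrightarrow> gall F s"
  by (simp add: gall_def)

lemma gimpD: "gimp A B s \<Longrightarrow> s \<sqsubseteq> t \<Longrightarrow> A t \<Longrightarrow> B t"
  by (simp add: gimp_def)

definition valid :: "fm \<Rightarrow> bool" where
  "valid A \<longleftrightarrow> (\<forall>s v. s \<sqsubseteq> s \<longrightarrow> (\<forall>i. v i \<in> Dm s) \<longrightarrow> N A v s)"

lemma N_Sub: "N (Sub i j) v = gsub (v i) (v j)"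
  by (simp add: Sub_def gsub_def)

lemma valid_Iff: "(\<And>v. N A v = N B v) \<Longrightarrow> valid (Iff A B)"
  by (simp add: valid_def Iff_def gimp_def)

theorem soundness:
  assumes "prov T A" "\<And>B. B \<in> T \<Longrightarrow> valid B"
  shows "valid A"
  using assms(1)
proof (induction rule: prov.induct)
  case (ax A)
  then show ?case using assms(2) by blast
next
  case (K A B)
  show ?case by (simp add: valid_def gimp_def) (metis N_mono)
next
  case (S A B C)
  show ?case
    unfolding valid_def N.simps
  proof (intro allI impI gimpI)
    fix s t u w and v :: "nat \<Rightarrow> 'd" assume "s \<sqsubseteq> t" "gimp (N A v) (gimp (N B v) (N C v)) t" "t \<sqsubseteq> u"
      "gimp (N A v) (N B v) u" "u \<sqsubseteq> w" "N A v w"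
    then show "N C v w" using ext_trans ext_refl unfolding gimp_def by blast
  qed
next
  case (conjE1 A B)
  show ?case by (simp add: valid_def gimp_def)
next
  case (conjE2 A B)
  show ?case by (simp add: valid_def gimp_def)
next
  case (conjI A B)
  show ?case by (simp add: valid_def gimp_def) (metis N_mono)
next
  case (disjI1 A B)
  show ?case unfolding valid_def N.simps by (intro allI impI gimpI gorI1) (rule N_mono)
next
  case (disjI2 B A)
  show ?case unfolding valid_def N.simps by (intro allI impI gimpI gorI2) (rule N_mono)
next
  case (disjE A C B)
  show ?case
    unfolding valid_def N.simps
  proof (intro allI impI gimpI)
    fix s t u w and v :: "nat \<Rightarrow> 'd" assume s: "s \<sqsubseteq> s" "\<forall>i. v i \<in> Dm s" "s \<sqsubseteq> t" "gimp (N A v) (N C v) t" "t \<sqsubseteq> u"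
      "gimp (N B v) (N C v) u" "u \<sqsubseteq> w" "gor (N A v) (N B v) w"
    have sw: "s \<sqsubseteq> w" "t \<sqsubseteq> w" using s ext_trans by blast+
    show "N C v w"
    proof (rule gorE[OF s(8) ext_refl[OF s(7)]])
      show "gclosed (N C v) w" by (rule N_closed[OF ext_refl[OF s(7)]]) (use s sw Dm_mono in blast)
      show "N C v x" if "w \<sqsubseteq> x" "N A v x" for x using that s(4) sw ext_trans gimpD by blast
      show "N C v x" if "w \<sqsubseteq> x" "N B v x" for x using that s(6,7) ext_trans gimpD by blast
    qed
  qed
next
  case (efq A)
  show ?case
    unfolding valid_def N.simps
  proof (intro allI impI gimpI)
    fix s t and v :: "nat \<Rightarrow> 'd" assume s: "s \<sqsubseteq> s" "\<forall>i. v i \<in> Dm s" "s \<sqsubseteq> t" "Fl t"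
    show "N A v t"
      by (rule Fl_closed[OF ext_refl[OF s(3)] N_closed s(4)]) (use s Dm_mono ext_refl in blast)+
  qed
next
  case (allE A t)
  show ?case
    unfolding valid_def N.simps
  proof (intro allI impI gimpI)
    fix s u and v :: "nat \<Rightarrow> 'd" assume s: "s \<sqsubseteq> s" "\<forall>i. v i \<in> Dm s" "s \<sqsubseteq> u" "gall (\<lambda>x. N A (x ## v)) u"
    have "N A (v t ## v) u" using s Dm_mono ext_refl unfolding gall_def by blast
    then show "N (subst 0 t A) v u" by (simp add: subst0_ren N_ren econs_comp)
  qed
next
  case (exI t A)
  show ?case
    unfolding valid_def N.simps
  proof (intro allI impI gimpI)
    fix s u and v :: "nat \<Rightarrow> 'd" assume s: "s \<sqsubseteq> s" "\<forall>i. v i \<in> Dm s" "s \<sqsubseteq> u" "N (subst 0 t A) v u"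
    have a: "N A (v t ## v) u" using s(4) by (simp add: subst0_ren N_ren econs_comp)
    show "gex (\<lambda>x. N A (x ## v)) u"
      by (rule gexI[of "v t"]) (use s Dm_mono a N_mono in blast)+
  qed
next
  case (ball_def i A)
  show ?case by (rule valid_Iff) simp
next
  case (bex_def i A)
  show ?case by (rule valid_Iff) simp
next
  case (sall_def i A)
  show ?case by (rule valid_Iff) (simp add: N_Sub)
next
  case (sex_def i A)
  show ?case by (rule valid_Iff) (simp add: N_Sub)
next
  case (mp A B)
  show ?case
    unfolding valid_def
  proof (intro allI impI)
    fix s and v :: "nat \<Rightarrow> 'd" assume s: "s \<sqsubseteq> s" "\<forall>i. v i \<in> Dm s"
    then have "N (Imp A B) v s" "N A v s" using mp.IH unfolding valid_def by blast+
    then show "N B v s" using s(1) by (simp add: gimp_def)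
  qed
next
  case (allI B A)
  show ?case
    unfolding valid_def N.simps
  proof (intro HOL.allI impI gimpI gallI)
    fix s t u x and v :: "nat \<Rightarrow> 'd" assume s: "s \<sqsubseteq> s" "\<forall>i. v i \<in> Dm s" "s \<sqsubseteq> t" "N B v t" "t \<sqsubseteq> u" "x \<in> Dm u"
    have "v i \<in> Dm u" for i using s Dm_mono by blast
    then have "\<forall>i. (x ## v) i \<in> Dm u" using s(6) by (auto split: nat.splits)
    then have "N (Imp (lift 0 B) A) (x ## v) u" using allI.IH ext_refl[OF s(5)] unfolding valid_def by blast
    moreover have "N (lift 0 B) (x ## v) u" using N_mono[OF s(5,4)] by (simp add: lift0_ren N_ren comp_def)
    ultimately show "N A (x ## v) u" using ext_refl[OF s(5)] by (simp add: gimp_def)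
  qed
next
  case (exE A B)
  show ?case
    unfolding valid_def N.simps
  proof (intro allI impI gimpI)
    fix s t and v :: "nat \<Rightarrow> 'd" assume s: "s \<sqsubseteq> s" "\<forall>i. v i \<in> Dm s" "s \<sqsubseteq> t" "gex (\<lambda>x. N A (x ## v)) t"
    show "N B v t"
    proof (rule gexE[OF s(4) ext_refl[OF s(3)]])
      show "gclosed (N B v) t" by (rule N_closed) (use s Dm_mono ext_refl in blast)+
      fix u x assume u: "t \<sqsubseteq> u" "x \<in> Dm u" "N A (x ## v) u"
      have "v i \<in> Dm u" for i using s u Dm_mono by blast
      then have "\<forall>i. (x ## v) i \<in> Dm u" using u(2) by (auto split: nat.splits)
      then have "N (Imp A (lift 0 B)) (x ## v) u" using exE.IH ext_refl[OF u(1)] unfolding valid_def by blast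
      then have "N (lift 0 B) (x ## v) u" using u ext_refl[OF u(1)] by (simp add: gimp_def)
      then show "N B v u" by (simp add: lift0_ren N_ren comp_def)
    qed
  qed
qed

end

section \<open>The forcing interpretation\<close>

context ikpp_model
begin

lemma definable_app1: "definable d w0 (\<lambda>w u. P w (u 0)) \<Longrightarrow> tm w0 t \<Longrightarrow> definable d w0 (\<lambda>w u. P w (t u))"
  using definable_subst[of d w0 "\<lambda>w u. P w (u 0)" "\<lambda>_. t"] by simp

lemma definable_app2: "definable d w0 (\<lambda>w u. P w (u 0) (u 1)) \<Longrightarrow> tm w0 s \<Longrightarrow> tm w0 t \<Longrightarrow>
    definable d w0 (\<lambda>w u. P w (s u) (t u))"
  using definable_subst[of d w0 "\<lambda>w u. P w (u 0) (u 1)" "s ## (\<lambda>_. t)"] by (simp add: tm_econs)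

text \<open>Bounds are compared by inclusion, because two bounds always have a common superset
  (\<open>join\<close>). Monotone predicates can then be moved to it and antitone ones away from
  it.\<close>

definition monoz :: "'w \<Rightarrow> ('w \<Rightarrow> 'd \<Rightarrow> bool) \<Rightarrow> bool" where
  "monoz w \<phi> \<longleftrightarrow> (\<forall>w' z z'. w \<preceq> w' \<longrightarrow> z \<in> D w' \<longrightarrow> z' \<in> D w' \<longrightarrow> sub w' z z' \<longrightarrow> \<phi> w' z \<longrightarrow> \<phi> w' z')"

definition antiz :: "'w \<Rightarrow> ('w \<Rightarrow> 'd \<Rightarrow> bool) \<Rightarrow> bool" where
  "antiz w \<phi> \<longleftrightarrow> (\<forall>w' z z'. w \<preceq> w' \<longrightarrow> z \<in> D w' \<longrightarrow> z' \<in> D w' \<longrightarrow> sub w' z z' \<longrightarrow> \<phi> w' z' \<longrightarrow> \<phi> w' z)"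

lemma monozD: "monoz w \<phi> \<Longrightarrow> w \<preceq> w' \<Longrightarrow> z \<in> D w' \<Longrightarrow> z' \<in> D w' \<Longrightarrow> sub w' z z' \<Longrightarrow> \<phi> w' z \<Longrightarrow> \<phi> w' z'"
  unfolding monoz_def by blast

lemma antizD: "antiz w \<phi> \<Longrightarrow> w \<preceq> w' \<Longrightarrow> z \<in> D w' \<Longrightarrow> z' \<in> D w' \<Longrightarrow> sub w' z z' \<Longrightarrow> \<phi> w' z' \<Longrightarrow> \<phi> w' z"
  unfolding antiz_def by blast

lemma monoz_base: "w \<preceq> w' \<Longrightarrow> monoz w \<phi> \<Longrightarrow> monoz w' \<phi>"
  unfolding monoz_def using le_trans by blast

lemma antiz_base: "w \<preceq> w' \<Longrightarrow> antiz w \<phi> \<Longrightarrow> antiz w' \<phi>"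
  unfolding antiz_def using le_trans by blast

text \<open>Class quantifiers bounded by \<open>bd\<close> admit collection; instances are
  \<open>x \<in> a\<close> and \<open>x \<subseteq> a\<close>.\<close>

definition bounding :: "'w \<Rightarrow> ('w \<Rightarrow> 'd \<Rightarrow> bool) \<Rightarrow> bool" where
  "bounding w bd \<longleftrightarrow> definable True w (\<lambda>w u. bd w (u 0)) \<and>
    (\<forall>w1 P. w \<preceq> w1 \<longrightarrow> definable True w1 (\<lambda>w u. P w (u 0) (u 1)) \<longrightarrow>
      (\<forall>w' x y y'. w1 \<preceq> w' \<longrightarrow> x \<in> D w' \<longrightarrow> y \<in> D w' \<longrightarrow> y' \<in> D w' \<longrightarrow> sub w' y y' \<longrightarrow> P w' y x \<longrightarrow> P w' y' x) \<longrightarrow>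
      (\<forall>w' x. w1 \<preceq> w' \<longrightarrow> x \<in> D w' \<longrightarrow> bd w' x \<longrightarrow> (\<exists>y\<in>D w'. P w' y x)) \<longrightarrow>
      (\<exists>z\<in>D w1. \<forall>w' x. w1 \<preceq> w' \<longrightarrow> x \<in> D w' \<longrightarrow> bd w' x \<longrightarrow> P w' z x))"

lemma boundingD:
  assumes "bounding w bd" "w \<preceq> w1" "definable True w1 (\<lambda>w u. P w (u 0) (u 1))"
    "\<And>w' x y y'. w1 \<preceq> w' \<Longrightarrow> x \<in> D w' \<Longrightarrow> y \<in> D w' \<Longrightarrow> y' \<in> D w' \<Longrightarrow> sub w' y y' \<Longrightarrow> P w' y x \<Longrightarrow> P w' y' x"
    "\<And>w' x. w1 \<preceq> w' \<Longrightarrow> x \<in> D w' \<Longrightarrow> bd w' x \<Longrightarrow> \<exists>y\<in>D w'. P w' y x"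
  shows "\<exists>z\<in>D w1. \<forall>w' x. w1 \<preceq> w' \<longrightarrow> x \<in> D w' \<longrightarrow> bd w' x \<longrightarrow> P w' z x"
  using assms(1)[unfolded bounding_def, THEN conjunct2, rule_format, OF assms(2,3)] assms(4,5) by blast

lemma bounding_base: "w \<preceq> w' \<Longrightarrow> bounding w bd \<Longrightarrow> bounding w' bd"
proof -
  assume a: "w \<preceq> w'" "bounding w bd"
  have "definable True w' (\<lambda>w u. bd w (u 0))"
    by (rule definable_base[OF _ a(1)]) (use a(2) in \<open>simp add: bounding_def\<close>)
  moreover have "w' \<preceq> w1 \<Longrightarrow> w \<preceq> w1" for w1 using a le_trans by blast
  ultimately show ?thesis using a(2) unfolding bounding_def by simp
qed

lemma bounding_mem: "r \<preceq> w \<Longrightarrow> a \<in> D w \<Longrightarrow> bounding w (\<lambda>w x. E w x a)"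
  unfolding bounding_def
proof (intro conjI allI impI)
  assume w: "r \<preceq> w" "a \<in> D w"
  show "definable True w (\<lambda>w u. E w (u 0) a)" by (intro definable_intros w)
  fix w1 P assume w1: "w \<preceq> w1" and P: "definable True w1 (\<lambda>w u. P w (u 0) (u 1))"
    and m: "\<forall>w' x y y'. w1 \<preceq> w' \<longrightarrow> x \<in> D w' \<longrightarrow> y \<in> D w' \<longrightarrow> y' \<in> D w' \<longrightarrow> sub w' y y' \<longrightarrow> P w' y x \<longrightarrow> P w' y' x"
    and e: "\<forall>w' x. w1 \<preceq> w' \<longrightarrow> x \<in> D w' \<longrightarrow> E w' x a \<longrightarrow> (\<exists>y\<in>D w'. P w' y x)"
  show "\<exists>z\<in>D w1. \<forall>w' x. w1 \<preceq> w' \<longrightarrow> x \<in> D w' \<longrightarrow> E w' x a \<longrightarrow> P w' z x"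
  proof (rule collection_mono[OF P le_trans[OF w(1) w1] D_mono[OF w1 w(2)]])
    fix w' x y y' assume "w1 \<preceq> w'" "x \<in> D w'" "y \<in> D w'" "y' \<in> D w'" "sub w' y y'" "P w' y x"
    then show "P w' y' x" using m by blast
  next
    fix w' x assume "w1 \<preceq> w'" "x \<in> D w'" "E w' x a"
    then show "\<exists>y\<in>D w'. P w' y x" using e by blast
  qed blast
qed

lemma bounding_sub: "r \<preceq> w \<Longrightarrow> a \<in> D w \<Longrightarrow> bounding w (\<lambda>w x. sub w x a)"
  unfolding bounding_def
proof (intro conjI allI impI)
  assume w: "r \<preceq> w" "a \<in> D w"
  show "definable True w (\<lambda>w u. sub w (u 0) a)" by (intro definable_intros w)
  fix w1 P assume w1: "w \<preceq> w1" and P: "definable True w1 (\<lambda>w u. P w (u 0) (u 1))"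
    and m: "\<forall>w' x y y'. w1 \<preceq> w' \<longrightarrow> x \<in> D w' \<longrightarrow> y \<in> D w' \<longrightarrow> y' \<in> D w' \<longrightarrow> sub w' y y' \<longrightarrow> P w' y x \<longrightarrow> P w' y' x"
    and e: "\<forall>w' x. w1 \<preceq> w' \<longrightarrow> x \<in> D w' \<longrightarrow> sub w' x a \<longrightarrow> (\<exists>y\<in>D w'. P w' y x)"
  show "\<exists>z\<in>D w1. \<forall>w' x. w1 \<preceq> w' \<longrightarrow> x \<in> D w' \<longrightarrow> sub w' x a \<longrightarrow> P w' z x"
  proof (rule collection_mono_sub[OF P le_trans[OF w(1) w1] D_mono[OF w1 w(2)]])
    fix w' x y y' assume "w1 \<preceq> w'" "x \<in> D w'" "y \<in> D w'" "y' \<in> D w'" "sub w' y y'" "P w' y x"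
    then show "P w' y' x" using m by blast
  next
    fix w' x assume "w1 \<preceq> w'" "x \<in> D w'" "sub w' x a"
    then show "\<exists>y\<in>D w'. P w' y x" using e by blast
  qed blast
qed

end

text \<open>\<open>U\<close> stays abstract until the finitely many formulas of a given proof are
  known. The requirement \<open>U_truth\<close> gives every Delta_0-statement with parameters a
  code, by way of its truth value.\<close>

locale forcing = ikpp_model le D E r
  for le :: "'w \<Rightarrow> 'w \<Rightarrow> bool" (infix "\<preceq>" 50) and D :: "'w \<Rightarrow> 'd set" and E r +
  fixes U :: "'w \<Rightarrow> 'd \<Rightarrow> 'd \<Rightarrow> bool"
  assumes U_def: "definable True r (\<lambda>w u. U w (u 0) (u 1))"
    and U_truth: "r \<preceq> w \<Longrightarrow> c \<in> D w \<Longrightarrow>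
      \<exists>s\<in>D w. \<forall>w'. w \<preceq> w' \<longrightarrow> (\<forall>z\<in>D w'. U w' z s \<longleftrightarrow> (\<exists>x\<in>D w'. E w' x c))"
begin

text \<open>\<open>U w z s\<close> evaluates the code \<open>s\<close> at the bound \<open>z\<close>; \<open>th\<close> and \<open>gm\<close> read \<open>s\<close> as a
  \<open>\<Pi>\<close>- respectively \<open>\<Sigma>\<close>-formula restricted to \<open>z\<close>, made monotone in \<open>z\<close> for arbitrary codes.
  A condition \<open>p\<close> is a set of codes of \<open>\<Pi>\<close>-formulas, and \<open>br w p z\<close> their conjunction restricted
  to \<open>z\<close>.\<close>

definition th :: "'w \<Rightarrow> 'd \<Rightarrow> 'd \<Rightarrow> bool" where
  "th w z s \<longleftrightarrow> (\<forall>w'. w \<preceq> w' \<longrightarrow> (\<forall>y\<in>D w'. sub w' y z \<longrightarrow> U w' y s))"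

definition gm :: "'w \<Rightarrow> 'd \<Rightarrow> 'd \<Rightarrow> bool" where
  "gm w z g \<longleftrightarrow> (\<exists>y\<in>D w. sub w y z \<and> U w y g)"

definition br :: "'w \<Rightarrow> 'd \<Rightarrow> 'd \<Rightarrow> bool" where
  "br w p z \<longleftrightarrow> (\<forall>w'. w \<preceq> w' \<longrightarrow> (\<forall>s\<in>D w'. E w' s p \<longrightarrow> th w' z s))"

lemma definable_U: "r \<preceq> w0 \<Longrightarrow> tm w0 s \<Longrightarrow> tm w0 t \<Longrightarrow> definable d w0 (\<lambda>w u. U w (s u) (t u))"
  by (rule definable_app2[OF definable_base[OF definable_weaken[OF U_def]]])

lemma definable_th: "r \<preceq> w0 \<Longrightarrow> tm w0 s \<Longrightarrow> tm w0 t \<Longrightarrow> definable d w0 (\<lambda>w u. th w (s u) (t u))"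
  unfolding th_def
  by (rule definable_sall[where Q = "\<lambda>w y u. U w y (t u)"]) (simp_all add: definable_U tm_var tm_shift)

lemma definable_gm: "r \<preceq> w0 \<Longrightarrow> tm w0 s \<Longrightarrow> tm w0 t \<Longrightarrow> definable d w0 (\<lambda>w u. gm w (s u) (t u))"
  unfolding gm_def
  by (rule definable_sex[where Q = "\<lambda>w y u. U w y (t u)"]) (simp_all add: definable_U tm_var tm_shift)

lemma definable_br: "r \<preceq> w0 \<Longrightarrow> tm w0 s \<Longrightarrow> tm w0 t \<Longrightarrow> definable d w0 (\<lambda>w u. br w (s u) (t u))"
  unfolding br_def
  by (rule definable_ball[where Q = "\<lambda>w y u. th w (t u) y"]) (simp_all add: definable_th tm_var tm_shift)

lemma th_anti: "sub w z z' \<Longrightarrow> th w z' s \<Longrightarrow> th w z s"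
  unfolding th_def by (meson sub_mono sub_trans)

lemma gm_mono: "sub w z z' \<Longrightarrow> gm w z g \<Longrightarrow> gm w z' g"
  unfolding gm_def using sub_trans by blast

lemma br_mono: "w \<preceq> w' \<Longrightarrow> br w p z \<Longrightarrow> br w' p z"
  unfolding br_def using le_trans by blast

lemma br_anti: "sub w z z' \<Longrightarrow> br w p z' \<Longrightarrow> br w p z"
  unfolding br_def by (meson sub_mono th_anti)

lemma br_sub: "sub w p q \<Longrightarrow> br w q z \<Longrightarrow> br w p z"
  unfolding br_def sub_def by blast

text \<open>Stages are pairs of a world and a condition. \<open>fo \<phi>\<close> and \<open>po \<chi>\<close> are the intended meanings of
  forcing a \<open>\<Sigma>\<close>- respectively \<open>\<Pi>\<close>-formula with restrictions \<open>\<phi> w z\<close> and \<open>\<chi> w z\<close> to \<open>z\<close>.\<close>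

definition pext :: "'w \<times> 'd \<Rightarrow> 'w \<times> 'd \<Rightarrow> bool" where
  "pext s t \<longleftrightarrow> r \<preceq> fst s \<and> snd s \<in> D (fst s) \<and> fst s \<preceq> fst t \<and> snd t \<in> D (fst t)
     \<and> sub (fst t) (snd s) (snd t)"

definition fo :: "('w \<Rightarrow> 'd \<Rightarrow> bool) \<Rightarrow> 'w \<times> 'd \<Rightarrow> bool" where
  "fo \<phi> s \<longleftrightarrow> (\<exists>z\<in>D (fst s). \<forall>w. fst s \<preceq> w \<longrightarrow> br w (snd s) z \<longrightarrow> \<phi> w z)"

definition po :: "('w \<Rightarrow> 'd \<Rightarrow> bool) \<Rightarrow> 'w \<times> 'd \<Rightarrow> bool" where
  "po \<chi> s \<longleftrightarrow> (\<forall>w. fst s \<preceq> w \<longrightarrow> (\<forall>y\<in>D w. fo (\<lambda>w _. \<chi> w y) (w, snd s)))"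

definition item :: "'w \<Rightarrow> ('w \<Rightarrow> 'd \<Rightarrow> bool) \<Rightarrow> bool" where
  "item w \<chi> \<longleftrightarrow> (\<exists>s\<in>D w. \<forall>w'. w \<preceq> w' \<longrightarrow> (\<forall>z\<in>D w'. th w' z s \<longleftrightarrow> \<chi> w' z))"

definition goal :: "'w \<Rightarrow> ('w \<Rightarrow> 'd \<Rightarrow> bool) \<Rightarrow> bool" where
  "goal w \<phi> \<longleftrightarrow> (\<exists>g\<in>D w. \<forall>w'. w \<preceq> w' \<longrightarrow> (\<forall>z\<in>D w'. gm w' z g \<longleftrightarrow> \<phi> w' z))"

lemma item_base: "w \<preceq> w' \<Longrightarrow> item w \<chi> \<Longrightarrow> item w' \<chi>"
  unfolding item_def using le_trans D_mono by metis

lemma goal_base: "w \<preceq> w' \<Longrightarrow> goal w \<phi> \<Longrightarrow> goal w' \<phi>"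
  unfolding goal_def using le_trans D_mono by metis

definition coded :: "'w \<Rightarrow> ('w \<Rightarrow> 'd \<Rightarrow> bool) \<Rightarrow> bool" where
  "coded w \<phi> \<longleftrightarrow> (\<exists>s\<in>D w. \<forall>w'. w \<preceq> w' \<longrightarrow> (\<forall>z\<in>D w'. U w' z s \<longleftrightarrow> \<phi> w' z))"

text \<open>\<open>th\<close> closes a code downwards in the bound. On a code of an antitone
  predicate this closure changes nothing.\<close>

lemma coded_item:
  assumes "r \<preceq> w" "coded w \<chi>" "antiz w \<chi>"
  shows "item w \<chi>"
proof -
  obtain s where s: "s \<in> D w" "\<forall>w'. w \<preceq> w' \<longrightarrow> (\<forall>z\<in>D w'. U w' z s \<longleftrightarrow> \<chi> w' z)"
    using assms(2) unfolding coded_def by blast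
  have "th w' z s \<longleftrightarrow> \<chi> w' z" if z: "w \<preceq> w'" "z \<in> D w'" for w' z
  proof
    have w': "w' \<preceq> w'" using z assms le_trans le_refl by blast
    show "\<chi> w' z" if "th w' z s"
      using that s(2) z w' sub_refl unfolding th_def by blast
    assume c: "\<chi> w' z"
    have m: "U w' z s" using s c z by blast
    show "th w' z s"
      unfolding th_def
    proof (intro allI impI ballI)
      fix w'' y assume y: "w' \<preceq> w''" "y \<in> D w''" "sub w'' y z"
      have ww: "w \<preceq> w''" "z \<in> D w''" using y z le_trans D_mono by blast+
      have "definable True w' (\<lambda>w u. U w (u 0) s)"
        by (intro definable_U tm_var tm_const) (use z s assms le_trans D_mono in blast)+
      then have "U w'' z s"
        using definable_mono[of True w' "\<lambda>w u. U w (u 0) s" w' w'' "\<lambda>_. z"] w' y z m by simp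
      then show "U w'' y s" using s(2) ww y antizD[OF assms(3)] by blast
    qed
  qed
  then show ?thesis unfolding item_def using s(1) by blast
qed

lemma coded_goal:
  assumes "r \<preceq> w" "coded w \<phi>" "monoz w \<phi>"
  shows "goal w \<phi>"
proof -
  obtain s where s: "s \<in> D w" "\<forall>w'. w \<preceq> w' \<longrightarrow> (\<forall>z\<in>D w'. U w' z s \<longleftrightarrow> \<phi> w' z)"
    using assms(2) unfolding coded_def by blast
  have "gm w' z s \<longleftrightarrow> \<phi> w' z" if z: "w \<preceq> w'" "z \<in> D w'" for w' z
    unfolding gm_def using s(2) z sub_refl monozD[OF assms(3)] by blast
  then show ?thesis unfolding goal_def using s(1) by blast
qed

lemma coded_truth:
  assumes "r \<preceq> w" "a \<in> D w" "definable True w (\<lambda>w u. P w)"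
  shows "coded w (\<lambda>w _. P w)"
proof -
  obtain c where c: "c \<in> D w" "\<And>w'. w \<preceq> w' \<Longrightarrow> (\<exists>x\<in>D w'. E w' x c) \<longleftrightarrow> P w'"
    by (rule truth_value[OF assms(3,1,2)]) blast
  then show ?thesis using U_truth[OF assms(1) c(1)] unfolding coded_def by auto
qed

lemma item_truth: "r \<preceq> w \<Longrightarrow> a \<in> D w \<Longrightarrow> definable True w (\<lambda>w u. P w) \<Longrightarrow> item w (\<lambda>w _. P w)"
  by (rule coded_item[OF _ coded_truth]) (auto simp: antiz_def)

lemma goal_truth: "r \<preceq> w \<Longrightarrow> a \<in> D w \<Longrightarrow> definable True w (\<lambda>w u. P w) \<Longrightarrow> goal w (\<lambda>w _. P w)"
  by (rule coded_goal[OF _ coded_truth]) (auto simp: monoz_def)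

lemma pext_valid: "pext (w, p) (w, p) \<longleftrightarrow> r \<preceq> w \<and> p \<in> D w"
  unfolding pext_def using le_refl sub_refl by auto

lemma pext_refl: "pext s t \<Longrightarrow> pext t t"
  unfolding pext_def using le_trans le_refl sub_refl by blast

lemma pext_trans: "pext s t \<Longrightarrow> pext t u \<Longrightarrow> pext s u"
  unfolding pext_def using le_trans sub_trans sub_mono by blast

lemma pextD:
  assumes "pext (w, p) (w', q)"
  shows "r \<preceq> w" "p \<in> D w" "w \<preceq> w'" "q \<in> D w'" "sub w' p q" "r \<preceq> w'" "p \<in> D w'" "w' \<preceq> w'" "w \<preceq> w"
proof -
  show *: "r \<preceq> w" "p \<in> D w" "w \<preceq> w'" "q \<in> D w'" "sub w' p q" using assms unfolding pext_def by simp_all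
  show "r \<preceq> w'" "p \<in> D w'" "w \<preceq> w" using * le_trans D_mono le_refl by blast+
  then show "w' \<preceq> w'" using le_refl by blast
qed

lemma pext_world: "pext (w, p) (w, p) \<Longrightarrow> w \<preceq> w' \<Longrightarrow> pext (w, p) (w', p)"
  unfolding pext_def using D_mono sub_refl by auto

lemma fo_mono: "pext s t \<Longrightarrow> fo \<phi> s \<Longrightarrow> fo \<phi> t"
  unfolding pext_def fo_def using D_mono le_trans br_sub sub_mono by metis

lemma fo_weaken:
  assumes "fo \<phi> (w, p)" "\<And>w' z. w \<preceq> w' \<Longrightarrow> z \<in> D w' \<Longrightarrow> \<phi> w' z \<Longrightarrow> \<psi> w' z"
  shows "fo \<psi> (w, p)"
  using assms D_mono unfolding fo_def by (metis fst_conv)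

lemma foI: "z \<in> D w \<Longrightarrow> (\<And>w'. w \<preceq> w' \<Longrightarrow> br w' p z \<Longrightarrow> \<phi> w' z) \<Longrightarrow> fo \<phi> (w, p)"
  unfolding fo_def by auto

lemma foE:
  assumes "fo \<phi> (w, p)"
  obtains z where "z \<in> D w" "\<And>w'. w \<preceq> w' \<Longrightarrow> br w' p z \<Longrightarrow> \<phi> w' z"
  using assms unfolding fo_def by auto

lemma poI: "(\<And>w' y. w \<preceq> w' \<Longrightarrow> y \<in> D w' \<Longrightarrow> fo (\<lambda>w _. \<chi> w y) (w', p)) \<Longrightarrow> po \<chi> (w, p)"
  unfolding po_def by auto

lemma poD: "po \<chi> (w, p) \<Longrightarrow> w \<preceq> w' \<Longrightarrow> y \<in> D w' \<Longrightarrow> fo (\<lambda>w _. \<chi> w y) (w', p)"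
  unfolding po_def by auto

text \<open>The two bounds are joined. At the larger bound the condition is stronger and the
  monotone conclusions are weaker, so both facts survive.\<close>

lemma fo_join:
  assumes v: "r \<preceq> w" and f: "fo \<phi> (w, p)" "fo \<psi> (w, p)" and m: "monoz w \<phi>" "monoz w \<psi>"
    and c: "\<And>w' z. w \<preceq> w' \<Longrightarrow> z \<in> D w' \<Longrightarrow> \<phi> w' z \<Longrightarrow> \<psi> w' z \<Longrightarrow> \<chi> w' z"
  shows "fo \<chi> (w, p)"
proof -
  obtain a where a: "a \<in> D w" "\<And>w'. w \<preceq> w' \<Longrightarrow> br w' p a \<Longrightarrow> \<phi> w' a" by (rule foE[OF f(1)]) blast
  obtain b where b: "b \<in> D w" "\<And>w'. w \<preceq> w' \<Longrightarrow> br w' p b \<Longrightarrow> \<psi> w' b" by (rule foE[OF f(2)]) blast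
  obtain z where z: "z \<in> D w" "sub w a z" "sub w b z" by (rule join[OF v a(1) b(1)])
  show ?thesis
  proof (rule foI[OF z(1)])
    fix w' assume w': "w \<preceq> w'" "br w' p z"
    have s: "sub w' a z" "sub w' b z" "a \<in> D w'" "b \<in> D w'" "z \<in> D w'"
      using z a b w' sub_mono D_mono by blast+
    have "\<phi> w' z" using monozD[OF m(1) w'(1) s(3,5,1)] a(2)[OF w'(1)] br_anti[OF s(1) w'(2)] by blast
    moreover have "\<psi> w' z" using monozD[OF m(2) w'(1) s(4,5,2)] b(2)[OF w'(1)] br_anti[OF s(2) w'(2)] by blast
    ultimately show "\<chi> w' z" using c w' s by blast
  qed
qed

lemma monoz_const: "monoz w (\<lambda>w _. P w)"
  unfolding monoz_def by blast

lemma item_ext: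
  assumes v: "pext (w, p) (w, p)" and i: "item w \<chi>"
  obtains q where "pext (w, p) (w, q)"
    "\<And>w' z. w \<preceq> w' \<Longrightarrow> z \<in> D w' \<Longrightarrow> br w' q z \<longleftrightarrow> br w' p z \<and> \<chi> w' z"
proof -
  have w: "r \<preceq> w" "p \<in> D w" "w \<preceq> w" using v pext_valid le_refl by auto
  obtain s where s: "s \<in> D w" "\<And>w' z. w \<preceq> w' \<Longrightarrow> z \<in> D w' \<Longrightarrow> th w' z s \<longleftrightarrow> \<chi> w' z"
    using i unfolding item_def by blast
  obtain q where q: "q \<in> D w"
    "\<And>w' x. w \<preceq> w' \<Longrightarrow> x \<in> D w' \<Longrightarrow> E w' x q \<longleftrightarrow> E w' x p \<or> eq w' x s"
    by (rule insertion[OF w(1,2) s(1)]) blast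
  have "sub w p q" unfolding sub_def using q(2) by blast
  then have "pext (w, p) (w, q)" unfolding pext_def using w q by auto
  moreover have "br w' q z \<longleftrightarrow> br w' p z \<and> \<chi> w' z" if z: "w \<preceq> w'" "z \<in> D w'" for w' z
  proof -
    have s': "s \<in> D w'" "r \<preceq> w'" "w' \<preceq> w'" using s z w D_mono le_trans le_refl by blast+
    have "br w' q z \<longleftrightarrow> br w' p z \<and> th w' z s"
    proof
      assume b: "br w' q z"
      have "sub w' p q" unfolding sub_def using q(2) z le_trans by blast
      then have "br w' p z" using b br_sub by blast
      moreover have "E w' s q" using q(2) z s' eq_refl by blast
      then have "th w' z s" using b s' unfolding br_def by blast
      ultimately show "br w' p z \<and> th w' z s" by blast
    next
      assume b: "br w' p z \<and> th w' z s"
      show "br w' q z"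
        unfolding br_def
      proof (intro allI impI ballI)
        fix w'' x assume x: "w' \<preceq> w''" "x \<in> D w''" "E w'' x q"
        have w'': "w \<preceq> w''" "s \<in> D w''" "z \<in> D w''" "r \<preceq> w''" using x z s' le_trans D_mono by blast+
        from x q(2)[OF w''(1)] consider "E w'' x p" | "eq w'' x s" by blast
        then show "th w'' z x"
        proof cases
          case 1
          then show ?thesis using b x unfolding br_def by blast
        next
          \<comment> \<open>Membership in \<open>q\<close> holds only up to extensional equality
            with \<open>s\<close>, so \<open>th\<close> has to be transported from \<open>s\<close>
            to \<open>x\<close> by extensionality.\<close>
          case 2
          have "th w'' z s" using b x(1) unfolding th_def using le_trans by blast
          moreover have "definable True w'' (\<lambda>w u. th w z (u 0))"
            by (intro definable_th tm_var tm_const w'')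
          ultimately show ?thesis
            using ext[of w'' "\<lambda>w x. th w z x" w'' s x] w'' x le_refl eq_sym[OF 2] by blast
        qed
      qed
    qed
    then show ?thesis using s(2) z by blast
  qed
  ultimately show ?thesis using that by blast
qed

text \<open>A condition may be inconsistent, in that some \<open>z\<close> refutes its restriction
  to \<open>z\<close>. Falsity therefore means exactly this, and it yields every goal. Atoms do not
  depend on the bound, so the goal for an atom is the code of a truth value.\<close>

sublocale N: goal_frame pext "\<lambda>s. D (fst s)" "\<lambda>s x y. fo (\<lambda>w _. E w x y) s" "fo (\<lambda>_ _. False)"
  "\<lambda>s g. fo (\<lambda>w z. gm w z g) s"
proof
  have goalD: "\<exists>g\<in>D (fst s). \<forall>t. pext s t \<longrightarrow> fo (\<lambda>w z. gm w z g) t \<longleftrightarrow> fo (\<lambda>w _. P w) t"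
    if G: "goal (fst s) (\<lambda>w _. P w)" for P s
  proof -
    obtain g where g: "g \<in> D (fst s)"
      "\<And>w' z. fst s \<preceq> w' \<Longrightarrow> z \<in> D w' \<Longrightarrow> gm w' z g \<longleftrightarrow> P w'"
      using G unfolding goal_def by blast
    have "fo (\<lambda>w z. gm w z g) t \<longleftrightarrow> fo (\<lambda>w _. P w) t" if "pext s t" for t
    proof (cases t)
      case (Pair w p)
      then have "fst s \<preceq> w' \<and> (z \<in> D w \<longrightarrow> z \<in> D w')" if "w \<preceq> w'" for w' z
        using \<open>pext s t\<close> that le_trans D_mono unfolding pext_def by auto
      then show ?thesis unfolding fo_def Pair using g(2) by (metis fst_conv)
    qed
    then show ?thesis using g(1) by blast
  qed
  fix s t u x y g
  show "pext t t" if "pext s t" using that pext_refl by blast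
  show "pext s u" if "pext s t" "pext t u" using that pext_trans by blast
  show "x \<in> D (fst t)" if "pext s t" "x \<in> D (fst s)" using that D_mono unfolding pext_def by blast
  show "fo (\<lambda>w _. E w x y) t" if "pext s t" "fo (\<lambda>w _. E w x y) s" using that fo_mono by blast
  show "fo (\<lambda>_ _. False) t" if "pext s t" "fo (\<lambda>_ _. False) s" using that fo_mono by blast
  show "\<exists>g\<in>D (fst s). \<forall>t. pext s t \<longrightarrow> fo (\<lambda>w z. gm w z g) t = fo (\<lambda>w _. E w x y) t"
    if "pext s s" "x \<in> D (fst s)" "y \<in> D (fst s)"
    using that by (intro goalD goal_truth[of _ x] definable_intros) (auto simp: pext_def)
  show "\<exists>g\<in>D (fst s). \<forall>t. pext s t \<longrightarrow> fo (\<lambda>w z. gm w z g) t = fo (\<lambda>_ _. False) t"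
    if "pext s s"
    using that by (intro goalD goal_truth[of _ "snd s"] definable_intros) (auto simp: pext_def)
  show "fo (\<lambda>w z. gm w z g) s" if "fo (\<lambda>_ _. False) s" using that unfolding fo_def by blast
qed

end

section \<open>Representation of \<open>\<Sigma>\<close>- and \<open>\<Pi>\<close>-formulas\<close>

context forcing
begin

definition srep :: "('w \<times> 'd \<Rightarrow> bool) \<Rightarrow> ('w \<Rightarrow> 'd \<Rightarrow> bool) \<Rightarrow> 'w \<times> 'd \<Rightarrow> bool" where
  "srep A \<phi> s \<longleftrightarrow> (\<forall>t. pext s t \<longrightarrow> (A t \<longleftrightarrow> fo \<phi> t))"

definition prep :: "('w \<times> 'd \<Rightarrow> bool) \<Rightarrow> ('w \<Rightarrow> 'd \<Rightarrow> bool) \<Rightarrow> 'w \<times> 'd \<Rightarrow> bool" where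
  "prep A \<chi> s \<longleftrightarrow> (\<forall>t. pext s t \<longrightarrow> (A t \<longleftrightarrow> po \<chi> t))"

lemma srepD: "srep A \<phi> s \<Longrightarrow> pext s t \<Longrightarrow> A t \<longleftrightarrow> fo \<phi> t"
  unfolding srep_def by blast

lemma prepD: "prep A \<chi> s \<Longrightarrow> pext s t \<Longrightarrow> A t \<longleftrightarrow> po \<chi> t"
  unfolding prep_def by blast

lemma srepI:
  assumes "\<And>w p. pext s (w, p) \<Longrightarrow> pext (w, p) (w, p) \<Longrightarrow> A (w, p) \<Longrightarrow> fo \<phi> (w, p)"
    "\<And>w p. pext s (w, p) \<Longrightarrow> pext (w, p) (w, p) \<Longrightarrow> fo \<phi> (w, p) \<Longrightarrow> A (w, p)"
  shows "srep A \<phi> s"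
  unfolding srep_def using assms pext_refl by auto

lemma prepI:
  assumes "\<And>w p. pext s (w, p) \<Longrightarrow> pext (w, p) (w, p) \<Longrightarrow> A (w, p) \<Longrightarrow> po \<chi> (w, p)"
    "\<And>w p. pext s (w, p) \<Longrightarrow> pext (w, p) (w, p) \<Longrightarrow> po \<chi> (w, p) \<Longrightarrow> A (w, p)"
  shows "prep A \<chi> s"
  unfolding prep_def using assms pext_refl by auto

lemma po_mono: "pext s t \<Longrightarrow> po \<chi> s \<Longrightarrow> po \<chi> t"
  unfolding po_def
proof (intro allI impI ballI)
  fix w y assume a: "pext s t" "\<forall>w. fst s \<preceq> w \<longrightarrow> (\<forall>y\<in>D w. fo (\<lambda>w _. \<chi> w y) (w, snd s))" "fst t \<preceq> w" "y \<in> D w"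
  have "pext (w, snd s) (w, snd t)" "fst s \<preceq> w"
  proof -
    have *: "r \<preceq> fst s" "snd s \<in> D (fst s)" "fst s \<preceq> fst t" "snd t \<in> D (fst t)" "sub (fst t) (snd s) (snd t)"
      using a(1) unfolding pext_def by blast+
    show sw: "fst s \<preceq> w" by (rule le_trans[OF *(3) a(3)])
    show "pext (w, snd s) (w, snd t)"
      using le_trans[OF *(1) sw] D_mono[OF sw *(2)] D_mono[OF a(3) *(4)] sub_mono[OF a(3) *(5)] le_refl
      unfolding pext_def by auto
  qed
  then show "fo (\<lambda>w _. \<chi> w y) (w, snd t)" using a(2,4) fo_mono by blast
qed

lemma srep_conj:
  assumes "srep A \<phi> s" "srep B \<psi> s" "monoz (fst s) \<phi>" "monoz (fst s) \<psi>"
  shows "srep (\<lambda>s. A s \<and> B s) (\<lambda>w z. \<phi> w z \<and> \<psi> w z) s"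
proof (rule srepI)
  fix w p assume e: "pext s (w, p)" "pext (w, p) (w, p)"
  have m: "monoz w \<phi>" "monoz w \<psi>" using e(1) assms monoz_base unfolding pext_def by auto
  show "fo (\<lambda>w z. \<phi> w z \<and> \<psi> w z) (w, p)" if "A (w, p) \<and> B (w, p)"
    by (rule fo_join[OF _ _ _ m]) (use that srepD assms e pext_valid in auto)
  show "A (w, p) \<and> B (w, p)" if f: "fo (\<lambda>w z. \<phi> w z \<and> \<psi> w z) (w, p)"
    using fo_weaken[OF f, of \<phi>] fo_weaken[OF f, of \<psi>] srepD assms e by auto
qed

lemma prep_conj:
  assumes "prep A \<phi> s" "prep B \<psi> s"
  shows "prep (\<lambda>s. A s \<and> B s) (\<lambda>w z. \<phi> w z \<and> \<psi> w z) s"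
proof (rule prepI)
  fix w p assume e: "pext s (w, p)" "pext (w, p) (w, p)"
  show "po (\<lambda>w z. \<phi> w z \<and> \<psi> w z) (w, p)" if AB: "A (w, p) \<and> B (w, p)"
  proof (rule poI)
    fix w' y assume w': "w \<preceq> w'" "y \<in> D w'"
    have "po \<phi> (w, p)" "po \<psi> (w, p)" using AB prepD assms e by blast+
    then show "fo (\<lambda>w _. \<phi> w y \<and> \<psi> w y) (w', p)"
      by (intro fo_join[OF _ poD poD monoz_const monoz_const, of w' \<phi> w p y \<psi>])
        (use w' pextD[OF e(2)] le_trans in blast)+
  qed
  show "A (w, p) \<and> B (w, p)" if f: "po (\<lambda>w z. \<phi> w z \<and> \<psi> w z) (w, p)"
  proof -
    have "po \<phi> (w, p)" by (rule poI) (rule fo_weaken[OF poD[OF f]]; blast)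
    moreover have "po \<psi> (w, p)" by (rule poI) (rule fo_weaken[OF poD[OF f]]; blast)
    ultimately show ?thesis using prepD assms e by blast
  qed
qed

text \<open>Adding a \<open>\<Pi>\<close>-formula to the condition forces it.\<close>

lemma item_po:
  assumes "pext (w, p) (w, q)" "antiz w \<chi>"
    "\<And>w' z. w \<preceq> w' \<Longrightarrow> z \<in> D w' \<Longrightarrow> br w' q z \<Longrightarrow> \<chi> w' z"
  shows "po \<chi> (w, q)"
proof (rule poI)
  fix w' y assume w': "w \<preceq> w'" "y \<in> D w'"
  show "fo (\<lambda>w _. \<chi> w y) (w', q)"
    by (rule foI[OF w'(2)]) (use w' assms(3) le_trans D_mono in blast)
qed

text \<open>Forward, the code of \<open>\<chi>\<close> joins the condition and the bound for
  \<open>B\<close> is read off. Conversely, the bound \<open>z\<close> of the implication is fixed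
  first, and \<open>po\<close> then provides a further bound at which the condition implies
  \<open>\<chi>\<close> at \<open>z\<close>. This is the use of the two independent bounds in
  \<open>po\<close>.\<close>

lemma srep_imp:
  assumes A: "prep A \<chi> s" and B: "srep B \<phi> s" and m: "antiz (fst s) \<chi>" "monoz (fst s) \<phi>"
    and i: "item (fst s) \<chi>"
  shows "srep (N.gimp A B) (\<lambda>w z. \<forall>w'. w \<preceq> w' \<longrightarrow> \<chi> w' z \<longrightarrow> \<phi> w' z) s"
proof (rule srepI)
  fix w p assume e: "pext s (w, p)" "pext (w, p) (w, p)"
  have m': "antiz w \<chi>" "monoz w \<phi>" "item w \<chi>"
    using e(1) m i antiz_base monoz_base item_base unfolding pext_def by auto
  show "fo (\<lambda>w z. \<forall>w'. w \<preceq> w' \<longrightarrow> \<chi> w' z \<longrightarrow> \<phi> w' z) (w, p)" if g: "N.gimp A B (w, p)"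
  proof -
    obtain q where q: "pext (w, p) (w, q)"
      "\<And>w' z. w \<preceq> w' \<Longrightarrow> z \<in> D w' \<Longrightarrow> br w' q z \<longleftrightarrow> br w' p z \<and> \<chi> w' z"
      by (rule item_ext[OF e(2) m'(3)]) blast
    have "po \<chi> (w, q)" by (rule item_po[OF q(1) m'(1)]) (use q(2) in blast)
    then have "A (w, q)" using prepD[OF A pext_trans[OF e(1) q(1)]] by blast
    then have "B (w, q)" using g q(1) N.gimpD by blast
    then have "fo \<phi> (w, q)" using srepD[OF B pext_trans[OF e(1) q(1)]] by blast
    then obtain z where z: "z \<in> D w" "\<And>w'. w \<preceq> w' \<Longrightarrow> br w' q z \<Longrightarrow> \<phi> w' z" by (rule foE) blast
    show ?thesis
    proof (rule foI[OF z(1)], intro allI impI)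
      fix w' w'' assume w: "w \<preceq> w'" "br w' p z" "w' \<preceq> w''" "\<chi> w'' z"
      have "w \<preceq> w''" "z \<in> D w''" "br w'' p z" using w z le_trans D_mono br_mono by blast+
      then show "\<phi> w'' z" using q(2) z(2) w(4) by blast
    qed
  qed
  show "N.gimp A B (w, p)" if f: "fo (\<lambda>w z. \<forall>w'. w \<preceq> w' \<longrightarrow> \<chi> w' z \<longrightarrow> \<phi> w' z) (w, p)"
  proof (rule N.gimpI)
    fix t assume t: "pext (w, p) t" "A t"
    obtain w1 q where [simp]: "t = (w1, q)" by force
    have st: "pext s t" using e t pext_trans by blast
    note t' = pextD[OF t(1)[simplified]]
    obtain z where z: "z \<in> D w" "\<And>w' w''. w \<preceq> w' \<Longrightarrow> br w' p z \<Longrightarrow> w' \<preceq> w'' \<Longrightarrow> \<chi> w'' z \<Longrightarrow> \<phi> w'' z"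
      by (rule foE[OF f]) blast
    have z1: "z \<in> D w1" using z t' D_mono by blast
    have "po \<chi> (w1, q)" using t(2) prepD[OF A st] by simp
    then have "fo (\<lambda>w _. \<chi> w z) (w1, q)" using poD z1 t' by blast
    then obtain z' where z': "z' \<in> D w1" "\<And>w'. w1 \<preceq> w' \<Longrightarrow> br w' q z' \<Longrightarrow> \<chi> w' z" by (rule foE) blast
    obtain y where y: "y \<in> D w1" "sub w1 z y" "sub w1 z' y" by (rule join[OF t'(6) z1 z'(1)])
    have "fo \<phi> (w1, q)"
    proof (rule foI[OF y(1)])
      fix w' assume w': "w1 \<preceq> w'" "br w' q y"
      have *: "w \<preceq> w'" "w' \<preceq> w'" "sub w' z y" "sub w' z' y" "sub w' p q" "z \<in> D w'" "y \<in> D w'"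
        using w' t' y z1 le_trans le_refl sub_mono D_mono by blast+
      have "br w' p z" "\<chi> w' z" using w' * br_anti br_sub z'(2) by blast+
      then have "\<phi> w' z" using z(2) * by blast
      then show "\<phi> w' y" using monozD[OF m'(2)] * by blast
    qed
    then show "B t" using srepD[OF B st] by simp
  qed
qed

lemma prep_imp:
  assumes A: "srep A \<phi> s" and B: "prep B \<chi> s" and m: "antiz (fst s) \<chi>" "monoz (fst s) \<phi>"
    and d: "definable True (fst s) (\<lambda>w u. \<phi> w (u 0))"
  shows "prep (N.gimp A B) (\<lambda>w z. \<forall>w'. w \<preceq> w' \<longrightarrow> \<phi> w' z \<longrightarrow> \<chi> w' z) s"
proof (rule prepI)
  fix w p assume e: "pext s (w, p)" "pext (w, p) (w, p)"
  have rw: "r \<preceq> w" "p \<in> D w" "fst s \<preceq> w" using e unfolding pext_def by auto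
  have m': "antiz w \<chi>" "monoz w \<phi>"
    using rw(3) m antiz_base monoz_base by blast+
  show "po (\<lambda>w z. \<forall>w'. w \<preceq> w' \<longrightarrow> \<phi> w' z \<longrightarrow> \<chi> w' z) (w, p)" if g: "N.gimp A B (w, p)"
  proof (rule poI)
    fix w1 y assume w1: "w \<preceq> w1" "y \<in> D w1"
    have e1: "pext (w, p) (w1, p)" by (rule pext_world[OF e(2) w1(1)])
    have rw1: "r \<preceq> w1" "fst s \<preceq> w1" using w1 rw le_trans by blast+
    \<comment> \<open>For a fixed \<open>y\<close> it is enough to add the truth value of
      \<open>\<phi>\<close> at \<open>y\<close>, which is a Delta_0-statement; no code for
      \<open>\<phi>\<close> as a whole is asked for.\<close>
    have "item w1 (\<lambda>w _. \<phi> w y)"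
      by (rule item_truth[OF rw1(1) w1(2)], rule definable_app1[OF definable_base[OF d rw1(2)] tm_const[OF w1(2)]])
    then obtain q where q: "pext (w1, p) (w1, q)"
      "\<And>w' z. w1 \<preceq> w' \<Longrightarrow> z \<in> D w' \<Longrightarrow> br w' q z \<longleftrightarrow> br w' p z \<and> \<phi> w' y"
      by (rule item_ext[OF pext_refl[OF e1]]) blast
    have e2: "pext (w, p) (w1, q)" "pext s (w1, q)" using e(1) e1 q(1) pext_trans by blast+
    have "fo \<phi> (w1, q)" by (rule foI[OF w1(2)]) (use q(2) w1(2) D_mono in blast)
    then have "A (w1, q)" using srepD[OF A e2(2)] by blast
    then have "B (w1, q)" using g e2(1) N.gimpD by blast
    then have "po \<chi> (w1, q)" using prepD[OF B e2(2)] by blast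
    then have "fo (\<lambda>w _. \<chi> w y) (w1, q)" using poD w1 rw1 le_refl by blast
    then obtain z where z: "z \<in> D w1" "\<And>w'. w1 \<preceq> w' \<Longrightarrow> br w' q z \<Longrightarrow> \<chi> w' y" by (rule foE) blast
    show "fo (\<lambda>w _. \<forall>w'. w \<preceq> w' \<longrightarrow> \<phi> w' y \<longrightarrow> \<chi> w' y) (w1, p)"
    proof (rule foI[OF z(1)], intro allI impI)
      fix w' w'' assume w: "w1 \<preceq> w'" "br w' p z" "w' \<preceq> w''" "\<phi> w'' y"
      have "w1 \<preceq> w''" "z \<in> D w''" "br w'' p z" using w z le_trans D_mono br_mono by blast+
      then show "\<chi> w'' y" using q(2) z(2) w(4) by blast
    qed
  qed
  show "N.gimp A B (w, p)" if f: "po (\<lambda>w z. \<forall>w'. w \<preceq> w' \<longrightarrow> \<phi> w' z \<longrightarrow> \<chi> w' z) (w, p)"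
  proof (rule N.gimpI)
    fix t assume t: "pext (w, p) t" "A t"
    obtain w1 q where [simp]: "t = (w1, q)" by force
    have st: "pext s t" using e t pext_trans by blast
    note t' = pextD[OF t(1)[simplified]]
    have "fo \<phi> (w1, q)" using srepD[OF A st] t(2) by simp
    then obtain z where z: "z \<in> D w1" "\<And>w'. w1 \<preceq> w' \<Longrightarrow> br w' q z \<Longrightarrow> \<phi> w' z" by (rule foE) blast
    have "po \<chi> (w1, q)"
    proof (rule poI)
      fix w2 y assume w2: "w1 \<preceq> w2" "y \<in> D w2"
      have w2': "r \<preceq> w2" "z \<in> D w2" "w \<preceq> w2" using w2 t' z le_trans D_mono by blast+
      \<comment> \<open>\<open>\<phi>\<close> is known at \<open>z\<close> and \<open>\<chi>\<close>
        is wanted at \<open>y\<close>. At a common superset \<open>\<phi>\<close> still holds, and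
        \<open>\<chi>\<close> descends from there to \<open>y\<close>.\<close>
      obtain y2 where y2: "y2 \<in> D w2" "sub w2 z y2" "sub w2 y y2" by (rule join[OF w2'(1,2) w2(2)])
      obtain z' where z': "z' \<in> D w2" "\<And>w' w''. w2 \<preceq> w' \<Longrightarrow> br w' p z' \<Longrightarrow> w' \<preceq> w'' \<Longrightarrow> \<phi> w'' y2 \<Longrightarrow> \<chi> w'' y2"
        by (rule foE[OF poD[OF f w2'(3) y2(1)]]) blast
      obtain a where a: "a \<in> D w2" "sub w2 z a" "sub w2 z' a" by (rule join[OF w2'(1,2) z'(1)])
      show "fo (\<lambda>w _. \<chi> w y) (w2, q)"
      proof (rule foI[OF a(1)])
        fix w' assume w': "w2 \<preceq> w'" "br w' q a"
        have *: "w \<preceq> w'" "w1 \<preceq> w'" "w' \<preceq> w'" "sub w' z a" "sub w' z' a" "sub w' p q" "sub w' z y2" "sub w' y y2"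
          "z \<in> D w'" "y2 \<in> D w'" "y \<in> D w'"
        proof -
          show l: "w \<preceq> w'" "w1 \<preceq> w'" "w' \<preceq> w'"
            using le_trans[OF w2'(3) w'(1)] le_trans[OF w2(1) w'(1)] le_refl[OF le_trans[OF w2'(1) w'(1)]] .
          show "sub w' z a" "sub w' z' a" "sub w' z y2" "sub w' y y2"
            using sub_mono[OF w'(1)] a y2 by blast+
          show "sub w' p q" by (rule sub_mono[OF l(2) t'(5)])
          show "z \<in> D w'" "y2 \<in> D w'" "y \<in> D w'" using D_mono[OF w'(1)] w2'(2) y2(1) w2(2) by blast+
        qed
        have "br w' q z" "br w' p z'" using w' * br_anti br_sub by blast+
        then have "\<phi> w' y2" using z(2) monozD[OF m'(2)] * by blast
        then have "\<chi> w' y2" using z'(2) w' \<open>br w' p z'\<close> * by blast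
        then show "\<chi> w' y" using antizD[OF m'(1)] * by blast
      qed
    qed
    then show "B t" using prepD[OF B st] by simp
  qed
qed

lemma goalE:
  assumes "goal w \<phi>"
  obtains g where "g \<in> D w" "\<And>w' z. w \<preceq> w' \<Longrightarrow> z \<in> D w' \<Longrightarrow> gm w' z g \<longleftrightarrow> \<phi> w' z"
  using assms unfolding goal_def by blast

lemma gorD:
  assumes "N.gor A B (w, p)" "goal w \<phi>" "pext (w, p) (w, p)"
    and "\<And>w' q. pext (w, p) (w', q) \<Longrightarrow> A (w', q) \<or> B (w', q) \<Longrightarrow> fo \<phi> (w', q)"
  shows "fo \<phi> (w, p)"
proof -
  obtain g where g: "g \<in> D w" "\<And>w' z. w \<preceq> w' \<Longrightarrow> z \<in> D w' \<Longrightarrow> gm w' z g \<longleftrightarrow> \<phi> w' z"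
    by (rule goalE[OF assms(2)]) blast
  have *: "fo (\<lambda>w z. gm w z g) (w', q)" if "pext (w, p) (w', q)" "A (w', q) \<or> B (w', q)" for w' q
    by (rule fo_weaken[OF assms(4)[OF that]]) (use g(2) pextD[OF that(1)] le_trans in blast)
  have "fo (\<lambda>w z. gm w z g) (w, p)"
    using assms(1)[unfolded N.gor_def, rule_format, OF assms(3), of g] g(1) * by auto
  then show ?thesis by (rule fo_weaken) (use g(2) in blast)
qed

lemma gexD:
  assumes "N.gex F (w, p)" "goal w \<phi>" "pext (w, p) (w, p)"
    and "\<And>w' q x. pext (w, p) (w', q) \<Longrightarrow> x \<in> D w' \<Longrightarrow> F x (w', q) \<Longrightarrow> fo \<phi> (w', q)"
  shows "fo \<phi> (w, p)"
proof -
  obtain g where g: "g \<in> D w" "\<And>w' z. w \<preceq> w' \<Longrightarrow> z \<in> D w' \<Longrightarrow> gm w' z g \<longleftrightarrow> \<phi> w' z"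
    by (rule goalE[OF assms(2)]) blast
  have *: "fo (\<lambda>w z. gm w z g) (w', q)" if "pext (w, p) (w', q)" "x \<in> D w'" "F x (w', q)" for w' q x
    by (rule fo_weaken[OF assms(4)[OF that]]) (use g(2) pextD[OF that(1)] le_trans in blast)
  have "fo (\<lambda>w z. gm w z g) (w, p)"
    using assms(1)[unfolded N.gex_def, rule_format, OF assms(3), of g] g(1) * by auto
  then show ?thesis by (rule fo_weaken) (use g(2) in blast)
qed

text \<open>\<open>itemized A \<psi> w\<close>: some item forces \<open>A\<close> and, restricted to \<open>z\<close>, is implied by
  \<open>\<psi> w z\<close>. For \<open>\<Pi>\<close>-formulas \<open>A\<close> this is \<open>A\<close> itself, for \<open>\<Sigma>\<close>-formulas the truth value
  of \<open>A\<close> restricted to a fixed set.\<close>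

definition itemized :: "('w \<times> 'd \<Rightarrow> bool) \<Rightarrow> ('w \<Rightarrow> 'd \<Rightarrow> bool) \<Rightarrow> 'w \<times> 'd \<Rightarrow> bool" where
  "itemized A \<psi> s \<longleftrightarrow> (\<exists>q. pext s (fst s, q) \<and> A (fst s, q) \<and>
    (\<forall>w z. fst s \<preceq> w \<longrightarrow> z \<in> D w \<longrightarrow> br w (snd s) z \<longrightarrow> \<psi> w z \<longrightarrow> br w q z))"

lemma itemized_srep:
  assumes A: "srep A \<phi> (w, q)" and e: "pext (w, q) (w, q)"
    and d: "definable True w (\<lambda>w u. \<phi> w z)" and z: "z \<in> D w"
  shows "itemized A (\<lambda>w _. \<phi> w z) (w, q)"
proof -
  have "r \<preceq> w" using e pext_valid by blast
  then have "item w (\<lambda>w _. \<phi> w z)" by (rule item_truth[OF _ z d])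
  then obtain q1 where q1: "pext (w, q) (w, q1)"
    "\<And>w' a. w \<preceq> w' \<Longrightarrow> a \<in> D w' \<Longrightarrow> br w' q1 a \<longleftrightarrow> br w' q a \<and> \<phi> w' z"
    by (rule item_ext[OF e]) blast
  have "fo \<phi> (w, q1)" by (rule foI[OF z]) (use q1(2) z D_mono in blast)
  then have "A (w, q1)" using srepD[OF A q1(1)] by blast
  then show ?thesis unfolding itemized_def using q1 by auto
qed

lemma itemized_prep:
  assumes A: "prep A \<chi> (w, q)" and e: "pext (w, q) (w, q)" and i: "item w \<chi>" and m: "antiz w \<chi>"
  shows "itemized A \<chi> (w, q)"
proof -
  obtain q1 where q1: "pext (w, q) (w, q1)"
    "\<And>w' a. w \<preceq> w' \<Longrightarrow> a \<in> D w' \<Longrightarrow> br w' q1 a \<longleftrightarrow> br w' q a \<and> \<chi> w' a"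
    by (rule item_ext[OF e i]) blast
  have "po \<chi> (w, q1)" by (rule item_po[OF q1(1) m]) (use q1(2) in blast)
  then have "A (w, q1)" using prepD[OF A q1(1)] by blast
  then show ?thesis unfolding itemized_def using q1 by auto
qed

text \<open>The assumption about all extensions that force \<open>A\<close> is applied to one of
  them, the extension by the item. The bound found there serves at every world where
  \<open>\<psi>\<close> holds.\<close>

lemma itemized_goal:
  assumes "itemized A \<psi> (w, q)" "\<And>u. pext (w, q) u \<Longrightarrow> A u \<Longrightarrow> fo (\<lambda>w z. gm w z g) u"
  obtains a where "a \<in> D w"
    "\<And>w'. w \<preceq> w' \<Longrightarrow> br w' q a \<Longrightarrow> \<psi> w' a \<Longrightarrow> gm w' a g"
proof -
  obtain q1 where q1: "pext (w, q) (w, q1)" "A (w, q1)"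
    "\<And>w' z. w \<preceq> w' \<Longrightarrow> z \<in> D w' \<Longrightarrow> br w' q z \<Longrightarrow> \<psi> w' z \<Longrightarrow> br w' q1 z"
    using assms(1) unfolding itemized_def by auto
  obtain a where "a \<in> D w" "\<And>w'. w \<preceq> w' \<Longrightarrow> br w' q1 a \<Longrightarrow> gm w' a g"
    by (rule foE[OF assms(2)[OF q1(1,2)]]) blast
  then show ?thesis using that q1(3) D_mono by blast
qed

lemma gm_transfer:
  assumes w: "r \<preceq> w" and a: "a \<in> D w" and f: "fo (\<lambda>w _. P w) (w, q)"
    and g: "\<And>w'. w \<preceq> w' \<Longrightarrow> br w' q a \<Longrightarrow> P w' \<Longrightarrow> gm w' a g"
  shows "fo (\<lambda>w z. gm w z g) (w, q)"
proof -
  obtain c where c: "c \<in> D w" "\<And>w'. w \<preceq> w' \<Longrightarrow> br w' q c \<Longrightarrow> P w'" by (rule foE[OF f]) blast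
  obtain y where y: "y \<in> D w" "sub w a y" "sub w c y" by (rule join[OF w a c(1)])
  show ?thesis
  proof (rule foI[OF y(1)])
    fix w' assume w': "w \<preceq> w'" "br w' q y"
    have s: "sub w' a y" "sub w' c y" using sub_mono[OF w'(1)] y by blast+
    have "gm w' a g"
      using g[OF w'(1) br_anti[OF s(1) w'(2)]] c(2)[OF w'(1) br_anti[OF s(2) w'(2)]] by blast
    then show "gm w' y g" by (rule gm_mono[OF s(1)])
  qed
qed

text \<open>For a goal that follows from both sides, the two items give bounds \<open>a\<close> and
  \<open>b\<close>. At a common superset \<open>c\<close> the disjunction is available by
  \<open>po\<close>; each disjunct descends to its own bound, and the goal ascends from there to
  \<open>c\<close>.\<close>

lemma gorI:
  assumes i: "\<And>t. pext s t \<Longrightarrow> itemized A \<psi> t" "\<And>t. pext s t \<Longrightarrow> itemized B \<xi> t"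
    and m: "antiz (fst s) \<psi>" "antiz (fst s) \<xi>"
    and f: "po (\<lambda>w y. \<psi> w y \<or> \<xi> w y) s"
  shows "N.gor A B s"
  unfolding N.gor_def
proof (intro allI impI ballI)
  fix t g assume t: "pext s t" and g: "g \<in> D (fst t)"
    and h: "\<forall>u. pext t u \<longrightarrow> A u \<longrightarrow> fo (\<lambda>w z. gm w z g) u" "\<forall>u. pext t u \<longrightarrow> B u \<longrightarrow> fo (\<lambda>w z. gm w z g) u"
  obtain w q where [simp]: "t = (w, q)" by force
  have w: "fst s \<preceq> w" "r \<preceq> w" "w \<preceq> w" using t le_trans le_refl unfolding pext_def by auto
  obtain a where a: "a \<in> D w" "\<And>w'. w \<preceq> w' \<Longrightarrow> br w' q a \<Longrightarrow> \<psi> w' a \<Longrightarrow> gm w' a g"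
    by (rule itemized_goal[OF i(1)[OF t, simplified]]) (use h(1) in auto)
  obtain b where b: "b \<in> D w" "\<And>w'. w \<preceq> w' \<Longrightarrow> br w' q b \<Longrightarrow> \<xi> w' b \<Longrightarrow> gm w' b g"
    by (rule itemized_goal[OF i(2)[OF t, simplified]]) (use h(2) in auto)
  obtain c where c: "c \<in> D w" "sub w a c" "sub w b c" by (rule join[OF w(2) a(1) b(1)])
  have "fo (\<lambda>w z. gm w z g) (w, q)"
  proof (rule gm_transfer[OF w(2) c(1)])
    show "fo (\<lambda>w _. \<psi> w c \<or> \<xi> w c) (w, q)" by (rule poD[OF po_mono[OF t f, simplified] w(3) c(1)])
    fix w' assume w': "w \<preceq> w'" "br w' q c" "\<psi> w' c \<or> \<xi> w' c"
    have s: "fst s \<preceq> w'" "sub w' a c" "sub w' b c" "a \<in> D w'" "b \<in> D w'" "c \<in> D w'"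
      using le_trans[OF w(1) w'(1)] sub_mono[OF w'(1)] D_mono[OF w'(1)] a b c by blast+
    from w'(3) show "gm w' c g"
    proof
      assume "\<psi> w' c"
      then show ?thesis
        by (intro gm_mono[OF s(2)] a(2)[OF w'(1) br_anti[OF s(2) w'(2)]] antizD[OF m(1) s(1,4,6,2)])
    next
      assume "\<xi> w' c"
      then show ?thesis
        by (intro gm_mono[OF s(3)] b(2)[OF w'(1) br_anti[OF s(3) w'(2)]] antizD[OF m(2) s(1,5,6,3)])
    qed
  qed
  then show "fo (\<lambda>w z. gm w z g) t" by simp
qed

lemma antiz_const: "antiz w (\<lambda>w _. P w)"
  unfolding antiz_def by blast

lemma po_constI: "pext (w, p) (w, p) \<Longrightarrow> fo (\<lambda>w _. P w) (w, p) \<Longrightarrow> po (\<lambda>w _. P w) (w, p)"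
  by (rule poI) (rule fo_mono[OF pext_world])

lemma definable_fix1:
  assumes "definable True w0 (\<lambda>w u. \<phi> w (u 0))" "w0 \<preceq> w" "x \<in> D w"
  shows "definable True w (\<lambda>w u. \<phi> w x)"
  by (rule definable_app1[OF definable_base[OF assms(1,2)] tm_const]) fact

lemma srep_disj:
  assumes A: "srep A \<phi> s" and B: "srep B \<psi> s"
    and d: "definable True (fst s) (\<lambda>w u. \<phi> w (u 0))" "definable True (fst s) (\<lambda>w u. \<psi> w (u 0))"
    and g: "goal (fst s) (\<lambda>w z. \<phi> w z \<or> \<psi> w z)"
  shows "srep (N.gor A B) (\<lambda>w z. \<phi> w z \<or> \<psi> w z) s"
proof (rule srepI)
  fix w p assume e: "pext s (w, p)" "pext (w, p) (w, p)"
  have sw: "fst s \<preceq> w" using e unfolding pext_def by auto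
  show "fo (\<lambda>w z. \<phi> w z \<or> \<psi> w z) (w, p)" if a: "N.gor A B (w, p)"
  proof (rule gorD[OF a goal_base[OF sw g] e(2)])
    fix w' q assume t: "pext (w, p) (w', q)" "A (w', q) \<or> B (w', q)"
    then have "fo \<phi> (w', q) \<or> fo \<psi> (w', q)" using srepD A B pext_trans e(1) by blast
    then show "fo (\<lambda>w z. \<phi> w z \<or> \<psi> w z) (w', q)"
      by (auto elim: fo_weaken)
  qed
  show "N.gor A B (w, p)" if f: "fo (\<lambda>w z. \<phi> w z \<or> \<psi> w z) (w, p)"
  proof -
    \<comment> \<open>With the bound of the disjunction fixed, \<open>\<phi>\<close> and
      \<open>\<psi>\<close> at \<open>z\<close> are Delta_0-statements, and their truth values serve
      as the items required by \<open>gorI\<close>.\<close>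
    obtain z where z: "z \<in> D w" "\<And>w'. w \<preceq> w' \<Longrightarrow> br w' p z \<Longrightarrow> \<phi> w' z \<or> \<psi> w' z" by (rule foE[OF f]) blast
    have i: "itemized C (\<lambda>w _. \<theta> w z) t"
      if t: "pext (w, p) t" and C: "srep C \<theta> s" and d: "definable True (fst s) (\<lambda>w u. \<theta> w (u 0))" for C \<theta> t
    proof -
      have "srep C \<theta> t" using C pext_trans[OF pext_trans[OF e(1) t]] unfolding srep_def by blast
      moreover have t': "fst s \<preceq> fst t" "z \<in> D (fst t)"
        using le_trans[OF sw] D_mono z(1) t unfolding pext_def by auto
      ultimately show ?thesis
        using itemized_srep[of C \<theta> "fst t" "snd t"] pext_refl[OF t] definable_fix1[OF d t'] by simp
    qed
    show ?thesis
      by (rule gorI[OF i[OF _ A d(1)] i[OF _ B d(2)] antiz_const antiz_const po_constI[OF e(2) foI[OF z(1)]]])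
        (simp_all add: z(2))
  qed
qed

text \<open>Forward, only the disjunction at a fixed \<open>y\<close> is needed as a goal, and this
  is a Delta_0-statement. Conversely the two \<Pi>-formulas are themselves the items, with the
  varying bound in \<open>gorI\<close>.\<close>

lemma prep_disj:
  assumes A: "prep A \<chi> s" and B: "prep B \<xi> s" and m: "antiz (fst s) \<chi>" "antiz (fst s) \<xi>"
    and d: "definable True (fst s) (\<lambda>w u. \<chi> w (u 0))" "definable True (fst s) (\<lambda>w u. \<xi> w (u 0))"
    and i: "item (fst s) \<chi>" "item (fst s) \<xi>"
  shows "prep (N.gor A B) (\<lambda>w z. \<chi> w z \<or> \<xi> w z) s"
proof (rule prepI)
  fix w p assume e: "pext s (w, p)" "pext (w, p) (w, p)"
  have rw: "r \<preceq> w" "p \<in> D w" "fst s \<preceq> w" using e unfolding pext_def by auto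
  show "po (\<lambda>w z. \<chi> w z \<or> \<xi> w z) (w, p)" if a: "N.gor A B (w, p)"
  proof (rule poI)
    fix w1 y assume w1: "w \<preceq> w1" "y \<in> D w1"
    have e1: "pext (w, p) (w1, p)" by (rule pext_world[OF e(2) w1(1)])
    have rw1: "r \<preceq> w1" "fst s \<preceq> w1" using w1 rw le_trans by blast+
    show "fo (\<lambda>w _. \<chi> w y \<or> \<xi> w y) (w1, p)"
    proof (rule gorD[OF N.gor_mono[OF e1 a] _ pext_refl[OF e1]])
      show "goal w1 (\<lambda>w _. \<chi> w y \<or> \<xi> w y)"
        by (rule goal_truth[OF rw1(1) w1(2)])
          (intro definable_disj definable_fix1[OF d(1) rw1(2) w1(2)] definable_fix1[OF d(2) rw1(2) w1(2)])
      fix w' q assume t: "pext (w1, p) (w', q)" "A (w', q) \<or> B (w', q)"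
      have "pext s (w', q)" using e(1) e1 t(1) pext_trans by blast
      then have "po \<chi> (w', q) \<or> po \<xi> (w', q)" using t prepD A B by blast
      moreover have "y \<in> D w'" "w' \<preceq> w'" using pextD[OF t(1)] w1 D_mono by blast+
      ultimately have "fo (\<lambda>w _. \<chi> w y) (w', q) \<or> fo (\<lambda>w _. \<xi> w y) (w', q)" using poD by blast
      then show "fo (\<lambda>w _. \<chi> w y \<or> \<xi> w y) (w', q)" by (auto elim: fo_weaken)
    qed
  qed
  show "N.gor A B (w, p)" if f: "po (\<lambda>w z. \<chi> w z \<or> \<xi> w z) (w, p)"
  proof -
    have itm: "itemized C \<theta> t"
      if t: "pext (w, p) t" and C: "prep C \<theta> s" and m: "antiz (fst s) \<theta>" and i: "item (fst s) \<theta>" for C \<theta> t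
    proof -
      have "prep C \<theta> t" using C pext_trans[OF pext_trans[OF e(1) t]] unfolding prep_def by blast
      moreover have "fst s \<preceq> fst t" using le_trans[OF rw(3)] t unfolding pext_def by auto
      ultimately show ?thesis
        using itemized_prep[of C \<theta> "fst t" "snd t"] pext_refl[OF t] item_base[OF _ i] antiz_base[OF _ m] by simp
    qed
    show ?thesis
      by (rule gorI[OF itm[OF _ A m(1) i(1)] itm[OF _ B m(2) i(2)] _ _ f])
        (simp_all add: antiz_base[OF rw(3)] m)
  qed
qed

lemma bounding_definable: "bounding w bd \<Longrightarrow> definable True w (\<lambda>w u. bd w (u 0))"
  unfolding bounding_def by blast

lemma bounding_persist:
  assumes "bounding w0 bd" "w0 \<preceq> w" "w \<preceq> w'" "x \<in> D w" "bd w x"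
  shows "bd w' x"
  by (rule definable_mono[OF bounding_definable[OF assms(1)] assms(2,3), of "\<lambda>_. x"]) (use assms in auto)

lemma definable_fix:
  assumes "definable True w0 (\<lambda>w u. \<phi> w (u 0) (u 1))" "w0 \<preceq> w" "z \<in> D w" "x \<in> D w"
  shows "definable True w (\<lambda>w u. \<phi> w z x)"
  by (rule definable_app2[OF definable_base[OF assms(1,2)] tm_const tm_const]) fact+

text \<open>Only bounds are collected and never the conditions \<open>q1\<close>: these are chosen
  for each \<open>x\<close> separately and disappear behind the implication from
  \<open>\<psi>\<close>. What remains to be collected, \<open>P\<close>, is Delta_0. Here collection
  for arbitrary formulas is avoided.\<close>

lemma collect_goal:
  assumes v: "pext (w1, q) (w1, q)" and g: "g \<in> D w1" and b: "bounding w1 bd"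
    and d: "definable True w1 (\<lambda>w u. \<psi> w (u 0) (u 1))"
    and anti: "\<And>w' x. w1 \<preceq> w' \<Longrightarrow> x \<in> D w' \<Longrightarrow> antiz w' (\<lambda>w z. \<psi> w z x)"
    and h: "\<And>w' x. w1 \<preceq> w' \<Longrightarrow> x \<in> D w' \<Longrightarrow> bd w' x \<Longrightarrow> \<exists>q1. 
      (\<forall>w'' z. w' \<preceq> w'' \<longrightarrow> z \<in> D w'' \<longrightarrow> br w'' q z \<longrightarrow> \<psi> w'' z x \<longrightarrow> br w'' q1 z) \<and>
      fo (\<lambda>w z. gm w z g) (w', q1)"
  obtains z where "z \<in> D w1"
    "\<And>w' x. w1 \<preceq> w' \<Longrightarrow> x \<in> D w' \<Longrightarrow> bd w' x \<Longrightarrow> br w' q z \<Longrightarrow> \<psi> w' z x \<Longrightarrow> gm w' z g"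
proof -
  have rw: "r \<preceq> w1" "q \<in> D w1" using v pext_valid by auto
  define P where "P w z x \<longleftrightarrow> (\<forall>w'. w \<preceq> w' \<longrightarrow> br w' q z \<and> \<psi> w' z x \<longrightarrow> gm w' z g)" for w z x
  have "\<exists>z\<in>D w1. \<forall>w' x. w1 \<preceq> w' \<longrightarrow> x \<in> D w' \<longrightarrow> bd w' x \<longrightarrow> P w' z x"
  proof (rule boundingD[OF b])
    show "w1 \<preceq> w1" using rw le_refl by blast
    show "definable True w1 (\<lambda>w u. P w (u 0) (u 1))"
      unfolding P_def by (intro definable_imp definable_conj definable_br definable_gm tm_var tm_const d rw g)
  next
    fix w' x y y' assume *: "w1 \<preceq> w'" "x \<in> D w'" "y \<in> D w'" "y' \<in> D w'" "sub w' y y'" "P w' y x"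
    show "P w' y' x"
      unfolding P_def
    proof (intro allI impI)
      fix w'' assume w: "w' \<preceq> w''" "br w'' q y' \<and> \<psi> w'' y' x"
      have s: "sub w'' y y'" "y \<in> D w''" "y' \<in> D w''" using w * sub_mono D_mono by blast+
      have "br w'' q y" "\<psi> w'' y x"
        using w s br_anti antizD[OF anti[OF *(1,2)]] by blast+
      then show "gm w'' y' g" using *(6) w(1) s gm_mono unfolding P_def by blast
    qed
  next
    fix w' x assume *: "w1 \<preceq> w'" "x \<in> D w'" "bd w' x"
    obtain q1 where q1: "\<And>w'' z. w' \<preceq> w'' \<Longrightarrow> z \<in> D w'' \<Longrightarrow> br w'' q z \<Longrightarrow> \<psi> w'' z x \<Longrightarrow> br w'' q1 z"
      "fo (\<lambda>w z. gm w z g) (w', q1)" using h[OF *] by blast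
    obtain z where "z \<in> D w'" "\<And>w''. w' \<preceq> w'' \<Longrightarrow> br w'' q1 z \<Longrightarrow> gm w'' z g"
      by (rule foE[OF q1(2)]) blast
    then show "\<exists>y\<in>D w'. P w' y x" unfolding P_def using q1(1) D_mono by blast
  qed
  moreover have "w1 \<preceq> w' \<Longrightarrow> w' \<preceq> w'" for w' using rw le_trans le_refl by blast
  ultimately show ?thesis using that unfolding P_def by blast
qed

lemma itemized_conj: "itemized A \<psi> t \<Longrightarrow> (\<And>u. pext t u \<Longrightarrow> B u) \<Longrightarrow> itemized (\<lambda>s. B s \<and> A s) \<psi> t"
  unfolding itemized_def by blast

text \<open>The infinitary counterpart of \<open>gorI\<close>: one item for each \<open>x\<close>
  within the bound, with collection in place of a join of two bounds.\<close>

lemma gex_itemizedI: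
  assumes i: "\<And>t x. pext s t \<Longrightarrow> x \<in> D (fst t) \<Longrightarrow> bd (fst t) x \<Longrightarrow> itemized (F x) (\<lambda>w z. \<psi> w z x) t"
    and b: "bounding (fst s) bd" and d: "definable True (fst s) (\<lambda>w u. \<psi> w (u 0) (u 1))"
    and m: "\<And>w x. fst s \<preceq> w \<Longrightarrow> x \<in> D w \<Longrightarrow> antiz w (\<lambda>w z. \<psi> w z x)"
    and f: "po (\<lambda>w y. \<exists>x\<in>D w. bd w x \<and> \<psi> w y x) s"
  shows "N.gex F s"
  unfolding N.gex_def
proof (intro allI impI ballI)
  fix t g assume t: "pext s t" and g: "g \<in> D (fst t)"
    and h: "\<forall>u. pext t u \<longrightarrow> (\<forall>x\<in>D (fst u). F x u \<longrightarrow> fo (\<lambda>w z. gm w z g) u)"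
  obtain w q where [simp]: "t = (w, q)" by force
  have w: "fst s \<preceq> w" "r \<preceq> w" "w \<preceq> w" using t le_trans le_refl unfolding pext_def by auto
  have tt: "pext (w, q) (w, q)" using pext_refl[OF t] by simp
  obtain a where a: "a \<in> D w"
    "\<And>w' x. w \<preceq> w' \<Longrightarrow> x \<in> D w' \<Longrightarrow> bd w' x \<Longrightarrow> br w' q a \<Longrightarrow> \<psi> w' a x \<Longrightarrow> gm w' a g"
  proof (rule collect_goal[where \<psi> = \<psi> and g = g, OF tt _ bounding_base[OF w(1) b] definable_base[OF d w(1)]])
    show "g \<in> D w" using g by simp
    show "antiz w' (\<lambda>w z. \<psi> w z x)" if "w \<preceq> w'" "x \<in> D w'" for w' x
      by (rule m[OF le_trans[OF w(1) that(1)] that(2)])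
    fix w' x assume *: "w \<preceq> w'" "x \<in> D w'" "bd w' x"
    have e: "pext (w, q) (w', q)" by (rule pext_world[OF tt *(1)])
    have "itemized (F x) (\<lambda>w z. \<psi> w z x) (w', q)" by (rule i) (use pext_trans[OF t] e * in auto)
    then obtain q1 where q1: "pext (w', q) (w', q1)" "F x (w', q1)"
      "\<forall>w'' z. w' \<preceq> w'' \<longrightarrow> z \<in> D w'' \<longrightarrow> br w'' q z \<longrightarrow> \<psi> w'' z x \<longrightarrow> br w'' q1 z"
      unfolding itemized_def by auto
    moreover have "fo (\<lambda>w z. gm w z g) (w', q1)"
      using h[rule_format, of "(w', q1)" x] pext_trans[OF e q1(1)] q1(2) *(2) by simp
    ultimately show "\<exists>q1. (\<forall>w'' z. w' \<preceq> w'' \<longrightarrow> z \<in> D w'' \<longrightarrow> br w'' q z \<longrightarrow> \<psi> w'' z x \<longrightarrow> br w'' q1 z) \<and>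
        fo (\<lambda>w z. gm w z g) (w', q1)" by blast
  qed blast
  have "fo (\<lambda>w z. gm w z g) (w, q)"
    by (rule gm_transfer[OF w(2) a(1) poD[OF po_mono[OF t f, simplified] w(3) a(1)]]) (use a(2) in blast)
  then show "fo (\<lambda>w z. gm w z g) t" by simp
qed

text \<open>The statement that the condition at \<open>z\<close> implies \<open>\<phi>\<close> at
  \<open>z\<close> is Delta_0 and monotone in \<open>z\<close>, hence the bounds for the single
  \<open>x\<close> have a common one. When \<open>\<phi>\<close> ignores its bound this also serves
  the \<Pi>-case.\<close>

lemma collect_br:
  assumes v: "pext (w, p) (w, p)" and b: "bounding w bd"
    and d: "definable True w (\<lambda>w u. \<phi> w (u 0) (u 1))"
    and m: "\<And>w' x. w \<preceq> w' \<Longrightarrow> x \<in> D w' \<Longrightarrow> monoz w' (\<lambda>w z. \<phi> w z x)"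
    and h: "\<And>w' x. w \<preceq> w' \<Longrightarrow> x \<in> D w' \<Longrightarrow> bd w' x \<Longrightarrow> fo (\<lambda>w z. \<phi> w z x) (w', p)"
  shows "fo (\<lambda>w z. \<forall>w'. w \<preceq> w' \<longrightarrow> (\<forall>x\<in>D w'. bd w' x \<longrightarrow> \<phi> w' z x)) (w, p)"
proof -
  have rw: "r \<preceq> w" "p \<in> D w" using v pext_valid by auto
  define P where "P w z x \<longleftrightarrow> (\<forall>w'. w \<preceq> w' \<longrightarrow> br w' p z \<longrightarrow> \<phi> w' z x)" for w z x
  have "\<exists>z\<in>D w. \<forall>w' x. w \<preceq> w' \<longrightarrow> x \<in> D w' \<longrightarrow> bd w' x \<longrightarrow> P w' z x"
  proof (rule boundingD[OF b])
    show "w \<preceq> w" using rw le_refl by blast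
    show "definable True w (\<lambda>w u. P w (u 0) (u 1))"
      unfolding P_def by (intro definable_imp definable_br tm_var tm_const d rw)
  next
    fix w' x y y' assume *: "w \<preceq> w'" "x \<in> D w'" "y \<in> D w'" "y' \<in> D w'" "sub w' y y'" "P w' y x"
    show "P w' y' x"
      unfolding P_def
    proof (intro allI impI)
      fix w'' assume w: "w' \<preceq> w''" "br w'' p y'"
      have s: "sub w'' y y'" "y \<in> D w''" "y' \<in> D w''" using w * sub_mono D_mono by blast+
      then have "\<phi> w'' y x" using *(6) w br_anti unfolding P_def by blast
      then show "\<phi> w'' y' x" using monozD[OF m[OF *(1,2)]] w(1) s by blast
    qed
  next
    fix w' x assume *: "w \<preceq> w'" "x \<in> D w'" "bd w' x"
    obtain z where "z \<in> D w'" "\<And>w''. w' \<preceq> w'' \<Longrightarrow> br w'' p z \<Longrightarrow> \<phi> w'' z x"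
      by (rule foE[OF h[OF *]]) blast
    then show "\<exists>y\<in>D w'. P w' y x" unfolding P_def by blast
  qed
  then obtain z where z: "z \<in> D w" "\<And>w' x. w \<preceq> w' \<Longrightarrow> x \<in> D w' \<Longrightarrow> bd w' x \<Longrightarrow> P w' z x" by blast
  show ?thesis
  proof (rule foI[OF z(1)], intro allI impI ballI)
    fix w' w'' x assume *: "w \<preceq> w'" "br w' p z" "w' \<preceq> w''" "x \<in> D w''" "bd w'' x"
    have w'': "w \<preceq> w''" by (rule le_trans[OF *(1,3)])
    have "P w'' z x" by (rule z(2)[OF w'' *(4,5)])
    moreover have "w'' \<preceq> w''" using le_refl le_trans[OF rw(1) w''] by blast
    ultimately show "\<phi> w'' z x" using br_mono[OF *(3,2)] unfolding P_def by blast
  qed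
qed

lemma Bd_ext:
  assumes "\<And>t x. pext s t \<Longrightarrow> x \<in> D (fst t) \<Longrightarrow> Bd x t \<longleftrightarrow> fo (\<lambda>w _. bd w x) t"
    and b: "bounding (fst s) bd" and t: "pext s t" "x \<in> D (fst t)" "bd (fst t) x" and u: "pext t u"
  shows "Bd x u"
proof -
  have "fst s \<preceq> fst t" using t(1) unfolding pext_def by blast
  then have "fo (\<lambda>w _. bd w x) t"
    using foI[OF t(2), of "snd t" "\<lambda>w _. bd w x"] bounding_persist[OF b _ _ t(2,3)] by simp
  then have "fo (\<lambda>w _. bd w x) u" by (rule fo_mono[OF u])
  moreover have "x \<in> D (fst u)" using u t(2) D_mono unfolding pext_def by blast
  ultimately show ?thesis using assms(1)[OF pext_trans[OF t(1) u]] by blast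
qed

text \<open>\<open>Bd\<close> is the forced bound on \<open>x\<close> and \<open>bd\<close> the true
  one. A condition may force membership or inclusion that does not hold yet, so in the converse
  direction the bound under which \<open>bd\<close> holds is joined to the bound of the quantified
  formula.\<close>

lemma srep_ball:
  assumes A: "\<And>t x. pext s t \<Longrightarrow> x \<in> D (fst t) \<Longrightarrow> srep (A x) (\<lambda>w z. \<phi> w z x) t"
    and Bd: "\<And>t x. pext s t \<Longrightarrow> x \<in> D (fst t) \<Longrightarrow> Bd x t \<longleftrightarrow> fo (\<lambda>w _. bd w x) t"
    and b: "bounding (fst s) bd" and d: "definable True (fst s) (\<lambda>w u. \<phi> w (u 0) (u 1))"
    and m: "\<And>w' x. fst s \<preceq> w' \<Longrightarrow> x \<in> D w' \<Longrightarrow> monoz w' (\<lambda>w z. \<phi> w z x)"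
  shows "srep (N.gall (\<lambda>x. N.gimp (Bd x) (A x)))
    (\<lambda>w z. \<forall>w'. w \<preceq> w' \<longrightarrow> (\<forall>x\<in>D w'. bd w' x \<longrightarrow> \<phi> w' z x)) s"
proof (rule srepI)
  fix w p assume e: "pext s (w, p)" "pext (w, p) (w, p)"
  have rw: "r \<preceq> w" "p \<in> D w" "fst s \<preceq> w" using e unfolding pext_def by auto
  show "fo (\<lambda>w z. \<forall>w'. w \<preceq> w' \<longrightarrow> (\<forall>x\<in>D w'. bd w' x \<longrightarrow> \<phi> w' z x)) (w, p)"
    if g: "N.gall (\<lambda>x. N.gimp (Bd x) (A x)) (w, p)"
  proof (rule collect_br[OF e(2) bounding_base[OF rw(3) b] definable_base[OF d rw(3)]])
    show "monoz w' (\<lambda>w z. \<phi> w z x)" if "w \<preceq> w'" "x \<in> D w'" for w' x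
      using m le_trans[OF rw(3)] that by blast
    fix w' x assume *: "w \<preceq> w'" "x \<in> D w'" "bd w' x"
    have t: "pext (w, p) (w', p)" by (rule pext_world[OF e(2) *(1)])
    have st: "pext s (w', p)" by (rule pext_trans[OF e(1) t])
    have "Bd x (w', p)"
      by (rule Bd_ext[OF Bd b st _ _ pext_refl[OF st]]) (use * in auto)
    moreover have "N.gimp (Bd x) (A x) (w', p)" using g t *(2) unfolding N.gall_def by force
    ultimately have "A x (w', p)" using N.gimpD pext_refl[OF t] by blast
    then show "fo (\<lambda>w z. \<phi> w z x) (w', p)" using srepD[OF A[OF st] pext_refl[OF t]] *(2) by simp
  qed
  show "N.gall (\<lambda>x. N.gimp (Bd x) (A x)) (w, p)"
    if f: "fo (\<lambda>w z. \<forall>w'. w \<preceq> w' \<longrightarrow> (\<forall>x\<in>D w'. bd w' x \<longrightarrow> \<phi> w' z x)) (w, p)"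
  proof (intro N.gallI N.gimpI)
    fix t x t' assume t: "pext (w, p) t" "x \<in> D (fst t)" "pext t t'" "Bd x t'"
    obtain w1 q where [simp]: "t' = (w1, q)" by force
    have e1: "pext (w, p) (w1, q)" "pext s (w1, q)" using pext_trans[OF t(1,3)] pext_trans[OF e(1)] by auto
    have x: "x \<in> D w1" using t(2,3) D_mono unfolding pext_def by auto
    note t' = pextD[OF e1(1)]
    have "fo (\<lambda>w _. bd w x) (w1, q)" using Bd[OF e1(2)] x t(4) by simp
    then have "fo (\<lambda>w z. \<phi> w z x) (w1, q)"
    proof (rule fo_join[OF t'(6) fo_mono[OF e1(1) f]])
      show "monoz w1 (\<lambda>w z. \<forall>w'. w \<preceq> w' \<longrightarrow> (\<forall>x\<in>D w'. bd w' x \<longrightarrow> \<phi> w' z x))"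
        unfolding monoz_def
      proof (intro allI impI ballI)
        fix w' z z' w'' x assume *: "w1 \<preceq> w'" "z \<in> D w'" "z' \<in> D w'" "sub w' z z'"
          "\<forall>w''. w' \<preceq> w'' \<longrightarrow> (\<forall>x\<in>D w''. bd w'' x \<longrightarrow> \<phi> w'' z x)" "w' \<preceq> w''" "x \<in> D w''" "bd w'' x"
        have l: "w1 \<preceq> w''" "w \<preceq> w''" "fst s \<preceq> w''" "w'' \<preceq> w''"
          using le_trans[OF *(1,6)] le_trans[OF t'(3)] le_trans[OF rw(3)] le_refl le_trans[OF t'(6)] by blast+
        show "\<phi> w'' z' x"
        proof (rule monozD[OF m[OF l(3) *(7)] l(4)])
          show "z \<in> D w''" "z' \<in> D w''" "sub w'' z z'"
            using D_mono[OF *(6)] sub_mono[OF *(6)] *(2-4) by blast+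
          show "\<phi> w'' z x" using * by blast
        qed
      qed
      show "monoz w1 (\<lambda>w z. bd w x)" by (rule monoz_const)
      fix w' z assume *: "w1 \<preceq> w'" "z \<in> D w'"
        "\<forall>w''. w' \<preceq> w'' \<longrightarrow> (\<forall>x\<in>D w''. bd w'' x \<longrightarrow> \<phi> w'' z x)" "bd w' x"
      then show "\<phi> w' z x" using le_refl le_trans[OF t'(6) *(1)] D_mono[OF *(1) x] by blast
    qed
    then show "A x t'" using srepD[OF A[OF e1(2)] pext_refl[OF e1(2)]] x by simp
  qed
qed

lemma prep_ball:
  assumes A: "\<And>t x. pext s t \<Longrightarrow> x \<in> D (fst t) \<Longrightarrow> prep (A x) (\<lambda>w z. \<chi> w z x) t"
    and Bd: "\<And>t x. pext s t \<Longrightarrow> x \<in> D (fst t) \<Longrightarrow> Bd x t \<longleftrightarrow> fo (\<lambda>w _. bd w x) t"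
    and b: "bounding (fst s) bd" and d: "definable True (fst s) (\<lambda>w u. \<chi> w (u 0) (u 1))"
  shows "prep (N.gall (\<lambda>x. N.gimp (Bd x) (A x)))
    (\<lambda>w z. \<forall>w'. w \<preceq> w' \<longrightarrow> (\<forall>x\<in>D w'. bd w' x \<longrightarrow> \<chi> w' z x)) s"
proof (rule prepI)
  fix w p assume e: "pext s (w, p)" "pext (w, p) (w, p)"
  have rw: "r \<preceq> w" "p \<in> D w" "fst s \<preceq> w" using e unfolding pext_def by auto
  show "po (\<lambda>w z. \<forall>w'. w \<preceq> w' \<longrightarrow> (\<forall>x\<in>D w'. bd w' x \<longrightarrow> \<chi> w' z x)) (w, p)"
    if g: "N.gall (\<lambda>x. N.gimp (Bd x) (A x)) (w, p)"
  proof (rule poI)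
    fix w1 y assume w1: "w \<preceq> w1" "y \<in> D w1"
    have t1: "pext (w, p) (w1, p)" by (rule pext_world[OF e(2) w1(1)])
    have sw1: "fst s \<preceq> w1" by (rule le_trans[OF rw(3) w1(1)])
    show "fo (\<lambda>w _. \<forall>w'. w \<preceq> w' \<longrightarrow> (\<forall>x\<in>D w'. bd w' x \<longrightarrow> \<chi> w' y x)) (w1, p)"
    proof (rule collect_br[OF pext_refl[OF t1] bounding_base[OF sw1 b]])
      show "definable True w1 (\<lambda>w u. \<chi> w y (u 1))"
        by (rule definable_app2[OF definable_base[OF d sw1] tm_const[OF w1(2)] tm_var])
      show "monoz w' (\<lambda>w z. \<chi> w y x)" for w' x by (rule monoz_const)
      fix w' x assume *: "w1 \<preceq> w'" "x \<in> D w'" "bd w' x"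
      have t: "pext (w, p) (w', p)" by (rule pext_world[OF e(2) le_trans[OF w1(1) *(1)]])
      have st: "pext s (w', p)" by (rule pext_trans[OF e(1) t])
      have "Bd x (w', p)"
        by (rule Bd_ext[OF Bd b st _ _ pext_refl[OF st]]) (use * in auto)
      moreover have "N.gimp (Bd x) (A x) (w', p)" using g t *(2) unfolding N.gall_def by force
      ultimately have "A x (w', p)" using N.gimpD pext_refl[OF t] by blast
      then have "po (\<lambda>w z. \<chi> w z x) (w', p)" using prepD[OF A[OF st] pext_refl[OF t]] *(2) by simp
      then show "fo (\<lambda>w z. \<chi> w y x) (w', p)"
        using poD pextD(8)[OF t] D_mono[OF *(1) w1(2)] by blast
    qed
  qed
  show "N.gall (\<lambda>x. N.gimp (Bd x) (A x)) (w, p)"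
    if f: "po (\<lambda>w z. \<forall>w'. w \<preceq> w' \<longrightarrow> (\<forall>x\<in>D w'. bd w' x \<longrightarrow> \<chi> w' z x)) (w, p)"
  proof (intro N.gallI N.gimpI)
    fix t x t' assume t: "pext (w, p) t" "x \<in> D (fst t)" "pext t t'" "Bd x t'"
    obtain w1 q where [simp]: "t' = (w1, q)" by force
    have e1: "pext (w, p) (w1, q)" "pext s (w1, q)" using pext_trans[OF t(1,3)] pext_trans[OF e(1)] by auto
    have x: "x \<in> D w1" using t(2,3) D_mono unfolding pext_def by auto
    note t' = pextD[OF e1(1)]
    have Bx: "fo (\<lambda>w _. bd w x) (w1, q)" using Bd[OF e1(2)] x t(4) by simp
    have "po (\<lambda>w z. \<chi> w z x) (w1, q)"
    proof (rule poI)
      fix w2 y assume w2: "w1 \<preceq> w2" "y \<in> D w2"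
      have rw2: "r \<preceq> w2" by (rule le_trans[OF t'(6) w2(1)])
      have e2: "pext (w1, q) (w2, q)" by (rule pext_world[OF pext_refl[OF e1(1)] w2(1)])
      show "fo (\<lambda>w _. \<chi> w y x) (w2, q)"
      proof (rule fo_join[OF rw2 poD[OF po_mono[OF e1(1) f] w2] fo_mono[OF e2 Bx] monoz_const monoz_const])
        fix w' z assume *: "w2 \<preceq> w'" "z \<in> D w'"
          "\<forall>w''. w' \<preceq> w'' \<longrightarrow> (\<forall>x\<in>D w''. bd w'' x \<longrightarrow> \<chi> w'' y x)" "bd w' x"
        then show "\<chi> w' y x"
          using le_refl[OF le_trans[OF rw2 *(1)]] D_mono[OF le_trans[OF w2(1) *(1)] x] by blast
      qed
    qed
    then show "A x t'" using prepD[OF A[OF e1(2)] pext_refl[OF e1(2)]] x by simp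
  qed
qed

lemma srep_bex:
  assumes A: "\<And>t x. pext s t \<Longrightarrow> x \<in> D (fst t) \<Longrightarrow> srep (A x) (\<lambda>w z. \<phi> w z x) t"
    and Bd: "\<And>t x. pext s t \<Longrightarrow> x \<in> D (fst t) \<Longrightarrow> Bd x t \<longleftrightarrow> fo (\<lambda>w _. bd w x) t"
    and b: "bounding (fst s) bd" and d: "definable True (fst s) (\<lambda>w u. \<phi> w (u 0) (u 1))"
    and m: "\<And>w' x. fst s \<preceq> w' \<Longrightarrow> x \<in> D w' \<Longrightarrow> monoz w' (\<lambda>w z. \<phi> w z x)"
    and g: "goal (fst s) (\<lambda>w z. \<exists>x\<in>D w. bd w x \<and> \<phi> w z x)"
  shows "srep (N.gex (\<lambda>x s. Bd x s \<and> A x s)) (\<lambda>w z. \<exists>x\<in>D w. bd w x \<and> \<phi> w z x) s"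
proof (rule srepI)
  fix w p assume e: "pext s (w, p)" "pext (w, p) (w, p)"
  have rw: "r \<preceq> w" "p \<in> D w" "fst s \<preceq> w" using e unfolding pext_def by auto
  show "fo (\<lambda>w z. \<exists>x\<in>D w. bd w x \<and> \<phi> w z x) (w, p)" if a: "N.gex (\<lambda>x s. Bd x s \<and> A x s) (w, p)"
  proof (rule gexD[OF a goal_base[OF rw(3) g] e(2)])
    fix w' q x assume t: "pext (w, p) (w', q)" "x \<in> D w'" "Bd x (w', q) \<and> A x (w', q)"
    have st: "pext s (w', q)" by (rule pext_trans[OF e(1) t(1)])
    have f: "fo (\<lambda>w _. bd w x) (w', q)" "fo (\<lambda>w z. \<phi> w z x) (w', q)"
      using Bd[OF st] srepD[OF A[OF st] pext_refl[OF st]] t by auto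
    note t' = pextD[OF t(1)]
    show "fo (\<lambda>w z. \<exists>x\<in>D w. bd w x \<and> \<phi> w z x) (w', q)"
      by (rule fo_join[OF t'(6) f monoz_const m[OF le_trans[OF rw(3) t'(3)] t(2)]])
        (use D_mono t(2) in blast)
  qed
  show "N.gex (\<lambda>x s. Bd x s \<and> A x s) (w, p)" if f: "fo (\<lambda>w z. \<exists>x\<in>D w. bd w x \<and> \<phi> w z x) (w, p)"
  proof -
    obtain z where z: "z \<in> D w" "\<And>w'. w \<preceq> w' \<Longrightarrow> br w' p z \<Longrightarrow> \<exists>x\<in>D w'. bd w' x \<and> \<phi> w' z x"
      by (rule foE[OF f]) blast
    show ?thesis
    proof (rule gex_itemizedI[where bd = bd and \<psi> = "\<lambda>w _ x. \<phi> w z x"])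
      fix t x assume t: "pext (w, p) t" "x \<in> D (fst t)" "bd (fst t) x"
      have st: "pext s t" by (rule pext_trans[OF e(1) t(1)])
      have ft: "fst s \<preceq> fst t" "z \<in> D (fst t)" using t(1) D_mono z(1) st unfolding pext_def by auto
      show "itemized (\<lambda>s. Bd x s \<and> A x s) (\<lambda>w _. \<phi> w z x) t"
      proof (rule itemized_conj)
        show "itemized (A x) (\<lambda>w _. \<phi> w z x) t"
          using itemized_srep[of "A x" "\<lambda>w z. \<phi> w z x" "fst t" "snd t" z] A[OF st t(2)] pext_refl[OF st]
            definable_fix[OF d ft t(2)] ft(2) by simp
      qed (rule Bd_ext[OF Bd b st t(2,3)])
    qed (use bounding_base[OF rw(3) b] definable_app2[OF definable_base[OF d rw(3)] tm_const[OF z(1)] tm_var]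
        po_constI[OF e(2) foI[OF z(1)]] z(2) in \<open>simp_all add: antiz_const\<close>)
  qed
qed

lemma prep_bex:
  assumes A: "\<And>t x. pext s t \<Longrightarrow> x \<in> D (fst t) \<Longrightarrow> prep (A x) (\<lambda>w z. \<chi> w z x) t"
    and Bd: "\<And>t x. pext s t \<Longrightarrow> x \<in> D (fst t) \<Longrightarrow> Bd x t \<longleftrightarrow> fo (\<lambda>w _. bd w x) t"
    and b: "bounding (fst s) bd" and d: "definable True (fst s) (\<lambda>w u. \<chi> w (u 0) (u 1))"
    and m: "\<And>w' x. fst s \<preceq> w' \<Longrightarrow> x \<in> D w' \<Longrightarrow> antiz w' (\<lambda>w z. \<chi> w z x)"
    and i: "\<And>w' x. fst s \<preceq> w' \<Longrightarrow> x \<in> D w' \<Longrightarrow> item w' (\<lambda>w z. \<chi> w z x)"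
  shows "prep (N.gex (\<lambda>x s. Bd x s \<and> A x s)) (\<lambda>w z. \<exists>x\<in>D w. bd w x \<and> \<chi> w z x) s"
proof (rule prepI)
  fix w p assume e: "pext s (w, p)" "pext (w, p) (w, p)"
  have rw: "r \<preceq> w" "p \<in> D w" "fst s \<preceq> w" using e unfolding pext_def by auto
  show "po (\<lambda>w z. \<exists>x\<in>D w. bd w x \<and> \<chi> w z x) (w, p)" if a: "N.gex (\<lambda>x s. Bd x s \<and> A x s) (w, p)"
  proof (rule poI)
    fix w1 y assume w1: "w \<preceq> w1" "y \<in> D w1"
    have t1: "pext (w, p) (w1, p)" by (rule pext_world[OF e(2) w1(1)])
    have sw1: "fst s \<preceq> w1" "r \<preceq> w1" using le_trans[OF _ w1(1)] rw by blast+
    show "fo (\<lambda>w _. \<exists>x\<in>D w. bd w x \<and> \<chi> w y x) (w1, p)"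
    proof (rule gexD[OF N.gex_mono[OF t1 a] _ pext_refl[OF t1]])
      have "definable True w1 (\<lambda>w u. \<exists>x\<in>D w. bd w x \<and> \<chi> w y x)"
      proof -
        \<comment> \<open>\<open>bd\<close> is an abstract class, so the quantifier over it is made
          Delta_0 by a set containing all its elements. The set comes from the bounding property
          applied to membership in the bound.\<close>
        obtain b' where b': "b' \<in> D w1" "\<And>w' x. w1 \<preceq> w' \<Longrightarrow> x \<in> D w' \<Longrightarrow> bd w' x \<Longrightarrow> E w' x b'"
        proof -
          have "\<exists>z\<in>D w1. \<forall>w' x. w1 \<preceq> w' \<longrightarrow> x \<in> D w' \<longrightarrow> bd w' x \<longrightarrow> E w' x z"
          proof (rule boundingD[OF b sw1(1), where P = "\<lambda>w z x. E w x z"])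
            show "definable True w1 (\<lambda>w u. E w (u 1) (u 0))" by (intro definable_intros)
            show "E w' x y'" if "w1 \<preceq> w'" "x \<in> D w'" "y \<in> D w'" "y' \<in> D w'" "sub w' y y'" "E w' x y" for w' x y y'
              using subD[OF le_trans[OF sw1(2) that(1)]] that by blast
            show "\<exists>y\<in>D w'. E w' x y" if "w1 \<preceq> w'" "x \<in> D w'" "bd w' x" for w' x
              using pairing[OF le_trans[OF sw1(2) that(1)] that(2) that(2)] by blast
          qed
          then show ?thesis using that by blast
        qed
        have "definable True w1 (\<lambda>w u. \<exists>x\<in>D w. E w x b' \<and> bd w x \<and> \<chi> w y x)"
          by (rule definable_bex[OF _ tm_const[OF b'(1)]])
            (intro definable_conj definable_app1[OF definable_base[OF bounding_definable[OF b] sw1(1)] tm_var]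
              definable_app2[OF definable_base[OF d sw1(1)] tm_const[OF w1(2)] tm_var])
        then show ?thesis by (rule definable_cong) (use b'(2) in blast)
      qed
      then show "goal w1 (\<lambda>w _. \<exists>x\<in>D w. bd w x \<and> \<chi> w y x)" by (rule goal_truth[OF sw1(2) w1(2)])
      fix w' q x assume t: "pext (w1, p) (w', q)" "x \<in> D w'" "Bd x (w', q) \<and> A x (w', q)"
      have st: "pext s (w', q)" by (rule pext_trans[OF e(1) pext_trans[OF t1 t(1)]])
      note t' = pextD[OF t(1)]
      have f: "fo (\<lambda>w _. bd w x) (w', q)" "po (\<lambda>w z. \<chi> w z x) (w', q)"
        using Bd[OF st] prepD[OF A[OF st] pext_refl[OF st]] t by auto
      show "fo (\<lambda>w _. \<exists>x\<in>D w. bd w x \<and> \<chi> w y x) (w', q)"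
        by (rule fo_join[OF t'(6) f(1) poD[OF f(2) t'(8) D_mono[OF t'(3) w1(2)]] monoz_const monoz_const])
          (use D_mono t(2) in blast)
    qed
  qed
  show "N.gex (\<lambda>x s. Bd x s \<and> A x s) (w, p)" if f: "po (\<lambda>w z. \<exists>x\<in>D w. bd w x \<and> \<chi> w z x) (w, p)"
  proof (rule gex_itemizedI[where bd = bd and \<psi> = \<chi>])
    fix t x assume t: "pext (w, p) t" "x \<in> D (fst t)" "bd (fst t) x"
    have st: "pext s t" by (rule pext_trans[OF e(1) t(1)])
    have ft: "fst s \<preceq> fst t" using st unfolding pext_def by auto
    show "itemized (\<lambda>s. Bd x s \<and> A x s) (\<lambda>w z. \<chi> w z x) t"
    proof (rule itemized_conj)
      show "itemized (A x) (\<lambda>w z. \<chi> w z x) t"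
        using itemized_prep[of "A x" "\<lambda>w z. \<chi> w z x" "fst t" "snd t"] A[OF st t(2)] pext_refl[OF st]
          i[OF ft t(2)] m[OF ft t(2)] by simp
    qed (rule Bd_ext[OF Bd b st t(2,3)])
  qed (use bounding_base[OF rw(3) b] definable_base[OF d rw(3)] f m le_trans[OF rw(3)] in simp_all)
qed

lemma singleton_above:
  assumes "r \<preceq> w" "x \<in> D w" "z \<in> D w"
  obtains y where "y \<in> D w" "sub w z y" "E w x y"
proof -
  obtain a where a: "a \<in> D w" "E w x a" "E w x a" by (rule pairing[OF assms(1,2,2)])
  obtain y where y: "y \<in> D w" "sub w z y" "sub w a y" by (rule join[OF assms(1,3) a(1)])
  show ?thesis by (rule that[OF y(1,2) subD[OF assms(1) y(3) assms(2) a(2)]])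
qed

text \<open>Restriction demands that the witness lie in the bound itself, so forward the bound is
  enlarged by the witness. Conversely, a fixed bound turns the quantifier into a bounded
  one.\<close>

lemma srep_ex:
  assumes A: "\<And>t x. pext s t \<Longrightarrow> x \<in> D (fst t) \<Longrightarrow> srep (A x) (\<lambda>w z. \<phi> w z x) t"
    and d: "definable True (fst s) (\<lambda>w u. \<phi> w (u 0) (u 1))"
    and m: "\<And>w' x. fst s \<preceq> w' \<Longrightarrow> x \<in> D w' \<Longrightarrow> monoz w' (\<lambda>w z. \<phi> w z x)"
    and g: "goal (fst s) (\<lambda>w z. \<exists>x\<in>D w. E w x z \<and> \<phi> w z x)"
  shows "srep (N.gex A) (\<lambda>w z. \<exists>x\<in>D w. E w x z \<and> \<phi> w z x) s"
proof (rule srepI)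
  fix w p assume e: "pext s (w, p)" "pext (w, p) (w, p)"
  have rw: "r \<preceq> w" "p \<in> D w" "fst s \<preceq> w" using e unfolding pext_def by auto
  show "fo (\<lambda>w z. \<exists>x\<in>D w. E w x z \<and> \<phi> w z x) (w, p)" if a: "N.gex A (w, p)"
  proof (rule gexD[OF a goal_base[OF rw(3) g] e(2)])
    fix w' q x assume t: "pext (w, p) (w', q)" "x \<in> D w'" "A x (w', q)"
    have st: "pext s (w', q)" by (rule pext_trans[OF e(1) t(1)])
    note t' = pextD[OF t(1)]
    have f: "fo (\<lambda>w z. \<phi> w z x) (w', q)" using srepD[OF A[OF st] pext_refl[OF st]] t by auto
    obtain z where z: "z \<in> D w'" "\<And>w''. w' \<preceq> w'' \<Longrightarrow> br w'' q z \<Longrightarrow> \<phi> w'' z x" by (rule foE[OF f]) blast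
    obtain y where y: "y \<in> D w'" "sub w' z y" "E w' x y" by (rule singleton_above[OF t'(6) t(2) z(1)])
    show "fo (\<lambda>w z. \<exists>x\<in>D w. E w x z \<and> \<phi> w z x) (w', q)"
    proof (rule foI[OF y(1)])
      fix w'' assume w: "w' \<preceq> w''" "br w'' q y"
      have s: "sub w'' z y" "x \<in> D w''" "z \<in> D w''" "y \<in> D w''" "E w'' x y"
        using sub_mono[OF w(1)] D_mono[OF w(1)] E_mono[OF w(1)] y z t(2) by blast+
      have "\<phi> w'' z x" by (rule z(2)[OF w(1) br_anti[OF s(1) w(2)]])
      then have "\<phi> w'' y x"
        by (rule monozD[OF m[OF le_trans[OF rw(3) t'(3)] t(2)] w(1) s(3,4,1)])
      then show "\<exists>x\<in>D w''. E w'' x y \<and> \<phi> w'' y x" using s by blast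
    qed
  qed
  show "N.gex A (w, p)" if f: "fo (\<lambda>w z. \<exists>x\<in>D w. E w x z \<and> \<phi> w z x) (w, p)"
  proof -
    obtain z where z: "z \<in> D w" "\<And>w'. w \<preceq> w' \<Longrightarrow> br w' p z \<Longrightarrow> \<exists>x\<in>D w'. E w' x z \<and> \<phi> w' z x"
      by (rule foE[OF f]) blast
    show ?thesis
    proof (rule gex_itemizedI[where bd = "\<lambda>w x. E w x z" and \<psi> = "\<lambda>w _ x. \<phi> w z x"])
      fix t x assume t: "pext (w, p) t" "x \<in> D (fst t)"
      have st: "pext s t" by (rule pext_trans[OF e(1) t(1)])
      have ft: "fst s \<preceq> fst t" "z \<in> D (fst t)" using t(1) D_mono z(1) st unfolding pext_def by auto
      show "itemized (A x) (\<lambda>w _. \<phi> w z x) t"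
        using itemized_srep[of "A x" "\<lambda>w z. \<phi> w z x" "fst t" "snd t" z] A[OF st t(2)] pext_refl[OF st]
          definable_fix[OF d ft t(2)] ft(2) by simp
    qed (use bounding_mem[OF rw(1) z(1)] definable_app2[OF definable_base[OF d rw(3)] tm_const[OF z(1)] tm_var]
        po_constI[OF e(2) foI[OF z(1)]] z(2) in \<open>simp_all add: antiz_const\<close>)
  qed
qed

text \<open>For a fixed \<open>y\<close> the restricted quantifier is bounded by \<open>y\<close>,
  and bounds are collected. Conversely a given \<open>x\<close> is put into a superset
  \<open>a\<close> of \<open>y\<close>; the instance at \<open>a\<close> descends to
  \<open>y\<close> by antitonicity.\<close>

lemma prep_all:
  assumes A: "\<And>t x. pext s t \<Longrightarrow> x \<in> D (fst t) \<Longrightarrow> prep (A x) (\<lambda>w z. \<chi> w z x) t"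
    and d: "definable True (fst s) (\<lambda>w u. \<chi> w (u 0) (u 1))"
    and m: "\<And>w' x. fst s \<preceq> w' \<Longrightarrow> x \<in> D w' \<Longrightarrow> antiz w' (\<lambda>w z. \<chi> w z x)"
  shows "prep (N.gall A) (\<lambda>w z. \<forall>w'. w \<preceq> w' \<longrightarrow> (\<forall>x\<in>D w'. E w' x z \<longrightarrow> \<chi> w' z x)) s"
proof (rule prepI)
  fix w p assume e: "pext s (w, p)" "pext (w, p) (w, p)"
  have rw: "r \<preceq> w" "p \<in> D w" "fst s \<preceq> w" using e unfolding pext_def by auto
  show "po (\<lambda>w z. \<forall>w'. w \<preceq> w' \<longrightarrow> (\<forall>x\<in>D w'. E w' x z \<longrightarrow> \<chi> w' z x)) (w, p)" if g: "N.gall A (w, p)"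
  proof (rule poI)
    fix w1 y assume w1: "w \<preceq> w1" "y \<in> D w1"
    have t1: "pext (w, p) (w1, p)" by (rule pext_world[OF e(2) w1(1)])
    have sw1: "fst s \<preceq> w1" by (rule le_trans[OF rw(3) w1(1)])
    show "fo (\<lambda>w _. \<forall>w'. w \<preceq> w' \<longrightarrow> (\<forall>x\<in>D w'. E w' x y \<longrightarrow> \<chi> w' y x)) (w1, p)"
    proof (rule collect_br[OF pext_refl[OF t1] bounding_mem[OF pextD(6)[OF t1] w1(2)]])
      show "definable True w1 (\<lambda>w u. \<chi> w y (u 1))"
        by (rule definable_app2[OF definable_base[OF d sw1] tm_const[OF w1(2)] tm_var])
      show "monoz w' (\<lambda>w z. \<chi> w y x)" for w' x by (rule monoz_const)
      fix w' x assume *: "w1 \<preceq> w'" "x \<in> D w'"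
      have t: "pext (w, p) (w', p)" by (rule pext_world[OF e(2) le_trans[OF w1(1) *(1)]])
      have st: "pext s (w', p)" by (rule pext_trans[OF e(1) t])
      have "A x (w', p)" using g t *(2) unfolding N.gall_def by force
      then have "po (\<lambda>w z. \<chi> w z x) (w', p)" using prepD[OF A[OF st] pext_refl[OF t]] *(2) by simp
      then show "fo (\<lambda>w z. \<chi> w y x) (w', p)"
        using poD pextD(8)[OF t] D_mono[OF *(1) w1(2)] by blast
    qed
  qed
  show "N.gall A (w, p)"
    if f: "po (\<lambda>w z. \<forall>w'. w \<preceq> w' \<longrightarrow> (\<forall>x\<in>D w'. E w' x z \<longrightarrow> \<chi> w' z x)) (w, p)"
  proof (intro N.gallI)
    fix t x assume t: "pext (w, p) t" "x \<in> D (fst t)"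
    obtain w1 q where [simp]: "t = (w1, q)" by force
    have st: "pext s t" by (rule pext_trans[OF e(1) t(1)])
    have x: "x \<in> D w1" using t(2) by simp
    note t' = pextD[OF t(1)[simplified]]
    have "po (\<lambda>w z. \<chi> w z x) (w1, q)"
    proof (rule poI)
      fix w2 y assume w2: "w1 \<preceq> w2" "y \<in> D w2"
      have rw2: "r \<preceq> w2" "fst s \<preceq> w2" using le_trans[OF t'(6) w2(1)] le_trans[OF le_trans[OF rw(3) t'(3)] w2(1)] .
      have x2: "x \<in> D w2" by (rule D_mono[OF w2(1) x])
      obtain a where a: "a \<in> D w2" "sub w2 y a" "E w2 x a" by (rule singleton_above[OF rw2(1) x2 w2(2)])
      show "fo (\<lambda>w _. \<chi> w y x) (w2, q)"
      proof (rule fo_weaken[OF poD[OF po_mono[OF t(1)[simplified] f] w2(1) a(1)]])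
        fix w' assume *: "w2 \<preceq> w'"
          "\<forall>w''. w' \<preceq> w'' \<longrightarrow> (\<forall>x\<in>D w''. E w'' x a \<longrightarrow> \<chi> w'' a x)"
        have s: "w' \<preceq> w'" "x \<in> D w'" "E w' x a" "sub w' y a" "y \<in> D w'" "a \<in> D w'"
          using le_refl[OF le_trans[OF rw2(1) *(1)]] D_mono[OF *(1)] E_mono[OF *(1)] sub_mono[OF *(1)] a x2 w2(2) by blast+
        then have "\<chi> w' a x" using *(2) by blast
        then show "\<chi> w' y x" by (rule antizD[OF m[OF rw2(2) x2] *(1) s(5,6,4)])
      qed
    qed
    then show "A x t" using prepD[OF A[OF st t(2)] pext_refl[OF st]] by simp
  qed
qed

end

section \<open>Satisfaction of formulas restricted to a bound\<close>

context kripke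
begin

text \<open>The meaning of \<open>rel\<close> with the bound as an element of the model instead of a
  variable; the bound then stays the same under binders.\<close>

primrec rforces :: "'w \<Rightarrow> 'd \<Rightarrow> (nat \<Rightarrow> 'd) \<Rightarrow> fm \<Rightarrow> bool" where
  "rforces w z v (Mem i j) = E w (v i) (v j)"
| "rforces w z v Bot = False"
| "rforces w z v (Conj A B) = (rforces w z v A \<and> rforces w z v B)"
| "rforces w z v (Disj A B) = (rforces w z v A \<or> rforces w z v B)"
| "rforces w z v (Imp A B) = (\<forall>w'. w \<preceq> w' \<longrightarrow> rforces w' z v A \<longrightarrow> rforces w' z v B)"
| "rforces w z v (All A) = (\<forall>w'. w \<preceq> w' \<longrightarrow> (\<forall>x\<in>D w'. E w' x z \<longrightarrow> rforces w' z (x ## v) A))"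
| "rforces w z v (Ex A) = (\<exists>x\<in>D w. E w x z \<and> rforces w z (x ## v) A)"
| "rforces w z v (BAll i A) = (\<forall>w'. w \<preceq> w' \<longrightarrow> (\<forall>x\<in>D w'. E w' x (v i) \<longrightarrow> rforces w' z (x ## v) A))"
| "rforces w z v (BEx i A) = (\<exists>x\<in>D w. E w x (v i) \<and> rforces w z (x ## v) A)"
| "rforces w z v (SAll i A) = (\<forall>w'. w \<preceq> w' \<longrightarrow> (\<forall>x\<in>D w'. sub w' x (v i) \<longrightarrow> rforces w' z (x ## v) A))"
| "rforces w z v (SEx i A) = (\<exists>x\<in>D w. sub w x (v i) \<and> rforces w z (x ## v) A)"

lemma forces_rel: "forces w v (rel k A) \<longleftrightarrow> rforces w (v k) v A"
  by (induction A arbitrary: w v k) simp_all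

lemma rforces_ren: "rforces w z v (ren \<rho> A) \<longleftrightarrow> rforces w z (v \<circ> \<rho>) A"
  by (induction A arbitrary: w v \<rho>) (simp_all add: econs_up)

lemma forces_rel_lift: "forces w (z ## v) (rel 0 (lift 0 A)) \<longleftrightarrow> rforces w z v A"
  by (simp add: forces_rel lift0_ren rforces_ren comp_def)

lemma rforces_delta0: "delta0 A \<Longrightarrow> rforces w z v A \<longleftrightarrow> forces w v A"
  by (induction A arbitrary: w v) simp_all

lemma delta0_rel: "delta0 (rel k A)"
  by (induction A arbitrary: k) simp_all

lemma definable_rforces:
  assumes "tm w0 t" "\<And>i. tm w0 (\<tau> i)"
  shows "definable d w0 (\<lambda>w u. rforces w (t u) (\<lambda>i. \<tau> i u) A)"
proof -
  have "definable d w0 (\<lambda>w u. forces w (\<lambda>i. (t ## \<tau>) i u) (rel 0 (lift 0 A)))"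
    by (rule definable_forces) (simp_all add: tm_econs assms delta0_rel)
  then show ?thesis by (simp add: econs_app forces_rel_lift)
qed

lemma definable_rforces1:
  assumes "\<And>i. v i \<in> D w0"
  shows "definable d w0 (\<lambda>w u. rforces w (u 0) v A)"
  using definable_rforces[of w0 "\<lambda>u. u 0" "\<lambda>i _. v i"] assms by (simp add: tm_var tm_const)

lemma definable_rforces2:
  assumes "\<And>i. v i \<in> D w0"
  shows "definable d w0 (\<lambda>w u. rforces w (u 0) (u 1 ## v) A)"
proof -
  have "definable d w0 (\<lambda>w u. rforces w (u 0) (\<lambda>i. ((\<lambda>u. u 1) ## (\<lambda>i _. v i)) i u) A)"
    by (rule definable_rforces) (simp_all add: tm_var tm_econs tm_const assms)
  then show ?thesis by (simp add: econs_app)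
qed

end

section \<open>Representation of the formulas of the two classes\<close>

context forcing
begin

text \<open>\<open>SR\<close> and \<open>PR\<close>: forcing the formula means what it should for \<open>\<Sigma>\<close>- respectively
  \<open>\<Pi>\<close>-formulas. \<open>MZ\<close> and \<open>AZ\<close>: its restriction to \<open>z\<close> is monotone respectively antitone in \<open>z\<close>.
  \<open>GO\<close> and \<open>IT\<close>: it is available as a goal respectively as a member of conditions.\<close>

definition MZ :: "fm \<Rightarrow> bool" where
  "MZ A \<longleftrightarrow> (\<forall>w z z' v. r \<preceq> w \<longrightarrow> sub w z z' \<longrightarrow> rforces w z v A \<longrightarrow> rforces w z' v A)"

definition AZ :: "fm \<Rightarrow> bool" where
  "AZ A \<longleftrightarrow> (\<forall>w z z' v. r \<preceq> w \<longrightarrow> sub w z z' \<longrightarrow> rforces w z' v A \<longrightarrow> rforces w z v A)"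

definition GO :: "fm \<Rightarrow> bool" where
  "GO A \<longleftrightarrow> (\<forall>w v. r \<preceq> w \<longrightarrow> (\<forall>i. v i \<in> D w) \<longrightarrow> goal w (\<lambda>w z. rforces w z v A))"

definition IT :: "fm \<Rightarrow> bool" where
  "IT A \<longleftrightarrow> (\<forall>w v. r \<preceq> w \<longrightarrow> (\<forall>i. v i \<in> D w) \<longrightarrow> item w (\<lambda>w z. rforces w z v A))"

definition SR :: "fm \<Rightarrow> bool" where
  "SR A \<longleftrightarrow> (\<forall>s v. pext s s \<longrightarrow> (\<forall>i. v i \<in> D (fst s)) \<longrightarrow> srep (N.N A v) (\<lambda>w z. rforces w z v A) s)"

definition PR :: "fm \<Rightarrow> bool" where
  "PR A \<longleftrightarrow> (\<forall>s v. pext s s \<longrightarrow> (\<forall>i. v i \<in> D (fst s)) \<longrightarrow> prep (N.N A v) (\<lambda>w z. rforces w z v A) s)"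

lemma SRD: "SR A \<Longrightarrow> pext s s \<Longrightarrow> (\<And>i. v i \<in> D (fst s)) \<Longrightarrow> srep (N.N A v) (\<lambda>w z. rforces w z v A) s"
  unfolding SR_def by blast

lemma PRD: "PR A \<Longrightarrow> pext s s \<Longrightarrow> (\<And>i. v i \<in> D (fst s)) \<Longrightarrow> prep (N.N A v) (\<lambda>w z. rforces w z v A) s"
  unfolding PR_def by blast

lemma env_ext:
  assumes "pext s t" "\<And>i. v i \<in> D (fst s)" "x \<in> D (fst t)"
  shows "(x ## v) i \<in> D (fst t)"
  using assms D_mono unfolding pext_def by (auto split: nat.splits)

lemma SRD2: "SR A \<Longrightarrow> pext s t \<Longrightarrow> (\<And>i. v i \<in> D (fst s)) \<Longrightarrow> x \<in> D (fst t) \<Longrightarrow>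
    srep (N.N A (x ## v)) (\<lambda>w z. rforces w z (x ## v) A) t"
  by (rule SRD[OF _ pext_refl]) (auto intro: env_ext)

lemma PRD2: "PR A \<Longrightarrow> pext s t \<Longrightarrow> (\<And>i. v i \<in> D (fst s)) \<Longrightarrow> x \<in> D (fst t) \<Longrightarrow>
    prep (N.N A (x ## v)) (\<lambda>w z. rforces w z (x ## v) A) t"
  by (rule PRD[OF _ pext_refl]) (auto intro: env_ext)

lemma MZD: "MZ A \<Longrightarrow> r \<preceq> w \<Longrightarrow> monoz w (\<lambda>w z. rforces w z v A)"
  unfolding MZ_def monoz_def using le_trans by blast

lemma AZD: "AZ A \<Longrightarrow> r \<preceq> w \<Longrightarrow> antiz w (\<lambda>w z. rforces w z v A)"
  unfolding AZ_def antiz_def using le_trans by blast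

lemma GOD: "GO A \<Longrightarrow> r \<preceq> w \<Longrightarrow> (\<And>i. v i \<in> D w) \<Longrightarrow> goal w (\<lambda>w z. rforces w z v A)"
  unfolding GO_def by blast

lemma ITD: "IT A \<Longrightarrow> r \<preceq> w \<Longrightarrow> (\<And>i. v i \<in> D w) \<Longrightarrow> item w (\<lambda>w z. rforces w z v A)"
  unfolding IT_def by blast

lemma pext_root: "pext s t \<Longrightarrow> r \<preceq> fst s"
  unfolding pext_def by blast

lemma SR_Conj: "SR A \<Longrightarrow> SR B \<Longrightarrow> MZ A \<Longrightarrow> MZ B \<Longrightarrow> SR (Conj A B)"
  unfolding SR_def[of "Conj A B"] N.N.simps rforces.simps
  by (intro allI impI srep_conj SRD MZD) (auto intro: pext_root)

lemma PR_Conj: "PR A \<Longrightarrow> PR B \<Longrightarrow> PR (Conj A B)"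
  unfolding PR_def[of "Conj A B"] N.N.simps rforces.simps
  by (intro allI impI prep_conj PRD) auto

lemma SR_Disj: "SR A \<Longrightarrow> SR B \<Longrightarrow> GO (Disj A B) \<Longrightarrow> SR (Disj A B)"
  unfolding SR_def[of "Disj A B"] N.N.simps rforces.simps
  by (intro allI impI srep_disj SRD definable_rforces1 GOD[of "Disj A B", unfolded rforces.simps])
    (auto intro: pext_root)

lemma PR_Disj: "PR A \<Longrightarrow> PR B \<Longrightarrow> AZ A \<Longrightarrow> AZ B \<Longrightarrow> IT A \<Longrightarrow> IT B \<Longrightarrow> PR (Disj A B)"
  unfolding PR_def[of "Disj A B"] N.N.simps rforces.simps
  by (intro allI impI prep_disj PRD AZD definable_rforces1 ITD) (auto intro: pext_root)

lemma SR_Imp: "PR A \<Longrightarrow> SR B \<Longrightarrow> AZ A \<Longrightarrow> MZ B \<Longrightarrow> IT A \<Longrightarrow> SR (Imp A B)"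
  unfolding SR_def[of "Imp A B"] N.N.simps rforces.simps
  by (intro allI impI srep_imp PRD SRD MZD AZD ITD) (auto intro: pext_root)

lemma PR_Imp: "SR A \<Longrightarrow> PR B \<Longrightarrow> MZ A \<Longrightarrow> AZ B \<Longrightarrow> PR (Imp A B)"
  unfolding PR_def[of "Imp A B"] N.N.simps rforces.simps
  by (intro allI impI prep_imp PRD SRD MZD AZD definable_rforces1) (auto intro: pext_root)

text \<open>Inclusion is a bounded universal formula with an atomic matrix, hence an instance of
  \<open>srep_ball\<close>. With this, subset-bounded quantifiers fall under the same lemmas as
  membership-bounded ones.\<close>

lemma gsub_fo:
  assumes "pext s t" "x \<in> D (fst t)" "y \<in> D (fst s)"
  shows "N.gsub x y t \<longleftrightarrow> fo (\<lambda>w _. sub w x y) t"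
proof -
  have y: "y \<in> D (fst t)" "r \<preceq> fst t" using assms D_mono le_trans unfolding pext_def by blast+
  have "srep (N.gsub x y) (\<lambda>w z. \<forall>w'. w \<preceq> w' \<longrightarrow> (\<forall>u\<in>D w'. E w' u x \<longrightarrow> E w' u y)) t"
    unfolding N.gsub_def
    by (rule srep_ball[where bd = "\<lambda>w u. E w u x" and \<phi> = "\<lambda>w _ u. E w u y"])
      (use y assms in \<open>simp_all add: srep_def monoz_const bounding_mem definable_mem tm_var tm_const\<close>)
  then show ?thesis using srepD pext_refl[OF assms(1)] unfolding sub_def by blast
qed

lemma gsub_fo': "pext s t \<Longrightarrow> (\<And>i. v i \<in> D (fst s)) \<Longrightarrow> x \<in> D (fst t) \<Longrightarrow>
    N.gsub x (v i) t \<longleftrightarrow> fo (\<lambda>w _. sub w x (v i)) t"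
  by (rule gsub_fo)

lemma root_ext: "pext s t \<Longrightarrow> fst s \<preceq> w \<Longrightarrow> r \<preceq> w"
  unfolding pext_def using le_trans by blast

lemma SR_BAll: "SR A \<Longrightarrow> MZ A \<Longrightarrow> SR (BAll i A)"
  unfolding SR_def[of "BAll i A"] N.N.simps rforces.simps
  by (intro allI impI srep_ball[where \<phi> = "\<lambda>w z x. rforces w z (x ## v) A" and bd = "\<lambda>w x. E w x (v i)" for v]
      SRD2 MZD bounding_mem definable_rforces2)
    (auto intro: pext_root root_ext)

lemma PR_BAll: "PR A \<Longrightarrow> PR (BAll i A)"
  unfolding PR_def[of "BAll i A"] N.N.simps rforces.simps
  by (intro allI impI prep_ball[where \<chi> = "\<lambda>w z x. rforces w z (x ## v) A" and bd = "\<lambda>w x. E w x (v i)" for v]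
      PRD2 bounding_mem definable_rforces2)
    (auto intro: pext_root root_ext)

lemma SR_SAll: "SR A \<Longrightarrow> MZ A \<Longrightarrow> SR (SAll i A)"
  unfolding SR_def[of "SAll i A"] N.N.simps rforces.simps
  by (intro allI impI srep_ball[where \<phi> = "\<lambda>w z x. rforces w z (x ## v) A" and bd = "\<lambda>w x. sub w x (v i)" for v]
      SRD2 MZD bounding_sub definable_rforces2 gsub_fo')
    (auto intro: pext_root root_ext)

lemma PR_SAll: "PR A \<Longrightarrow> PR (SAll i A)"
  unfolding PR_def[of "SAll i A"] N.N.simps rforces.simps
  by (intro allI impI prep_ball[where \<chi> = "\<lambda>w z x. rforces w z (x ## v) A" and bd = "\<lambda>w x. sub w x (v i)" for v]
      PRD2 bounding_sub definable_rforces2 gsub_fo')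
    (auto intro: pext_root root_ext)

lemma SR_BEx: "SR A \<Longrightarrow> MZ A \<Longrightarrow> GO (BEx i A) \<Longrightarrow> SR (BEx i A)"
  unfolding SR_def[of "BEx i A"] N.N.simps rforces.simps
  by (intro allI impI srep_bex[where \<phi> = "\<lambda>w z x. rforces w z (x ## v) A" and bd = "\<lambda>w x. E w x (v i)" for v]
      SRD2 MZD bounding_mem definable_rforces2 GOD[of "BEx i A", unfolded rforces.simps])
    (auto intro: pext_root root_ext)

lemma SR_SEx: "SR A \<Longrightarrow> MZ A \<Longrightarrow> GO (SEx i A) \<Longrightarrow> SR (SEx i A)"
  unfolding SR_def[of "SEx i A"] N.N.simps rforces.simps
  by (intro allI impI srep_bex[where \<phi> = "\<lambda>w z x. rforces w z (x ## v) A" and bd = "\<lambda>w x. sub w x (v i)" for v]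
      SRD2 MZD bounding_sub definable_rforces2 gsub_fo' GOD[of "SEx i A", unfolded rforces.simps])
    (auto intro: pext_root root_ext)

lemma env_D: "w \<preceq> w' \<Longrightarrow> (\<And>i. v i \<in> D w) \<Longrightarrow> x \<in> D w' \<Longrightarrow> (x ## v) i \<in> D w'"
  using D_mono by (auto split: nat.splits)

lemma PR_BEx: "PR A \<Longrightarrow> AZ A \<Longrightarrow> IT A \<Longrightarrow> PR (BEx i A)"
  unfolding PR_def[of "BEx i A"] N.N.simps rforces.simps
  by (intro allI impI prep_bex[where \<chi> = "\<lambda>w z x. rforces w z (x ## v) A" and bd = "\<lambda>w x. E w x (v i)" for v]
      PRD2 AZD ITD bounding_mem definable_rforces2)
    (auto intro: pext_root root_ext env_D)

lemma PR_SEx: "PR A \<Longrightarrow> AZ A \<Longrightarrow> IT A \<Longrightarrow> PR (SEx i A)"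
  unfolding PR_def[of "SEx i A"] N.N.simps rforces.simps
  by (intro allI impI prep_bex[where \<chi> = "\<lambda>w z x. rforces w z (x ## v) A" and bd = "\<lambda>w x. sub w x (v i)" for v]
      PRD2 AZD ITD bounding_sub definable_rforces2 gsub_fo')
    (auto intro: pext_root root_ext env_D)

lemma SR_Ex: "SR A \<Longrightarrow> MZ A \<Longrightarrow> GO (Ex A) \<Longrightarrow> SR (Ex A)"
  unfolding SR_def[of "Ex A"] N.N.simps rforces.simps
  by (intro allI impI srep_ex[where \<phi> = "\<lambda>w z x. rforces w z (x ## v) A" for v]
      SRD2 MZD definable_rforces2 GOD[of "Ex A", unfolded rforces.simps])
    (auto intro: pext_root root_ext)

lemma PR_All: "PR A \<Longrightarrow> AZ A \<Longrightarrow> PR (All A)"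
  unfolding PR_def[of "All A"] N.N.simps rforces.simps
  by (intro allI impI prep_all[where \<chi> = "\<lambda>w z x. rforces w z (x ## v) A" for v]
      PRD2 AZD definable_rforces2)
    (auto intro: pext_root root_ext)

lemma delta0_MZ: "delta0 A \<Longrightarrow> MZ A"
  unfolding MZ_def by (simp add: rforces_delta0)

lemma delta0_AZ: "delta0 A \<Longrightarrow> AZ A"
  unfolding AZ_def by (simp add: rforces_delta0)

lemma delta0_GO: "delta0 A \<Longrightarrow> GO A"
  unfolding GO_def
proof (intro allI impI)
  fix w and v :: "nat \<Rightarrow> 'd" assume a: "delta0 A" "r \<preceq> w" "\<forall>i. v i \<in> D w"
  \<comment> \<open>A Delta_0-formula does not feel the bound, so any element will do as bound;
    \<open>v 0\<close> is at hand.\<close>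
  have "definable True w (\<lambda>w u. rforces w (v 0) v A)"
    by (rule definable_rforces) (use a in \<open>simp_all add: tm_const\<close>)
  from goal_truth[OF a(2) a(3)[rule_format, of 0] this]
  show "goal w (\<lambda>w z. rforces w z v A)" using a(1) by (simp add: rforces_delta0)
qed

lemma delta0_IT: "delta0 A \<Longrightarrow> IT A"
  unfolding IT_def
proof (intro allI impI)
  fix w and v :: "nat \<Rightarrow> 'd" assume a: "delta0 A" "r \<preceq> w" "\<forall>i. v i \<in> D w"
  have "definable True w (\<lambda>w u. rforces w (v 0) v A)"
    by (rule definable_rforces) (use a in \<open>simp_all add: tm_const\<close>)
  from item_truth[OF a(2) a(3)[rule_format, of 0] this]
  show "item w (\<lambda>w z. rforces w z v A)" using a(1) by (simp add: rforces_delta0)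
qed

lemma po_const: "pext (w, p) (w, p) \<Longrightarrow> po (\<lambda>w _. P w) (w, p) \<longleftrightarrow> fo (\<lambda>w _. P w) (w, p)"
proof
  assume e: "pext (w, p) (w, p)"
  show "fo (\<lambda>w _. P w) (w, p)" if "po (\<lambda>w _. P w) (w, p)"
    using poD[OF that] e pext_valid le_refl by blast
  show "po (\<lambda>w _. P w) (w, p)" if "fo (\<lambda>w _. P w) (w, p)"
    by (rule po_constI[OF e that])
qed

text \<open>The restriction of a Delta_0-formula is independent of the bound, and then
  \<open>fo\<close> and \<open>po\<close> agree. This lets the antecedent of a Delta_0-implication
  be read as a \<Pi>-formula.\<close>

lemma delta0_SR_PR: "delta0 A \<Longrightarrow> SR A \<longleftrightarrow> PR A"
proof -
  assume d: "delta0 A"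
  have "fo (\<lambda>w z. rforces w z v A) t \<longleftrightarrow> po (\<lambda>w z. rforces w z v A) t" if "pext s t" for s t v
    using po_const[of "fst t" "snd t"] pext_refl[OF that] d by (simp add: rforces_delta0)
  then show ?thesis unfolding SR_def PR_def srep_def prep_def by blast
qed

lemma delta0_SR: "delta0 A \<Longrightarrow> SR A"
proof (induction A)
  case (Mem i j)
  show ?case unfolding SR_def srep_def by simp
next
  case Bot
  show ?case unfolding SR_def srep_def by simp
next
  case (Conj A B)
  then show ?case by (simp add: SR_Conj delta0_MZ)
next
  case (Disj A B)
  then show ?case by (simp add: SR_Disj delta0_MZ delta0_GO)
next
  case (Imp A B)
  then show ?case by (simp add: SR_Imp delta0_MZ delta0_AZ delta0_IT flip: delta0_SR_PR)
qed (simp_all add: SR_BAll SR_BEx SR_SAll SR_SEx delta0_MZ delta0_GO)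

lemma delta0_PR: "delta0 A \<Longrightarrow> PR A"
  using delta0_SR delta0_SR_PR by blast

text \<open>A larger bound admits more witnesses and imposes more instances. The induction is
  simultaneous because an antecedent belongs to the opposite class.\<close>

lemma SigmaP_PiP_mono: "(SigmaP A \<longrightarrow> MZ A) \<and> (PiP B \<longrightarrow> AZ B)"
proof -
  have e: "E w x z'" if "r \<preceq> w" "sub w z z'" "x \<in> D w" "E w x z" for w x z z'
    using subD that by blast
  have m: "r \<preceq> w \<Longrightarrow> w \<preceq> w' \<Longrightarrow> r \<preceq> w'" for w w' using le_trans by blast
  have "(SigmaP A \<Longrightarrow> MZ A)" "(PiP B \<Longrightarrow> AZ B)" for A B
  proof (induction rule: SigmaP_PiP.inducts)
    case (S_ex A)
    then show ?case unfolding MZ_def rforces.simps using e by blast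
  next
    case (P_all A)
    show ?case
      unfolding AZ_def rforces.simps
    proof (intro allI impI ballI)
      fix w z z' v w' x assume *: "r \<preceq> w" "sub w z z'"
        "\<forall>w'. w \<preceq> w' \<longrightarrow> (\<forall>x\<in>D w'. E w' x z' \<longrightarrow> rforces w' z' (x ## v) A)" "w \<preceq> w'" "x \<in> D w'" "E w' x z"
      have s: "r \<preceq> w'" "sub w' z z'" using m * sub_mono by blast+
      then have "rforces w' z' (x ## v) A" using * e by blast
      then show "rforces w' z (x ## v) A" using P_all.IH s unfolding AZ_def by blast
    qed
  next
    case (S_imp C A)
    show ?case
      unfolding MZ_def rforces.simps
    proof (intro allI impI)
      fix w z z' v w' assume *: "r \<preceq> w" "sub w z z'"
        "\<forall>w'. w \<preceq> w' \<longrightarrow> rforces w' z v C \<longrightarrow> rforces w' z v A" "w \<preceq> w'" "rforces w' z' v C"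
      have s: "r \<preceq> w'" "sub w' z z'" using m * sub_mono by blast+
      then have "rforces w' z v C" using S_imp.IH(1) *(5) unfolding AZ_def by blast
      then have "rforces w' z v A" using * by blast
      then show "rforces w' z' v A" using S_imp.IH(2) s unfolding MZ_def by blast
    qed
  next
    case (P_imp C A)
    show ?case
      unfolding AZ_def rforces.simps
    proof (intro allI impI)
      fix w z z' v w' assume *: "r \<preceq> w" "sub w z z'"
        "\<forall>w'. w \<preceq> w' \<longrightarrow> rforces w' z' v C \<longrightarrow> rforces w' z' v A" "w \<preceq> w'" "rforces w' z v C"
      have s: "r \<preceq> w'" "sub w' z z'" using m * sub_mono by blast+
      then have "rforces w' z' v C" using P_imp.IH(1) *(5) unfolding MZ_def by blast
      then have "rforces w' z' v A" using * by blast
      then show "rforces w' z v A" using P_imp.IH(2) s unfolding AZ_def by blast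
    qed
  next
    case (S_neg C)
    show ?case
      unfolding MZ_def rforces.simps Neg_def
    proof (intro allI impI)
      fix w z z' v w' assume *: "r \<preceq> w" "sub w z z'"
        "\<forall>w'. w \<preceq> w' \<longrightarrow> rforces w' z v C \<longrightarrow> False" "w \<preceq> w'" "rforces w' z' v C"
      have s: "r \<preceq> w'" "sub w' z z'" using m * sub_mono by blast+
      then have "rforces w' z v C" using S_neg.IH *(5) unfolding AZ_def by blast
      then show False using * by blast
    qed
  next
    case (P_neg C)
    show ?case
      unfolding AZ_def rforces.simps Neg_def
    proof (intro allI impI)
      fix w z z' v w' assume *: "r \<preceq> w" "sub w z z'"
        "\<forall>w'. w \<preceq> w' \<longrightarrow> rforces w' z' v C \<longrightarrow> False" "w \<preceq> w'" "rforces w' z v C"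
      have s: "r \<preceq> w'" "sub w' z z'" using m * sub_mono by blast+
      then have "rforces w' z' v C" using P_neg.IH *(5) unfolding MZ_def by blast
      then show False using * by blast
    qed
  next
    case (S_ball A i)
    then show ?case unfolding MZ_def rforces.simps using m sub_mono by metis
  next
    case (S_sall A i)
    then show ?case unfolding MZ_def rforces.simps using m sub_mono by metis
  next
    case (P_ball A i)
    then show ?case unfolding AZ_def rforces.simps using m sub_mono by metis
  next
    case (P_sall A i)
    then show ?case unfolding AZ_def rforces.simps using m sub_mono by metis
  qed (auto simp: MZ_def AZ_def intro: delta0_MZ[unfolded MZ_def, rule_format] delta0_AZ[unfolded AZ_def, rule_format])
  then show ?thesis by blast
qed

definition cov :: "fm \<Rightarrow> bool" where
  "cov A \<longleftrightarrow> (\<forall>w v. r \<preceq> w \<longrightarrow> (\<forall>i. v i \<in> D w) \<longrightarrow> coded w (\<lambda>w z. rforces w z v A))"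

lemma cov_GO: "cov A \<Longrightarrow> MZ A \<Longrightarrow> GO A"
  unfolding GO_def cov_def using coded_goal MZD by blast

lemma cov_IT: "cov A \<Longrightarrow> AZ A \<Longrightarrow> IT A"
  unfolding IT_def cov_def using coded_item AZD by blast

end

text \<open>The compound subformulas, a finite set. Atoms may be left out: as Delta_0-formulas they
  have codes through their truth values (\<open>delta0_GO\<close>,
  \<open>delta0_IT\<close>).\<close>

primrec sf :: "fm \<Rightarrow> fm set" where
  "sf (Mem i j) = {}"
| "sf Bot = {}"
| "sf (Conj A B) = insert (Conj A B) (sf A \<union> sf B)"
| "sf (Disj A B) = insert (Disj A B) (sf A \<union> sf B)"
| "sf (Imp A B) = insert (Imp A B) (sf A \<union> sf B)"
| "sf (All A) = insert (All A) (sf A)"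
| "sf (Ex A) = insert (Ex A) (sf A)"
| "sf (BAll i A) = insert (BAll i A) (sf A)"
| "sf (BEx i A) = insert (BEx i A) (sf A)"
| "sf (SAll i A) = insert (SAll i A) (sf A)"
| "sf (SEx i A) = insert (SEx i A) (sf A)"

lemma finite_sf: "finite (sf A)"
  by (induction A) auto

lemma sf_self: "delta0 A \<or> A \<in> sf A"
  by (cases A) auto

context forcing
begin

theorem SigmaP_PiP_rep:
  shows "SigmaP A \<Longrightarrow> \<forall>B\<in>sf A. cov B \<Longrightarrow> SR A" and "PiP B \<Longrightarrow> \<forall>A\<in>sf B. cov A \<Longrightarrow> PR B"
proof (induction rule: SigmaP_PiP.inducts)
  have MZ: "SigmaP A \<Longrightarrow> MZ A" and AZ: "PiP A \<Longrightarrow> AZ A" for A using SigmaP_PiP_mono by blast+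
  have GO: "GO A" if "SigmaP A" "\<forall>B\<in>sf A. cov B" for A
    using sf_self[of A] delta0_GO cov_GO MZ that by blast
  have IT: "IT A" if "PiP A" "\<forall>B\<in>sf A. cov B" for A
    using sf_self[of A] delta0_IT cov_IT AZ that by blast
  {
    case (S_disj A B)
    have "GO (Disj A B)" by (rule GO) (use S_disj SigmaP_PiP.S_disj in auto)
    then show ?case using S_disj MZ by (simp add: SR_Disj)
  next
    case (S_bex A i)
    have "GO (BEx i A)" by (rule GO) (use S_bex SigmaP_PiP.S_bex in auto)
    then show ?case using S_bex MZ by (simp add: SR_BEx)
  next
    case (S_sex A i)
    have "GO (SEx i A)" by (rule GO) (use S_sex SigmaP_PiP.S_sex in auto)
    then show ?case using S_sex MZ by (simp add: SR_SEx)
  next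
    case (S_ex A)
    have "GO (Ex A)" by (rule GO) (use S_ex SigmaP_PiP.S_ex in auto)
    then show ?case using S_ex MZ by (simp add: SR_Ex)
  next
    case (S_neg C)
    then show ?case using AZ IT by (simp add: Neg_def SR_Imp delta0_SR delta0_MZ)
  next
    case (S_imp C A)
    then show ?case using AZ IT MZ by (simp add: SR_Imp)
  next
    case (P_neg D)
    then show ?case using MZ by (simp add: Neg_def PR_Imp delta0_PR delta0_AZ)
  next
    case (P_imp D A)
    then show ?case using AZ MZ by (simp add: PR_Imp)
  next
    case (S_conj A B)
    then show ?case using MZ by (simp add: SR_Conj)
  next
    case (S_ball A i)
    then show ?case using MZ by (simp add: SR_BAll)
  next
    case (S_sall A i)
    then show ?case using MZ by (simp add: SR_SAll)
  next
    case (P_disj A B)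
    then show ?case using AZ IT by (simp add: PR_Disj)
  next
    case (P_bex A i)
    then show ?case using AZ IT by (simp add: PR_BEx)
  next
    case (P_sex A i)
    then show ?case using AZ IT by (simp add: PR_SEx)
  next
    case (P_all A)
    then show ?case using AZ by (simp add: PR_All)
  next
    case (P_conj A B)
    then show ?case by (simp add: PR_Conj)
  next
    case (P_ball A i)
    then show ?case by (simp add: PR_BAll)
  next
    case (P_sall A i)
    then show ?case by (simp add: PR_SAll)
  next
    case (S_d0 A)
    then show ?case by (simp add: delta0_SR)
  next
    case (P_d0 A)
    then show ?case by (simp add: delta0_PR)
  }
qed

end

section \<open>The axioms are forced\<close>

context forcing
begin

section \<open>Definability of the forcing relation\<close>

lemma definable_True: "definable d w0 (\<lambda>w u. True)"
  by (rule definable_cong[OF definable_imp[OF definable_bot definable_bot]]) simp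

lemma definable_fo:
  assumes "r \<preceq> w0" "tm w0 t" "definable False w0 (\<lambda>w u. \<phi> w (u 0) (\<lambda>i. u (Suc i)))"
  shows "definable False w0 (\<lambda>w u. fo (\<lambda>w z. \<phi> w z u) (w, t u))"
  unfolding fo_def fst_conv snd_conv
  by (rule definable_ex[where Q = "\<lambda>w z u. \<forall>w'. w \<preceq> w' \<longrightarrow> br w' (t u) z \<longrightarrow> \<phi> w' z u"])
    (intro definable_imp definable_br assms tm_var tm_shift[OF assms(2)], simp)

text \<open>An extension is a later world with a larger condition. Two universal quantifiers and an
  implication express this, each with its own passage to a later world; since domains grow, the
  three passages can be taken as one.\<close>

lemma definable_pext2:
  assumes w0: "r \<preceq> w0" and t: "tm w0 t"
    and P: "definable False w0 (\<lambda>w v. P w (v 0) (v 1) (\<lambda>i. v (Suc (Suc i))))"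
    and Q: "definable False w0 (\<lambda>w v. Q w (v 0) (v 1) (\<lambda>i. v (Suc (Suc i))))"
  shows "definable False w0 (\<lambda>w u. \<forall>w' q. pext (w, t u) (w', q) \<longrightarrow> (\<forall>x\<in>D w'. P w' x q u \<longrightarrow> Q w' x q u))"
proof -
  have "definable False w0 (\<lambda>w u. \<forall>w1. w \<preceq> w1 \<longrightarrow> (\<forall>q\<in>D w1. \<forall>w2. w1 \<preceq> w2 \<longrightarrow> (\<forall>x\<in>D w2. 
      \<forall>w3. w2 \<preceq> w3 \<longrightarrow> (sub w3 (t u) q \<and> P w3 x q u) \<longrightarrow> Q w3 x q u)))"
    by (rule definable_all, rule definable_all[where Q = "\<lambda>w x v. \<forall>w3. w \<preceq> w3 \<longrightarrow>
        sub w3 (t (\<lambda>i. v (Suc i))) (v 0) \<and> P w3 x (v 0) (\<lambda>i. v (Suc i)) \<longrightarrow> Q w3 x (v 0) (\<lambda>i. v (Suc i))"])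
      (intro definable_imp definable_conj definable_sub tm_var tm_shift[OF t] P[simplified] Q[simplified], simp_all)
  then show ?thesis
  proof (rule definable_cong)
    fix w and u :: "nat \<Rightarrow> 'd" assume w: "w0 \<preceq> w" "\<And>i. u i \<in> D w"
    have rw: "r \<preceq> w" "t u \<in> D w" using le_trans[OF w0 w(1)] tm_in[OF t w(1)] w(2) by blast+
    show "(\<forall>w' q. pext (w, t u) (w', q) \<longrightarrow> (\<forall>x\<in>D w'. P w' x q u \<longrightarrow> Q w' x q u)) \<longleftrightarrow>
      (\<forall>w1. w \<preceq> w1 \<longrightarrow> (\<forall>q\<in>D w1. \<forall>w2. w1 \<preceq> w2 \<longrightarrow> (\<forall>x\<in>D w2. 
      \<forall>w3. w2 \<preceq> w3 \<longrightarrow> (sub w3 (t u) q \<and> P w3 x q u) \<longrightarrow> Q w3 x q u)))" (is "?L = ?R")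
    proof
      assume L: ?L
      show ?R
      proof (intro allI impI ballI, elim conjE)
        fix w1 q w2 x w3 assume *: "w \<preceq> w1" "q \<in> D w1" "w1 \<preceq> w2" "x \<in> D w2" "w2 \<preceq> w3" "sub w3 (t u) q" "P w3 x q u"
        have "w \<preceq> w3" "q \<in> D w3" "x \<in> D w3" using * le_trans D_mono by blast+
        then have "pext (w, t u) (w3, q)" using rw *(6) unfolding pext_def by simp
        then show "Q w3 x q u" using L *(7) \<open>x \<in> D w3\<close> by blast
      qed
    next
      assume R: ?R
      show ?L
      proof (intro allI impI ballI)
        fix w' q x assume *: "pext (w, t u) (w', q)" "x \<in> D w'" "P w' x q u"
        show "Q w' x q u" using R pextD[OF *(1)] *(2,3) by blast
      qed
    qed
  qed
qed

lemma definable_pext1: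
  assumes w0: "r \<preceq> w0" and t: "tm w0 t"
    and P: "definable False w0 (\<lambda>w v. P w (v 0) (\<lambda>i. v (Suc i)))"
    and Q: "definable False w0 (\<lambda>w v. Q w (v 0) (\<lambda>i. v (Suc i)))"
  shows "definable False w0 (\<lambda>w u. \<forall>w' q. pext (w, t u) (w', q) \<longrightarrow> P w' q u \<longrightarrow> Q w' q u)"
proof -
  have *: "definable False w0 (\<lambda>w v. P w (v 1) (\<lambda>i. v (Suc (Suc i))))"
    "definable False w0 (\<lambda>w v. Q w (v 1) (\<lambda>i. v (Suc (Suc i))))"
    using definable_subst[OF P, of "\<lambda>i v. v (Suc i)"] definable_subst[OF Q, of "\<lambda>i v. v (Suc i)"]
    by (simp_all add: tm_var)
  show ?thesis
  proof (rule definable_cong[OF definable_pext2[OF w0 t, of "\<lambda>w x. P w" "\<lambda>w x. Q w"]])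
    fix w and u :: "nat \<Rightarrow> 'd"
    \<comment> \<open>The additional quantifier over \<open>x\<close> is harmless because the domain
      contains the condition \<open>q\<close>.\<close>
    have "D w' \<noteq> {}" if "pext (w, t u) (w', q)" for w' q using pextD(4)[OF that] by blast
    then show "(\<forall>w' q. pext (w, t u) (w', q) \<longrightarrow> P w' q u \<longrightarrow> Q w' q u) \<longleftrightarrow>
        (\<forall>w' q. pext (w, t u) (w', q) \<longrightarrow> (\<forall>x\<in>D w'. P w' q u \<longrightarrow> Q w' q u))" by blast
  qed (use * in simp_all)
qed

text \<open>Slot 0 holds the condition and the other slots hold the free variables of the formula;
  the world of the stage is the world of evaluation.\<close>

definition dN :: "fm \<Rightarrow> bool" where
  "dN A \<longleftrightarrow> definable False r (\<lambda>w u. N.N A (\<lambda>i. u (Suc i)) (w, u 0))"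

lemma dN_use:
  assumes "dN A" "r \<preceq> w0" "\<And>i. tm w0 (\<tau> i)" "tm w0 t"
  shows "definable False w0 (\<lambda>w u. N.N A (\<lambda>i. \<tau> i u) (w, t u))"
proof -
  have "tm w0 ((t ## \<tau>) i)" for i by (rule tm_econs) (use assms in auto)
  from definable_subst[OF definable_base[OF assms(1)[unfolded dN_def] assms(2)], where \<sigma> = "t ## \<tau>", OF this]
  show ?thesis by simp
qed

lemma tm_env: "tm w0 t \<Longrightarrow> (\<And>i. tm w0 (\<tau> i)) \<Longrightarrow> tm w0 (\<lambda>u. (t u ## (\<lambda>i. \<tau> i u)) j)"
  by (cases j) auto

lemma definable_gall:
  assumes "definable False r (\<lambda>w v. F (v 0) (\<lambda>i. v (Suc (Suc i))) (w, v 1))" "tm r t"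
  shows "definable False r (\<lambda>w u. N.gall (\<lambda>x. F x u) (w, t u))"
  using definable_pext2[OF le_root assms(2) definable_True, of "\<lambda>w x q u. F x u (w, q)"] assms(1)
  by (simp add: N.gall_def)

lemma definable_gimp:
  assumes "definable False r (\<lambda>w v. A (\<lambda>i. v (Suc i)) (w, v 0))"
    "definable False r (\<lambda>w v. B (\<lambda>i. v (Suc i)) (w, v 0))" "tm r t"
  shows "definable False r (\<lambda>w u. N.gimp (A u) (B u) (w, t u))"
  using definable_pext1[OF le_root assms(3), of "\<lambda>w q u. A u (w, q)" "\<lambda>w q u. B u (w, q)"] assms(1,2)
  by (simp add: N.gimp_def)

lemma definable_GL:
  assumes "tm r g" "tm r t"
  shows "definable False r (\<lambda>w u. fo (\<lambda>w z. gm w z (g u)) (w, t u))"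
  by (rule definable_fo[OF le_root assms(2), where \<phi> = "\<lambda>w z u. gm w z (g u)"])
    (intro definable_gm le_root tm_var tm_shift[OF assms(1)])

lemma definable_Mm:
  assumes "tm r x" "tm r y" "tm r t"
  shows "definable False r (\<lambda>w u. fo (\<lambda>w _. E w (x u) (y u)) (w, t u))"
  by (rule definable_fo[OF le_root assms(3), where \<phi> = "\<lambda>w z u. E w (x u) (y u)"])
    (intro definable_mem tm_shift[OF assms(1)] tm_shift[OF assms(2)])

lemma definable_gex:
  assumes "definable False r (\<lambda>w v. F (v 0) (\<lambda>i. v (Suc (Suc i))) (w, v 1))" "tm r t"
  shows "definable False r (\<lambda>w u. N.gex (\<lambda>x. F x u) (w, t u))"
proof -
  have F: "definable False r (\<lambda>w v. F (v 0) (\<lambda>i. v (Suc (Suc (Suc (Suc i))))) (w, v 1))"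
    using definable_subst[OF assms(1), of "(\<lambda>v. v 0) ## ((\<lambda>v. v 1) ## (\<lambda>i v. v (Suc (Suc (Suc (Suc i))))))"]
    by (simp add: tm_econs tm_var)
  have "definable False r (\<lambda>w v. \<forall>w' q. pext (w, v 1) (w', q) \<longrightarrow> (\<forall>x\<in>D w'.
      F x (\<lambda>i. v (Suc (Suc i))) (w', q) \<longrightarrow> fo (\<lambda>w z. gm w z (v 0)) (w', q)))"
    by (rule definable_pext2[OF le_root tm_var, where Q = "\<lambda>w x q v. fo (\<lambda>w z. gm w z (v 0)) (w, q)"
          and P = "\<lambda>w x q v. F x (\<lambda>i. v (Suc (Suc i))) (w, q)"])
      (rule F, rule definable_GL, rule tm_var, rule tm_var)
  from definable_pext2[OF le_root assms(2), of "\<lambda>w g q u. \<forall>w' q'. pext (w, q) (w', q') \<longrightarrow> (\<forall>x\<in>D w'.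
      F x u (w', q') \<longrightarrow> fo (\<lambda>w z. gm w z g) (w', q'))" "\<lambda>w g q u. fo (\<lambda>w z. gm w z g) (w, q)",
    OF this definable_GL[OF tm_var tm_var]]
  show ?thesis by (simp add: N.gex_def)
qed

lemma definable_gor:
  assumes "definable False r (\<lambda>w v. A (\<lambda>i. v (Suc i)) (w, v 0))"
    "definable False r (\<lambda>w v. B (\<lambda>i. v (Suc i)) (w, v 0))" "tm r t"
  shows "definable False r (\<lambda>w u. N.gor (A u) (B u) (w, t u))"
proof -
  have h: "definable False r (\<lambda>w v. \<forall>w' q. pext (w, v 1) (w', q) \<longrightarrow>
      C (\<lambda>i. v (Suc (Suc i))) (w', q) \<longrightarrow> fo (\<lambda>w z. gm w z (v 0)) (w', q))"
    if C: "definable False r (\<lambda>w v. C (\<lambda>i. v (Suc i)) (w, v 0))" for C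
  proof -
    have "definable False r (\<lambda>w v. C (\<lambda>i. v (Suc (Suc (Suc i)))) (w, v 0))"
      using definable_subst[OF C, of "(\<lambda>v. v 0) ## (\<lambda>i v. v (Suc (Suc (Suc i))))"]
      by (simp add: tm_econs tm_var)
    from definable_pext1[OF le_root tm_var, of "\<lambda>w q v. C (\<lambda>i. v (Suc (Suc i))) (w, q)"
        "\<lambda>w q v. fo (\<lambda>w z. gm w z (v 0)) (w, q)" 1, OF this definable_GL[OF tm_var tm_var]]
    show ?thesis .
  qed
  from definable_pext2[OF le_root assms(3), of "\<lambda>w g q u. (\<forall>w' q'. pext (w, q) (w', q') \<longrightarrow>
      A u (w', q') \<longrightarrow> fo (\<lambda>w z. gm w z g) (w', q')) \<and> (\<forall>w' q'. pext (w, q) (w', q') \<longrightarrow>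
      B u (w', q') \<longrightarrow> fo (\<lambda>w z. gm w z g) (w', q'))" "\<lambda>w g q u. fo (\<lambda>w z. gm w z g) (w, q)",
    OF definable_conj[OF h[OF assms(1)] h[OF assms(2)]] definable_GL[OF tm_var tm_var]]
  show ?thesis by (simp add: N.gor_def imp_conjL)
qed

lemma definable_gsub:
  assumes "tm r x" "tm r y" "tm r t"
  shows "definable False r (\<lambda>w u. N.gsub (x u) (y u) (w, t u))"
  unfolding N.gsub_def
  by (rule definable_gall[OF _ assms(3), where F = "\<lambda>z u. N.gimp (\<lambda>s. fo (\<lambda>w _. E w z (x u)) s) (\<lambda>s. fo (\<lambda>w _. E w z (y u)) s)"],
      rule definable_gimp[where A = "\<lambda>v s. fo (\<lambda>w _. E w (v 0) (x (\<lambda>i. v (Suc (Suc i))))) s" and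
        B = "\<lambda>v s. fo (\<lambda>w _. E w (v 0) (y (\<lambda>i. v (Suc (Suc i))))) s"])
    (intro definable_Mm tm_var tm_shift[OF assms(1)] tm_shift[OF assms(2)])+

text \<open>The defining formula is not Delta_0. It is needed for set induction alone, which is
  available for all formulas.\<close>

theorem definable_N: "dN A"
proof (induction A)
  case (Mem i j)
  show ?case unfolding dN_def N.N.simps by (intro definable_Mm tm_var)
next
  case Bot
  show ?case unfolding dN_def N.N.simps
    by (rule definable_fo[OF le_root tm_var, of "\<lambda>_ _ _. False"]) (rule definable_bot)
next
  case (Conj A B)
  then show ?case unfolding dN_def N.N.simps by (rule definable_conj)
next
  case (Disj A B)
  show ?case unfolding dN_def N.N.simps
    by (rule definable_gor[where A = "\<lambda>u. N.N A (\<lambda>i. u (Suc i))" and B = "\<lambda>u. N.N B (\<lambda>i. u (Suc i))"])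
      (intro dN_use Disj le_root tm_var)+
next
  case (Imp A B)
  show ?case unfolding dN_def N.N.simps
    by (rule definable_gimp[where A = "\<lambda>u. N.N A (\<lambda>i. u (Suc i))" and B = "\<lambda>u. N.N B (\<lambda>i. u (Suc i))"])
      (intro dN_use Imp le_root tm_var)+
next
  case (All A)
  show ?case unfolding dN_def N.N.simps
    by (rule definable_gall[where F = "\<lambda>x u. N.N A (x ## (\<lambda>i. u (Suc i)))"])
      (intro dN_use All le_root tm_var tm_env)+
next
  case (Ex A)
  show ?case unfolding dN_def N.N.simps
    by (rule definable_gex[where F = "\<lambda>x u. N.N A (x ## (\<lambda>i. u (Suc i)))"])
      (intro dN_use Ex le_root tm_var tm_env)+
next
  case (BAll k A)
  show ?case unfolding dN_def N.N.simps
    by (rule definable_gall[where F = "\<lambda>x u. N.gimp (\<lambda>s. fo (\<lambda>w _. E w x (u (Suc k))) s) (N.N A (x ## (\<lambda>i. u (Suc i))))"],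
        rule definable_gimp[where A = "\<lambda>u s. fo (\<lambda>w _. E w (u 0) (u (Suc (Suc (Suc k))))) s" and
          B = "\<lambda>u. N.N A (u 0 ## (\<lambda>i. u (Suc (Suc (Suc i)))))"])
      (intro dN_use BAll le_root definable_Mm tm_var tm_env)+
next
  case (SAll k A)
  show ?case unfolding dN_def N.N.simps
    by (rule definable_gall[where F = "\<lambda>x u. N.gimp (N.gsub x (u (Suc k))) (N.N A (x ## (\<lambda>i. u (Suc i))))"],
        rule definable_gimp[where A = "\<lambda>u. N.gsub (u 0) (u (Suc (Suc (Suc k))))" and
          B = "\<lambda>u. N.N A (u 0 ## (\<lambda>i. u (Suc (Suc (Suc i)))))"])
      (intro dN_use SAll le_root definable_gsub tm_var tm_env)+
next
  case (BEx k A)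
  show ?case unfolding dN_def N.N.simps
    by (rule definable_gex[where F = "\<lambda>x u s. fo (\<lambda>w _. E w x (u (Suc k))) s \<and> N.N A (x ## (\<lambda>i. u (Suc i))) s"],
        rule definable_conj)
      (intro dN_use BEx le_root definable_Mm tm_var tm_env)+
next
  case (SEx k A)
  show ?case unfolding dN_def N.N.simps
    by (rule definable_gex[where F = "\<lambda>x u s. N.gsub x (u (Suc k)) s \<and> N.N A (x ## (\<lambda>i. u (Suc i))) s"],
        rule definable_conj)
      (intro dN_use SEx le_root definable_gsub tm_var tm_env)+
qed

text \<open>Forcing is local: \<open>A\<close> may be verified under the hypothesis that the
  condition holds restricted to some \<open>z\<close>. By \<open>N_closed\<close> it suffices to
  treat a goal. Its bounds, found at the worlds where the hypothesis holds, are made uniform by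
  \<open>implication_mono\<close>.\<close>

lemma N_fo_closed:
  assumes e: "pext (w, p) (w, p)" "\<And>i. v i \<in> D w" and z: "z \<in> D w"
    and h: "\<And>w'. w \<preceq> w' \<Longrightarrow> br w' p z \<Longrightarrow> N.N A v (w', p)"
  shows "N.N A v (w, p)"
proof -
  have "fo (\<lambda>w z. gm w z g) t" if t: "pext (w, p) t" "g \<in> D (fst t)"
    and g: "\<forall>u. pext t u \<longrightarrow> N.N A v u \<longrightarrow> fo (\<lambda>w z. gm w z g) u" for t g
  proof -
    obtain w1 q where [simp]: "t = (w1, q)" by force
    note t' = pextD[OF t(1)[simplified]]
    have z1: "z \<in> D w1" by (rule D_mono[OF t'(3) z])
    have g1: "g \<in> D w1" using t(2) by simp
    have f: "fo (\<lambda>w z. gm w z g) (w', q)" if w': "w1 \<preceq> w'" "br w' q z" for w'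
    proof -
      have e1: "pext t (w', q)" using pext_world[OF pext_refl[OF t(1)[simplified]] w'(1)] by simp
      have "br w' p z" by (rule br_sub[OF sub_mono[OF w'(1) t'(5)] w'(2)])
      then have "N.N A v (w', p)" by (rule h[OF le_trans[OF t'(3) w'(1)]])
      moreover have "pext (w', p) (w', q)"
        using D_mono[OF w'(1)] t' le_trans[OF t'(6) w'(1)] le_refl sub_mono[OF w'(1)] unfolding pext_def by auto
      ultimately have "N.N A v (w', q)" using N.N_mono by blast
      then show ?thesis using g e1 by blast
    qed
    have C: "definable True w1 (\<lambda>w u. br w q z)"
      by (rule definable_br[OF t'(6) tm_const[OF t'(4)] tm_const[OF z1]])
    have P: "definable True w1 (\<lambda>w u. \<forall>w'. w \<preceq> w' \<longrightarrow> br w' q (u 0) \<longrightarrow> gm w' (u 0) g)"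
      by (intro definable_imp definable_br definable_gm t'(6) tm_const t'(4) tm_var g1)
    obtain y where y: "y \<in> D w1"
      "\<And>w'. w1 \<preceq> w' \<Longrightarrow> br w' q z \<Longrightarrow> \<forall>w''. w' \<preceq> w'' \<longrightarrow> br w'' q y \<longrightarrow> gm w'' y g"
    proof (rule implication_mono[where P = "\<lambda>w y. \<forall>w'. w \<preceq> w' \<longrightarrow> br w' q y \<longrightarrow> gm w' y g", OF P C t'(6,4)])
      fix w' y y' assume *: "w1 \<preceq> w'" "sub w' y y'" "\<forall>w''. w' \<preceq> w'' \<longrightarrow> br w'' q y \<longrightarrow> gm w'' y g"
      show "\<forall>w''. w' \<preceq> w'' \<longrightarrow> br w'' q y' \<longrightarrow> gm w'' y' g"
      proof (intro allI impI)
        fix w'' assume w: "w' \<preceq> w''" "br w'' q y'"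
        have s: "sub w'' y y'" by (rule sub_mono[OF w(1) *(2)])
        show "gm w'' y' g" using *(3) w(1) br_anti[OF s w(2)] gm_mono[OF s] by blast
      qed
    next
      fix w' assume "w1 \<preceq> w'" "br w' q z"
      then show "\<exists>y\<in>D w'. \<forall>w''. w' \<preceq> w'' \<longrightarrow> br w'' q y \<longrightarrow> gm w'' y g"
        by (rule f[THEN foE]) blast
    qed blast
    obtain a where a: "a \<in> D w1" "sub w1 z a" "sub w1 y a" by (rule join[OF t'(6) z1 y(1)])
    have "fo (\<lambda>w z. gm w z g) (w1, q)"
    proof (rule foI[OF a(1)])
      fix w' assume w': "w1 \<preceq> w'" "br w' q a"
      have s: "sub w' z a" "sub w' y a" using sub_mono[OF w'(1)] a by blast+
      have "gm w' y g"
        using y(2)[OF w'(1) br_anti[OF s(1) w'(2)]] br_anti[OF s(2) w'(2)] le_refl[OF le_trans[OF t'(6) w'(1)]] by blast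
      then show "gm w' a g" by (rule gm_mono[OF s(2)])
    qed
    then show ?thesis by simp
  qed
  then show ?thesis
    using N.N_closed[OF e(1), of v A] e(2) unfolding N.gclosed_def by simp
qed

section \<open>Verification of the axioms\<close>

lemma validI:
  assumes "\<And>w p v. r \<preceq> w \<Longrightarrow> p \<in> D w \<Longrightarrow> pext (w, p) (w, p) \<Longrightarrow> (\<And>i. v i \<in> D w) \<Longrightarrow> N.N A v (w, p)"
  shows "N.valid A"
  unfolding N.valid_def using assms pext_valid by (auto simp: split_paired_all)

lemma valid_ImpI:
  assumes "\<And>w p v. r \<preceq> w \<Longrightarrow> p \<in> D w \<Longrightarrow> pext (w, p) (w, p) \<Longrightarrow> (\<And>i. v i \<in> D w) \<Longrightarrow> N.N A v (w, p) \<Longrightarrow>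
    N.N B v (w, p)"
  shows "N.valid (Imp A B)"
proof (rule validI)
  fix w p and v :: "nat \<Rightarrow> 'd" assume *: "r \<preceq> w" "p \<in> D w" "\<And>i. v i \<in> D w"
  show "N.N (Imp A B) v (w, p)"
    unfolding N.N.simps
  proof (rule N.gimpI)
    fix t assume t: "pext (w, p) t" "N.N A v t"
    obtain w' q where [simp]: "t = (w', q)" by force
    note t' = pextD[OF t(1)[simplified]]
    have "N.N B v (w', q)"
      by (rule assms[OF t'(6,4)]) (use t pext_refl[OF t(1)] D_mono[OF t'(3) *(3)] in auto)
    then show "N.N B v t" by simp
  qed
qed

lemma N_delta0I:
  assumes "delta0 A" "pext (w, p) (w, p)" "\<And>i. v i \<in> D w" "forces w v A"
  shows "N.N A v (w, p)"
proof -
  have "fo (\<lambda>w z. rforces w z v A) (w, p)"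
    \<comment> \<open>The bound is arbitrary for a Delta_0-formula; the condition itself is an
      element at hand.\<close>
    by (rule foI[of "p"]) (use assms forces_mono pext_valid in \<open>auto simp: rforces_delta0\<close>)
  moreover have "srep (N.N A v) (\<lambda>w z. rforces w z v A) (w, p)"
    by (rule SRD[OF delta0_SR]) (use assms in auto)
  ultimately show ?thesis using srepD assms(2) by blast
qed

lemma valid_delta0: "delta0 A \<Longrightarrow> A \<in> IKPP \<Longrightarrow> N.valid A"
  by (rule validI, rule N_delta0I) (auto intro: ikpp)

lemma N_ExI: "x \<in> D w \<Longrightarrow> N.N A (x ## v) (w, p) \<Longrightarrow> N.N (Ex A) v (w, p)"
  unfolding N.N.simps by (rule N.gexI[of x]) (auto intro: N.N_mono)

lemma valid_Ex_delta0:
  assumes "delta0 A" "Ex A \<in> IKPP"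
  shows "N.valid (Ex A)"
proof (rule validI)
  fix w p and v :: "nat \<Rightarrow> 'd" assume *: "r \<preceq> w" "p \<in> D w" "pext (w, p) (w, p)" "\<And>i. v i \<in> D w"
  have "forces w v (Ex A)" by (rule ikpp[OF *(1,4) assms(2)])
  then obtain x where x: "x \<in> D w" "forces w (x ## v) A" by auto
  show "N.N (Ex A) v (w, p)"
    by (rule N_ExI[OF x(1)], rule N_delta0I[OF assms(1) *(3) _ x(2)]) (rule econs_in[OF x(1) *(4)])
qed

lemma valid_Inf: "A \<in> Inf_ax \<Longrightarrow> N.valid A"
proof (rule validI)
  fix w p and v :: "nat \<Rightarrow> 'd" assume A: "A \<in> Inf_ax" and *: "r \<preceq> w" "p \<in> D w" "pext (w, p) (w, p)" "\<And>i. v i \<in> D w"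
  let ?B = "BAll 0 (BEx 1 (Mem 1 0))"
  have A: "A = Ex (Conj (Ex (Mem 0 1)) ?B)" "A \<in> IKPP" using A by (auto simp: Inf_ax_def IKPP_def)
  have "forces w v A" by (rule ikpp[OF *(1,4) A(2)])
  then obtain z where z: "z \<in> D w" "forces w (z ## v) (Ex (Mem 0 1))" "forces w (z ## v) ?B"
    unfolding A(1) forces.simps by blast
  obtain x where x: "x \<in> D w" "forces w (x ## (z ## v)) (Mem 0 1)" using z(2) unfolding forces.simps by blast
  have "N.N ?B (z ## v) (w, p)"
    by (rule N_delta0I[OF _ *(3) _ z(3)]) (simp, rule econs_in[OF z(1) *(4)])
  moreover have "N.N (Ex (Mem 0 1)) (z ## v) (w, p)"
    by (rule N_ExI[OF x(1)], rule N_delta0I[OF _ *(3) _ x(2)]) (simp, intro econs_in x z *)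
  ultimately show "N.N A v (w, p)" unfolding A(1) by (intro N_ExI[OF z(1)]) simp
qed

lemma valid_Sep: "A \<in> Sep_ax \<Longrightarrow> N.valid A"
proof (rule validI)
  fix w p and v :: "nat \<Rightarrow> 'd" assume A: "A \<in> Sep_ax" and *: "r \<preceq> w" "p \<in> D w" "pext (w, p) (w, p)" "\<And>i. v i \<in> D w"
  obtain a B where AB: "A = Ex (All (Iff (Mem 0 1) (Conj (Mem 0 (Suc (Suc a))) (lift 1 B))))" "delta0 B" "A \<in> IKPP"
    using A by (auto simp: Sep_ax_def IKPP_def)
  let ?C = "Iff (Mem 0 1) (Conj (Mem 0 (Suc (Suc a))) (lift 1 B))"
  have "forces w v A" by (rule ikpp[OF *(1,4) AB(3)])
  then obtain y where y: "y \<in> D w" "forces w (y ## v) (All ?C)"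
    unfolding AB(1) forces.simps(7) by blast
  have d: "delta0 ?C" using AB(2) by (simp add: Iff_def lift_ren delta0_ren)
  have "N.N (All ?C) (y ## v) (w, p)"
    unfolding N.N.simps
  proof (rule N.gallI)
    fix t x assume t: "pext (w, p) t" "x \<in> D (fst t)"
    obtain w' q where [simp]: "t = (w', q)" by force
    note t' = pextD[OF t(1)[simplified]]
    have x: "x \<in> D w'" using t by simp
    have "forces w' (x ## (y ## v)) ?C" using y(2) t'(3) x unfolding forces.simps(6) by blast
    then have "N.N ?C (x ## (y ## v)) (w', q)"
      using pext_refl[OF t(1)] D_mono[OF t'(3)] x y(1) *(4) by (intro N_delta0I[OF d]) (auto split: nat.splits)
    then show "N.N ?C (x ## (y ## v)) t" by simp
  qed
  then show "N.N A v (w, p)" unfolding AB(1) by (rule N_ExI[OF y(1)])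
qed

lemma SR_Ex_delta0:
  assumes "SigmaP A" "\<forall>B\<in>sf A. cov B" "pext (w, p) (w, p)" "\<And>i. v i \<in> D w" "N.N A v (w, p)"
  shows "fo (\<lambda>w z. rforces w z v A) (w, p)"
  using SRD[OF SigmaP_PiP_rep(1)[OF assms(1,2)] assms(3), of v] assms(3-5) srepD by auto

text \<open>The bound that \<open>fo\<close> provides is itself the witness of the existential
  quantifier. Both collection and reflection get their set from here.\<close>

lemma N_Ex_delta0I:
  assumes f: "fo (\<lambda>w z. forces w (z ## v) B) (w, p)" and d: "delta0 B"
    and e: "pext (w, p) (w, p)" "\<And>i. v i \<in> D w"
  shows "N.N (Ex B) v (w, p)"
proof -
  obtain z where z: "z \<in> D w" "\<And>w'. w \<preceq> w' \<Longrightarrow> br w' p z \<Longrightarrow> forces w' (z ## v) B" by (rule foE[OF f]) blast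
  have zv: "(z ## v) i \<in> D w" for i by (rule econs_in[OF z(1) e(2)])
  have "fo (\<lambda>w z'. rforces w z' (z ## v) B) (w, p)"
    by (rule foI[OF z(1)]) (simp add: rforces_delta0[OF d] z(2))
  then have "N.N B (z ## v) (w, p)"
    using SRD[OF delta0_SR[OF d] e(1), of "z ## v"] zv srepD e(1) by auto
  then show ?thesis by (rule N_ExI[OF z(1)])
qed

text \<open>An instance of reflection: \<open>BAll a (Ex B)\<close> is a \<Sigma>-formula, and
  restricted to \<open>z\<close> it says what the conclusion of collection says of
  \<open>z\<close>.\<close>

lemma valid_Coll:
  assumes "A \<in> Coll_ax" "\<forall>B\<in>sf A. cov B"
  shows "N.valid A"
proof -
  obtain a B where A: "A = Imp (BAll a (Ex B)) (Ex (BAll (Suc a) (BEx 1 (lift 2 B))))" and B: "delta0 B"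
    using assms(1) by (auto simp: Coll_ax_def)
  have S: "SigmaP (BAll a (Ex B))" by (intro S_ball S_ex S_d0 B)
  have c: "\<forall>C\<in>sf (BAll a (Ex B)). cov C" using assms(2) unfolding A by simp
  show ?thesis
    unfolding A
  proof (rule valid_ImpI)
    fix w p and v :: "nat \<Rightarrow> 'd" assume *: "r \<preceq> w" "p \<in> D w" "pext (w, p) (w, p)" "\<And>i. v i \<in> D w" "N.N (BAll a (Ex B)) v (w, p)"
    have "fo (\<lambda>w z. rforces w z v (BAll a (Ex B))) (w, p)" by (rule SR_Ex_delta0[OF S c *(3-5)])
    then have "fo (\<lambda>w z. forces w (z ## v) (BAll (Suc a) (BEx 1 (lift 2 B)))) (w, p)"
    proof (rule fo_weaken)
      fix w' z assume h: "rforces w' z v (BAll a (Ex B))"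
      have "(y ## (x ## (z ## v))) \<circ> lv 2 = y ## (x ## v)" for x y
        by (auto simp: fun_eq_iff eval_nat_numeral lv_def split: nat.splits)
      then have "forces w' (y ## (x ## (z ## v))) (lift 2 B) \<longleftrightarrow> rforces w' z (y ## (x ## v)) B" for w' x y
        by (simp add: lift_ren forces_ren rforces_delta0[OF B])
      then show "forces w' (z ## v) (BAll (Suc a) (BEx 1 (lift 2 B)))" using h by simp
    qed
    then show "N.N (Ex (BAll (Suc a) (BEx 1 (lift 2 B)))) v (w, p)"
      by (rule N_Ex_delta0I[OF _ _ *(3,4)]) (simp add: B lift_ren delta0_ren)
  qed
qed

lemma valid_Refl:
  assumes "A \<in> SigmaRefl" "\<forall>B\<in>sf A. cov B"
  shows "N.valid A"
proof -
  obtain B where A: "A = Imp B (Ex (rel 0 (lift 0 B)))" and S: "SigmaP B"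
    using assms(1) by (auto simp: SigmaRefl_def)
  have c: "\<forall>C\<in>sf B. cov C" using assms(2) unfolding A by simp
  show ?thesis
    unfolding A
  proof (rule valid_ImpI)
    fix w p and v :: "nat \<Rightarrow> 'd" assume *: "r \<preceq> w" "p \<in> D w" "pext (w, p) (w, p)" "\<And>i. v i \<in> D w" "N.N B v (w, p)"
    have "fo (\<lambda>w z. rforces w z v B) (w, p)" by (rule SR_Ex_delta0[OF S c *(3-5)])
    then show "N.N (Ex (rel 0 (lift 0 B))) v (w, p)"
      by (intro N_Ex_delta0I *(3,4)) (simp_all add: forces_rel_lift delta0_rel)
  qed
qed

text \<open>Set induction in the model, for the predicate that the fixed condition \<open>q\<close>
  forces the formula.\<close>

lemma valid_Ind: "A \<in> Ind_ax \<Longrightarrow> N.valid A"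
proof -
  assume "A \<in> Ind_ax"
  then obtain B where A: "A = Imp (All (Imp (BAll 0 (lift 1 B)) B)) (All B)" by (auto simp: Ind_ax_def)
  show ?thesis
    unfolding A
  proof (rule valid_ImpI)
    fix w p and v :: "nat \<Rightarrow> 'd" assume *: "r \<preceq> w" "p \<in> D w" "pext (w, p) (w, p)" "\<And>i. v i \<in> D w"
      and prog: "N.N (All (Imp (BAll 0 (lift 1 B)) B)) v (w, p)"
    show "N.N (All B) v (w, p)"
      unfolding N.N.simps
    proof (rule N.gallI)
      fix t x assume t: "pext (w, p) t" "x \<in> D (fst t)"
      obtain w1 q where [simp]: "t = (w1, q)" by force
      note t' = pextD[OF t(1)[simplified]]
      have x: "x \<in> D w1" using t by simp
      have v1: "v i \<in> D w1" for i by (rule D_mono[OF t'(3) *(4)])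
      have "N.N B (x ## v) (w1, q)"
      proof (rule induction[where P = "\<lambda>w x. N.N B (x ## v) (w, q)", OF _ t'(6) _ x])
        show "definable False w1 (\<lambda>w u. N.N B (u 0 ## v) (w, q))"
          by (intro dN_use definable_N t'(6) tm_env tm_var tm_const v1 t'(4))
      next
        fix w2 y assume y: "w1 \<preceq> w2" "y \<in> D w2"
          and IH: "\<And>w3 y'. w2 \<preceq> w3 \<Longrightarrow> y' \<in> D w3 \<Longrightarrow> E w3 y' y \<Longrightarrow> N.N B (y' ## v) (w3, q)"
        have e2: "pext (w, p) (w2, q)"
          using pext_trans[OF t(1)] pext_world[OF pext_refl[OF t(1)[simplified]] y(1)] by simp
        have "N.N (BAll 0 (lift 1 B)) (y ## v) (w2, q)"
          unfolding N.N.simps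
        proof (intro N.gallI N.gimpI)
          fix t z t1 assume s: "pext (w2, q) t" "z \<in> D (fst t)" "pext t t1" "fo (\<lambda>w _. E w z ((y ## v) 0)) t1"
          obtain w3 q3 where [simp]: "t1 = (w3, q3)" by force
          have e3: "pext (w2, q) (w3, q3)" using pext_trans[OF s(1,3)] by simp
          note s' = pextD[OF e3]
          have z: "z \<in> D w3" using s(2,3) D_mono unfolding pext_def by auto
          have v3: "(z ## v) i \<in> D w3" for i
            using z D_mono[OF s'(3)] D_mono[OF y(1)] v1 by (auto split: nat.splits)
          obtain a where a: "a \<in> D w3" "\<And>w'. w3 \<preceq> w' \<Longrightarrow> br w' q3 a \<Longrightarrow> E w' z y"
            using s(4) by (auto elim: foE)
          \<comment> \<open>The induction hypothesis needs true membership in \<open>y\<close>,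
            whereas \<open>q3\<close> only forces it. Locality, \<open>N_fo_closed\<close>, allows
            passing to worlds where \<open>q3\<close> restricted to \<open>a\<close> holds and
            membership is true.\<close>
          have "N.N B (z ## v) (w3, q3)"
          proof (rule N_fo_closed[OF pext_refl[OF e3] v3 a(1)])
            fix w' assume w': "w3 \<preceq> w'" "br w' q3 a"
            have "N.N B (z ## v) (w', q)"
              by (rule IH[OF le_trans[OF s'(3) w'(1)] D_mono[OF w'(1) z] a(2)[OF w']])
            moreover have "pext (w', q) (w', q3)"
              using D_mono[OF w'(1)] s' le_trans[OF s'(6) w'(1)] le_refl sub_mono[OF w'(1)] unfolding pext_def by auto
            ultimately show "N.N B (z ## v) (w', q3)" using N.N_mono by blast
          qed
          moreover have "(z ## (y ## v)) \<circ> lv 1 = z ## v"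
            by (auto simp: fun_eq_iff lv_def split: nat.splits)
          ultimately show "N.N (lift 1 B) (z ## (y ## v)) t1" by (simp add: lift_ren N.N_ren)
        qed
        moreover have "N.N (Imp (BAll 0 (lift 1 B)) B) (y ## v) (w2, q)"
          using prog e2 y(2) unfolding N.N.simps(6) N.gall_def by force
        ultimately show "N.N B (y ## v) (w2, q)"
          using pext_refl[OF e2] unfolding N.N.simps(5) by (blast intro: N.gimpD)
      qed
      then show "N.N B (x ## v) t" by simp
    qed
  qed
qed

lemma valid_axiom:
  assumes "A \<in> IKPP \<union> SigmaRefl" "\<forall>B\<in>sf A. cov B"
  shows "N.valid A"
proof -
  consider "A \<in> Ext_ax" | "A \<in> Pair_ax \<union> Union_ax \<union> Pow_ax" | "A \<in> Inf_ax" | "A \<in> Sep_ax"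
    | "A \<in> Coll_ax" | "A \<in> Ind_ax" | "A \<in> SigmaRefl"
    using assms(1) unfolding IKPP_def by blast
  then show ?thesis
  proof cases
    case 1
    then have "delta0 A" by (auto simp: Ext_ax_def subst_ren delta0_ren Eqd_def)
    then show ?thesis by (rule valid_delta0) (use 1 in \<open>simp add: IKPP_def\<close>)
  next
    case 2
    then obtain B where "A = Ex B" "delta0 B" by (auto simp: Pair_ax_def Union_ax_def Pow_ax_def)
    then show ?thesis using valid_Ex_delta0[of B] 2 by (auto simp: IKPP_def)
  qed (use assms(2) valid_Inf valid_Sep valid_Coll valid_Ind valid_Refl in auto)
qed

text \<open>Dropping the restriction enlarges only the range of positive existential quantifiers and
  of negative universal ones.\<close>

lemma SigmaP_PiP_rforces:
  shows "SigmaP A \<Longrightarrow> rforces w z v A \<Longrightarrow> forces w v A" and "PiP B \<Longrightarrow> forces w v B \<Longrightarrow> rforces w z v B"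
  by (induction arbitrary: w v and w v rule: SigmaP_PiP.inducts)
    (auto simp: rforces_delta0 Neg_def)

theorem SigmaP_conservation:
  assumes "prov T A" "T \<subseteq> IKPP \<union> SigmaRefl" "\<And>B C. B \<in> T \<Longrightarrow> C \<in> sf B \<Longrightarrow> cov C"
    and "SigmaP A" "\<forall>C\<in>sf A. cov C" "\<And>i. v i \<in> D r"
  shows "forces r v A"
proof -
  have "N.valid A" using N.soundness[OF assms(1)] valid_axiom assms(2,3) by blast
  obtain e where e: "e \<in> D r" "\<And>w x. r \<preceq> w \<Longrightarrow> x \<in> D w \<Longrightarrow> \<not> E w x e"
    by (rule empty[OF le_root assms(6)[of 0]]) blast
  have pe: "pext (r, e) (r, e)" using e(1) le_root pext_valid by blast
  then have "N.N A v (r, e)" using \<open>N.valid A\<close> assms(6) unfolding N.valid_def by auto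
  then have "fo (\<lambda>w z. rforces w z v A) (r, e)" by (rule SR_Ex_delta0[OF assms(4,5) pe assms(6)])
  then obtain z where z: "z \<in> D r" "\<And>w. r \<preceq> w \<Longrightarrow> br w e z \<Longrightarrow> rforces w z v A" by (rule foE) blast
  have "br r e z" unfolding br_def using e(2) by blast
  then have "rforces r z v A" using z(2) le_root by blast
  then show ?thesis by (rule SigmaP_PiP_rforces(1)[OF assms(4)])
qed

end

section \<open>A universal family\<close>

context ikpp_model
begin

definition sing :: "'w \<Rightarrow> 'd \<Rightarrow> 'd \<Rightarrow> bool" where
  "sing w u x \<longleftrightarrow> E w x u \<and> (\<forall>w'. w \<preceq> w' \<longrightarrow> (\<forall>t\<in>D w'. E w' t u \<longrightarrow> eq w' t x))"

definition doub :: "'w \<Rightarrow> 'd \<Rightarrow> 'd \<Rightarrow> 'd \<Rightarrow> bool" where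
  "doub w u x y \<longleftrightarrow> E w x u \<and> E w y u \<and> (\<forall>w'. w \<preceq> w' \<longrightarrow> (\<forall>t\<in>D w'. E w' t u \<longrightarrow> eq w' t x \<or> eq w' t y))"

text \<open>Kuratowski pairs, up to extensional equality. A relation is used since the language has
  no terms for sets.\<close>

definition opair :: "'w \<Rightarrow> 'd \<Rightarrow> 'd \<Rightarrow> 'd \<Rightarrow> bool" where
  "opair w s x y \<longleftrightarrow> (\<exists>u\<in>D w. E w u s \<and> sing w u x) \<and> (\<exists>u\<in>D w. E w u s \<and> doub w u x y) \<and>
    (\<forall>w'. w \<preceq> w' \<longrightarrow> (\<forall>u\<in>D w'. E w' u s \<longrightarrow> sing w' u x \<or> doub w' u x y))"

lemma definable_sing: "tm w0 s \<Longrightarrow> tm w0 t \<Longrightarrow> definable True w0 (\<lambda>w u. sing w (s u) (t u))"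
  unfolding sing_def
  by (intro definable_conj definable_mem definable_ball[where Q = "\<lambda>w x u. eq w x (t u)"] definable_eq tm_var)
    (auto intro: tm_shift)

lemma definable_doub: "tm w0 s \<Longrightarrow> tm w0 t \<Longrightarrow> tm w0 t' \<Longrightarrow> definable True w0 (\<lambda>w u. doub w (s u) (t u) (t' u))"
  unfolding doub_def
  by (intro definable_conj definable_mem definable_ball[where Q = "\<lambda>w x u. eq w x (t u) \<or> eq w x (t' u)"]
      definable_disj definable_eq tm_var)
    (auto intro: tm_shift)

lemma definable_opair: "tm w0 s \<Longrightarrow> tm w0 t \<Longrightarrow> tm w0 t' \<Longrightarrow> definable True w0 (\<lambda>w u. opair w (s u) (t u) (t' u))"
  unfolding opair_def
  by (intro definable_conj definable_bex[where Q = "\<lambda>w x u. sing w x (t u)"]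
      definable_bex[where Q = "\<lambda>w x u. doub w x (t u) (t' u)"]
      definable_ball[where Q = "\<lambda>w x u. sing w x (t u) \<or> doub w x (t u) (t' u)"]
      definable_disj definable_sing definable_doub tm_var)
    (auto intro: tm_shift)

lemma opair_mono:
  assumes "r \<preceq> w" "w \<preceq> w'" "s \<in> D w" "x \<in> D w" "y \<in> D w" "opair w s x y"
  shows "opair w' s x y"
proof -
  have "definable True w (\<lambda>w u. opair w s x y)" by (intro definable_opair tm_const assms)
  from definable_mono[OF this le_refl[OF assms(1)] assms(2), of "\<lambda>_. x"] assms show ?thesis by blast
qed

lemma opair_inj:
  assumes w: "r \<preceq> w" and d: "a \<in> D w" "b \<in> D w" "x \<in> D w" "y \<in> D w"
    and p: "opair w s a b" "opair w s x y"
  shows "eq w x a" "eq w y b"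
proof -
  have ww: "w \<preceq> w" by (rule le_refl[OF w])
  obtain u where u: "u \<in> D w" "E w u s" "sing w u a" using p(1) unfolding opair_def by blast
  have "E w x u" using p(2) u ww unfolding opair_def sing_def doub_def by blast
  then show xa: "eq w x a" using u(3) d ww unfolding sing_def by blast
  obtain u where u: "u \<in> D w" "E w u s" "doub w u x y" using p(2) unfolding opair_def by blast
  have "E w y u" using u(3) unfolding doub_def by blast
  then have 1: "eq w y a \<or> eq w y b" using p(1) u ww d unfolding opair_def sing_def doub_def by blast
  obtain u where u: "u \<in> D w" "E w u s" "doub w u a b" using p(1) unfolding opair_def by blast
  have "E w b u" using u(3) unfolding doub_def by blast
  then have 2: "eq w b x \<or> eq w b y" using p(2) u ww d unfolding opair_def sing_def doub_def by blast
  \<comment> \<open>No distinction by \<open>a = b\<close> is made. The only combination left to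
    check is \<open>y = a\<close> with \<open>b = x\<close>, where
    \<open>y = a = x = b\<close>.\<close>
  show "eq w y b" using 1 2 xa eq_trans eq_sym by blast
qed

lemma opair_ex:
  assumes w: "r \<preceq> w" and d: "a \<in> D w" "b \<in> D w"
  obtains s where "s \<in> D w" "opair w s a b"
proof -
  have ww: "w \<preceq> w" by (rule le_refl[OF w])
  obtain e where e: "e \<in> D w" "\<And>w' x. w \<preceq> w' \<Longrightarrow> x \<in> D w' \<Longrightarrow> \<not> E w' x e"
    by (rule empty[OF w d(1)]) blast
  obtain u1 where u1: "u1 \<in> D w" "\<And>w' x. w \<preceq> w' \<Longrightarrow> x \<in> D w' \<Longrightarrow> E w' x u1 \<longleftrightarrow> E w' x e \<or> eq w' x a"
    by (rule insertion[OF w e(1) d(1)]) blast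
  obtain u2 where u2: "u2 \<in> D w" "\<And>w' x. w \<preceq> w' \<Longrightarrow> x \<in> D w' \<Longrightarrow> E w' x u2 \<longleftrightarrow> E w' x u1 \<or> eq w' x b"
    by (rule insertion[OF w u1(1) d(2)]) blast
  obtain s1 where s1: "s1 \<in> D w" "\<And>w' x. w \<preceq> w' \<Longrightarrow> x \<in> D w' \<Longrightarrow> E w' x s1 \<longleftrightarrow> E w' x e \<or> eq w' x u1"
    by (rule insertion[OF w e(1) u1(1)]) blast
  obtain s where s: "s \<in> D w" "\<And>w' x. w \<preceq> w' \<Longrightarrow> x \<in> D w' \<Longrightarrow> E w' x s \<longleftrightarrow> E w' x s1 \<or> eq w' x u2"
    by (rule insertion[OF w s1(1) u2(1)]) blast
  have "sing w' u a \<or> doub w' u a b" if *: "w \<preceq> w'" "u \<in> D w'" "E w' u s" for w' u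
  proof -
    have d': "a \<in> D w'" "b \<in> D w'" "r \<preceq> w'" using d D_mono[OF *(1)] le_trans[OF w *(1)] by blast+
    have "eq w' u u1 \<or> eq w' u u2" using * s s1 e by blast
    then show ?thesis
    proof
      assume q: "eq w' u u1"
      have "E w' a u" using u1(2)[OF *(1) d'(1)] eq_refl subD[OF d'(3) _ d'(1)] q unfolding eq_def by blast
      moreover have "eq w'' t a" if t: "w' \<preceq> w''" "t \<in> D w''" "E w'' t u" for w'' t
      proof -
        have l: "w \<preceq> w''" by (rule le_trans[OF *(1) t(1)])
        have "E w'' t u1" using q t unfolding eq_def sub_def by blast
        then show ?thesis using u1(2)[OF l t(2)] e(2)[OF l t(2)] by blast
      qed
      ultimately show ?thesis unfolding sing_def by blast
    next
      assume q: "eq w' u u2"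
      have "E w' a u2" "E w' b u2" using u2(2)[OF *(1)] u1(2)[OF *(1)] d' eq_refl by blast+
      then have "E w' a u" "E w' b u" using subD[OF d'(3)] d' q unfolding eq_def by blast+
      moreover have "eq w'' t a \<or> eq w'' t b" if t: "w' \<preceq> w''" "t \<in> D w''" "E w'' t u" for w'' t
      proof -
        have l: "w \<preceq> w''" by (rule le_trans[OF *(1) t(1)])
        have "E w'' t u2" using q t unfolding eq_def sub_def by blast
        then show ?thesis using u2(2)[OF l t(2)] u1(2)[OF l t(2)] e(2)[OF l t(2)] by blast
      qed
      ultimately show ?thesis unfolding doub_def by blast
    qed
  qed
  moreover have "sing w u1 a"
    using u1(2) e(2) d ww eq_refl unfolding sing_def by blast
  moreover have "doub w u2 a b"
    using u2(2) u1(2) e(2) d ww eq_refl unfolding doub_def by blast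
  moreover have "E w u1 s" "E w u2 s" using s(2) s1(2) u1(1) u2(1) ww eq_refl by blast+
  ultimately have "opair w s a b" unfolding opair_def using u1(1) u2(1) by blast
  then show ?thesis using that s(1) by blast
qed

text \<open>The components of an ordered pair lie in its members' union, so this quantifier over
  components is \<open>\<Delta>\<^sub>0\<close>.\<close>

definition expair :: "'w \<Rightarrow> 'd \<Rightarrow> ('d \<Rightarrow> 'd \<Rightarrow> bool) \<Rightarrow> bool" where
  "expair w s R \<longleftrightarrow> (\<exists>u\<in>D w. E w u s \<and> (\<exists>x\<in>D w. E w x u \<and> (\<exists>u'\<in>D w. E w u' s \<and>
     (\<exists>y\<in>D w. E w y u' \<and> (opair w s x y \<and> R x y)))))"

lemma definable_expair:
  assumes "definable True w0 (\<lambda>w v. R w (v 0) (v 1) (\<lambda>i. v (Suc (Suc i))))" and t: "tm w0 t"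
  shows "definable True w0 (\<lambda>w u. expair w (t u) (\<lambda>x y. R w x y u))"
proof -
  have R: "definable True w0 (\<lambda>w v. R w (v 2) (v 0) (\<lambda>i. v (Suc (Suc (Suc (Suc i))))))"
    using definable_subst[OF assms(1), of "(\<lambda>v. v 2) ## ((\<lambda>v. v 0) ## (\<lambda>i v. v (Suc (Suc (Suc (Suc i))))))"]
    by (simp add: tm_econs tm_var)
  show ?thesis
    unfolding expair_def
    by (rule definable_bex[OF _ t, where Q = "\<lambda>w u1 u. \<exists>x\<in>D w. E w x u1 \<and> (\<exists>u'\<in>D w. E w u' (t u) \<and>
           (\<exists>y\<in>D w. E w y u' \<and> (opair w (t u) x y \<and> R w x y u)))"], rule definable_bex[where t = "\<lambda>v. v 0" and
          Q = "\<lambda>w x v. \<exists>u'\<in>D w. E w u' (t (\<lambda>i. v (Suc i))) \<and>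
           (\<exists>y\<in>D w. E w y u' \<and> (opair w (t (\<lambda>i. v (Suc i))) x y \<and> R w x y (\<lambda>i. v (Suc i))))"],
        rule definable_bex[where t = "\<lambda>v. t (\<lambda>i. v (Suc (Suc i)))" and
          Q = "\<lambda>w u' v. (\<exists>y\<in>D w. E w y u' \<and> (opair w (t (\<lambda>i. v (Suc (Suc i)))) (v 0) y \<and> R w (v 0) y (\<lambda>i. v (Suc (Suc i)))))"],
        rule definable_bex[where t = "\<lambda>v. v 0" and
          Q = "\<lambda>w y v. opair w (t (\<lambda>i. v (Suc (Suc (Suc i))))) (v (Suc 0)) y \<and> R w (v (Suc 0)) y (\<lambda>i. v (Suc (Suc (Suc i))))"])
      (use R in \<open>simp_all add: definable_conj definable_opair tm_var tm_shift[OF t] numeral_2_eq_2\<close>)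
qed

lemma expair_iff:
  assumes w: "r \<preceq> w" "s \<in> D w" "a \<in> D w" "b \<in> D w" and p: "opair w s a b" and w': "w \<preceq> w'"
    and R: "\<And>x y. x \<in> D w' \<Longrightarrow> y \<in> D w' \<Longrightarrow> eq w' x a \<Longrightarrow> eq w' y b \<Longrightarrow> R x y \<Longrightarrow> R a b"
  shows "expair w' s R \<longleftrightarrow> R a b"
proof
  have d: "r \<preceq> w'" "a \<in> D w'" "b \<in> D w'" "opair w' s a b"
    using le_trans[OF w(1) w'] D_mono[OF w'] w opair_mono[OF w(1) w' w(2-4) p] by blast+
  show "R a b" if ex: "expair w' s R"
  proof -
    obtain x y where "x \<in> D w'" "y \<in> D w'" "opair w' s x y" "R x y"
      using ex unfolding expair_def by blast
    then show ?thesis using R opair_inj[OF d(1-3) _ _ d(4)] by blast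
  qed
  show "expair w' s R" if "R a b"
  proof -
    obtain u where u: "u \<in> D w'" "E w' u s" "E w' a u" using d(4) unfolding opair_def sing_def by blast
    obtain u' where u': "u' \<in> D w'" "E w' u' s" "E w' b u'" using d(4) unfolding opair_def doub_def by blast
    show ?thesis unfolding expair_def using u u' d that by blast
  qed
qed

text \<open>All parameters of \<open>K\<close> can be packed into a single code, at every world,
  while the bound \<open>z\<close> remains an argument.\<close>

definition covers :: "('w \<Rightarrow> 'd \<Rightarrow> 'd \<Rightarrow> bool) \<Rightarrow> ('w \<Rightarrow> 'd \<Rightarrow> (nat \<Rightarrow> 'd) \<Rightarrow> bool) \<Rightarrow> bool" where
  "covers U K \<longleftrightarrow> (\<forall>w v. r \<preceq> w \<longrightarrow> (\<forall>i. v i \<in> D w) \<longrightarrow>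
    (\<exists>s\<in>D w. \<forall>w'. w \<preceq> w' \<longrightarrow> (\<forall>z\<in>D w'. U w' z s \<longleftrightarrow> K w' z v)))"

lemma coversE:
  assumes "covers U K" "r \<preceq> w" "\<forall>i. v i \<in> D w"
  obtains s where "s \<in> D w" "\<And>w' z. w \<preceq> w' \<Longrightarrow> z \<in> D w' \<Longrightarrow> U w' z s \<longleftrightarrow> K w' z v"
  using assms(1)[unfolded covers_def, THEN spec, THEN spec, THEN mp, THEN mp, OF assms(2,3)] by blast

lemma ext_const:
  assumes "definable True r (\<lambda>w u. P w (u 0) (\<lambda>i. u (Suc i)))" "r \<preceq> w" "x \<in> D w" "y \<in> D w"
    "\<And>i. v i \<in> D w" "eq w x y" "P w x v"
  shows "P w y v"
proof (rule ext[where P = "\<lambda>w x. P w x v", OF _ assms(2) le_refl[OF assms(2)] assms(3,4,6,7)])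
  have "tm w (((\<lambda>u. u 0) ## (\<lambda>i _. v i)) i)" for i by (intro tm_econs tm_var tm_const assms)
  from definable_subst[OF definable_base[OF assms(1,2)], where \<sigma> = "(\<lambda>u. u 0) ## (\<lambda>i _. v i)", OF this]
  show "definable True w (\<lambda>w u. P w (u 0) v)" by simp
qed

text \<open>Induction on the number of parameters: a pair replaces the first two of them, and the
  Delta_0 unpairing \<open>expair\<close> keeps the predicate Delta_0.\<close>

lemma covers_finite:
  assumes "definable True r (\<lambda>w u. K w (u 0) (\<lambda>i. u (Suc i)))"
    and "\<And>w z v v'. (\<And>i. i \<le> n \<Longrightarrow> v i = v' i) \<Longrightarrow> K w z v = K w z v'"
  shows "\<exists>U. definable True r (\<lambda>w u. U w (u 0) (u 1)) \<and> covers U K"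
  using assms
proof (induction n arbitrary: K)
  case 0
  have "definable True r (\<lambda>w u. K w (u 0) (\<lambda>_. u 1))"
    using definable_subst[OF 0(1), of "(\<lambda>u. u 0) ## (\<lambda>_ u. u 1)"] by (simp add: tm_econs tm_var)
  moreover have "covers (\<lambda>w z s. K w z (\<lambda>_. s)) K"
    unfolding covers_def
  proof (intro allI impI)
    fix w and v :: "nat \<Rightarrow> 'd" assume "r \<preceq> w" "\<forall>i. v i \<in> D w"
    moreover have "K w' z (\<lambda>_. v 0) = K w' z v" for w' z by (rule 0(2)) simp
    ultimately show "\<exists>s\<in>D w. \<forall>w'. w \<preceq> w' \<longrightarrow> (\<forall>z\<in>D w'. K w' z (\<lambda>_. s) \<longleftrightarrow> K w' z v)" by blast
  qed
  ultimately show ?case by (intro exI[of _ "\<lambda>w z s. K w z (\<lambda>_. s)"]) simp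
next
  case (Suc n)
  define K' where "K' w z v = expair w (v 0) (\<lambda>x y. K w z (x ## (y ## (\<lambda>i. v (Suc i)))))" for w z v
  have dK: "definable True r (\<lambda>w v. K w (v 2) (v 0 ## (v 1 ## (\<lambda>i. v (i + 4)))))"
  proof -
    have "tm r (((\<lambda>v. v 2) ## ((\<lambda>v. v 0) ## ((\<lambda>v. v 1) ## (\<lambda>i v. v (i + 4))))) i)" for i
      by (intro tm_econs tm_var)
    from definable_subst[OF Suc.prems(1), where \<sigma> = "(\<lambda>v. v 2) ## ((\<lambda>v. v 0) ## ((\<lambda>v. v 1) ## (\<lambda>i v. v (i + 4))))", OF this]
    show ?thesis by (simp add: econs_app)
  qed
  have "definable True r (\<lambda>w u. expair w (u 1) (\<lambda>x y. K w (u 0) (x ## (y ## (\<lambda>i. u (i + 2))))))"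
    by (rule definable_expair[where R = "\<lambda>w x y u. K w (u 0) (x ## (y ## (\<lambda>i. u (i + 2))))"])
      (use dK in \<open>simp_all add: tm_var eval_nat_numeral\<close>)
  then have 1: "definable True r (\<lambda>w u. K' w (u 0) (\<lambda>i. u (Suc i)))" by (simp add: K'_def)
  have 2: "K' w z v = K' w z v'" if "\<And>i. i \<le> n \<Longrightarrow> v i = v' i" for w z v v'
  proof -
    have "K w z (x ## (y ## (\<lambda>i. v (Suc i)))) = K w z (x ## (y ## (\<lambda>i. v' (Suc i))))" for x y
      by (rule Suc.prems(2)) (use that in \<open>auto split: nat.splits\<close>)
    then show ?thesis unfolding K'_def using that[of 0] by simp
  qed
  obtain U where U: "definable True r (\<lambda>w u. U w (u 0) (u 1))" "covers U K'"
    using Suc.IH[of K', OF 1 2] by blast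
  have "covers U K"
    unfolding covers_def
  proof (intro allI impI)
    fix w and v :: "nat \<Rightarrow> 'd" assume w: "r \<preceq> w" "\<forall>i. v i \<in> D w"
    obtain c where c: "c \<in> D w" "opair w c (v 0) (v 1)"
      by (rule opair_ex[OF w(1) w(2)[rule_format] w(2)[rule_format]])
    define v' where "v' = c ## (\<lambda>i. v (Suc (Suc i)))"
    have "\<forall>i. v' i \<in> D w" unfolding v'_def using w c by (auto split: nat.splits)
    then obtain s where s: "s \<in> D w" "\<And>w' z. w \<preceq> w' \<Longrightarrow> z \<in> D w' \<Longrightarrow> U w' z s \<longleftrightarrow> K' w' z v'"
      by (rule coversE[OF U(2) w(1)]) blast
    have "K' w' z v' \<longleftrightarrow> K w' z v" if z: "w \<preceq> w'" "z \<in> D w'" for w' z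
    proof -
      have rw: "r \<preceq> w'" and vD: "\<And>i. v i \<in> D w'" using le_trans[OF w(1) z(1)] D_mono[OF z(1)] w(2) by blast+
      let ?f = "\<lambda>i. v (Suc (Suc i))"
      have "expair w' c (\<lambda>x y. K w' z (x ## (y ## ?f))) \<longleftrightarrow> K w' z (v 0 ## (v 1 ## ?f))"
      proof (rule expair_iff[OF w(1) c(1) w(2)[rule_format] w(2)[rule_format] c(2) z(1)])
        fix x y assume *: "x \<in> D w'" "y \<in> D w'" "eq w' x (v 0)" "eq w' y (v 1)" "K w' z (x ## (y ## ?f))"
        \<comment> \<open>Unpairing determines the components only up to extensional equality. They
          are therefore replaced one after the other, by extensionality for \<open>K\<close> in each
          of its two first parameters.\<close>
        have "definable True r (\<lambda>w u. K w (u 1) (u 0 ## (u 2 ## (\<lambda>i. u (i + 3)))))"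
        proof -
          have "tm r (((\<lambda>v. v 1) ## ((\<lambda>v. v 0) ## ((\<lambda>v. v 2) ## (\<lambda>i v. v (i + 3))))) i)" for i
            by (intro tm_econs tm_var)
          from definable_subst[OF Suc.prems(1), where \<sigma> = "(\<lambda>v. v 1) ## ((\<lambda>v. v 0) ## ((\<lambda>v. v 2) ## (\<lambda>i v. v (i + 3))))", OF this]
          show ?thesis by (simp add: econs_app)
        qed
        then have d1: "definable True r (\<lambda>w u. (\<lambda>w x g. K w (g 0) (x ## (g 1 ## (\<lambda>i. g (i + 2))))) w (u 0) (\<lambda>i. u (Suc i)))"
          by (simp add: eval_nat_numeral)
        have "tm r (((\<lambda>v. v 1) ## ((\<lambda>v. v 2) ## ((\<lambda>v. v 0) ## (\<lambda>i v. v (i + 3))))) i)" for i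
          by (intro tm_econs tm_var)
        from definable_subst[OF Suc.prems(1), where \<sigma> = "(\<lambda>v. v 1) ## ((\<lambda>v. v 2) ## ((\<lambda>v. v 0) ## (\<lambda>i v. v (i + 3))))", OF this]
        have d2: "definable True r (\<lambda>w u. (\<lambda>w x g. K w (g 0) (g 1 ## (x ## (\<lambda>i. g (i + 2))))) w (u 0) (\<lambda>i. u (Suc i)))"
          by (simp add: econs_app eval_nat_numeral)
        have "K w' z (v 0 ## (y ## ?f))"
          using ext_const[OF d1 rw *(1) vD[of 0] _ *(3), of "z ## (y ## ?f)"] *(2,5) z(2) vD
          by (auto split: nat.splits simp: econs_in)
        then show "K w' z (v 0 ## (v 1 ## ?f))"
          using ext_const[OF d2 rw *(2) vD[of 1] _ *(4), of "z ## (v 0 ## ?f)"] z(2) vD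
          by (auto split: nat.splits simp: econs_in)
      qed
      moreover have "v 0 ## (v 1 ## ?f) = v" by (auto simp: fun_eq_iff split: nat.splits)
      ultimately show ?thesis by (simp add: K'_def v'_def)
    qed
    then show "\<exists>s\<in>D w. \<forall>w'. w \<preceq> w' \<longrightarrow> (\<forall>z\<in>D w'. U w' z s \<longleftrightarrow> K w' z v)" using s by blast
  qed
  then show ?case using U(1) by blast
qed

lemma covers_rforces: "\<exists>U. definable True r (\<lambda>w u. U w (u 0) (u 1)) \<and> covers U (\<lambda>w z v. rforces w z v A)"
proof -
  obtain n where n: "\<And>i. i \<in> fv A \<Longrightarrow> i \<le> n"
    using finite_nat_set_iff_bounded_le[of "fv A"] by auto
  \<comment> \<open>Indices above \<open>n\<close> do not occur in \<open>A\<close>; sending them to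
    0 makes the value depend on \<open>v 0\<close> up to \<open>v n\<close> alone.\<close>
  define \<rho> where "\<rho> i = (if i \<le> n then i else 0)" for i
  have "ren \<rho> A = A" using ren_cong[of A \<rho> id] n by (simp add: \<rho>_def ren_id)
  then have c: "rforces w z v A = rforces w z (v \<circ> \<rho>) A" for w z v by (metis rforces_ren)
  show ?thesis
  proof (rule covers_finite[of _ n])
    show "definable True r (\<lambda>w u. rforces w (u 0) (\<lambda>i. u (Suc i)) A)"
      by (rule definable_rforces) (rule tm_var)+
    fix w z and v v' :: "nat \<Rightarrow> 'd" assume "\<And>i. i \<le> n \<Longrightarrow> v i = v' i"
    then have "v \<circ> \<rho> = v' \<circ> \<rho>" by (auto simp: \<rho>_def)
    then show "rforces w z v A = rforces w z v' A" using c[of w z v] c[of w z v'] by simp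
  qed
qed

text \<open>\<open>sub w t t\<close> is the Delta_0-formula for truth in the body of the bounded
  quantifier, just as \<open>False\<close> is the body in \<open>emp\<close>.\<close>

definition inh :: "'w \<Rightarrow> 'd \<Rightarrow> bool" where "inh w x \<longleftrightarrow> (\<exists>t\<in>D w. E w t x \<and> sub w t t)"
definition emp :: "'w \<Rightarrow> 'd \<Rightarrow> bool" where "emp w x \<longleftrightarrow> (\<forall>w'. w \<preceq> w' \<longrightarrow> (\<forall>t\<in>D w'. E w' t x \<longrightarrow> False))"

lemma definable_inh: "tm w0 t \<Longrightarrow> definable True w0 (\<lambda>w u. inh w (t u))"
  unfolding inh_def by (rule definable_bex) (intro definable_sub tm_var)

lemma definable_emp: "tm w0 t \<Longrightarrow> definable True w0 (\<lambda>w u. emp w (t u))"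
  unfolding emp_def by (rule definable_ball[where Q = "\<lambda>_ _ _. False"]) (rule definable_bot)

text \<open>Codes for the two families are tagged by an inhabited and by the empty set.\<close>

lemma covers_merge:
  assumes U: "definable True r (\<lambda>w u. U w (u 0) (u 1))" and V: "definable True r (\<lambda>w u. V w (u 0) (u 1))"
  shows "\<exists>W. definable True r (\<lambda>w u. W w (u 0) (u 1)) \<and> (\<forall>K. covers U K \<or> covers V K \<longrightarrow> covers W K)"
proof -
  define R where "R w z x y \<longleftrightarrow> (inh w x \<and> U w z y) \<or> (emp w x \<and> V w z y)" for w z x y
  define W where "W w z s = expair w s (\<lambda>x y. R w z x y)" for w z s
  have dR: "definable True w0 (\<lambda>w u. R w (c u) (a u) (b u))"
    if "r \<preceq> w0" "tm w0 a" "tm w0 b" "tm w0 c" for w0 a b c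
    unfolding R_def
    by (intro definable_disj definable_conj definable_inh definable_emp
        definable_app2[OF definable_base[OF U]] definable_app2[OF definable_base[OF V]] that)
  have "definable True r (\<lambda>w u. W w (u 0) (u 1))"
    unfolding W_def
    by (rule definable_expair[where R = "\<lambda>w x y u. R w (u 0) x y"]) (intro dR le_root tm_var)+
  moreover have W: "W w' z s \<longleftrightarrow> R w' z a b"
    if *: "r \<preceq> w" "s \<in> D w" "a \<in> D w" "b \<in> D w" "opair w s a b" "w \<preceq> w'" "z \<in> D w'" for w w' z s a b
    unfolding W_def
  proof (rule expair_iff[OF *(1-6)])
    fix x y assume x: "x \<in> D w'" "y \<in> D w'" "eq w' x a" "eq w' y b" "R w' z x y"
    have rw: "r \<preceq> w'" "a \<in> D w'" "b \<in> D w'" "w' \<preceq> w'"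
      using le_trans[OF *(1,6)] D_mono[OF *(6)] *(3,4) le_refl by blast+
    have "R w' z a y"
      by (rule ext[where P = "\<lambda>w x. R w z x y", OF _ rw(1,4) x(1) rw(2) x(3,5)])
        (intro dR rw tm_var tm_const x *)
    then show "R w' z a b"
      by (rule ext[where P = "\<lambda>w y. R w z a y", OF _ rw(1,4) x(2) rw(3) x(4), rotated])
        (intro dR rw tm_var tm_const x *)
  qed
  have "covers W K" if K: "covers U K \<or> covers V K" for K
    unfolding covers_def
  proof (intro allI impI)
    fix w and v :: "nat \<Rightarrow> 'd" assume w: "r \<preceq> w" "\<forall>i. v i \<in> D w"
    have code: "\<exists>s\<in>D w. \<forall>w'. w \<preceq> w' \<longrightarrow> (\<forall>z\<in>D w'. W w' z s \<longleftrightarrow> R w' z a b)"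
      if ab: "a \<in> D w" "b \<in> D w" for a b
      using opair_ex[OF w(1) ab] W[OF w(1) _ ab] by metis
    show "\<exists>s\<in>D w. \<forall>w'. w \<preceq> w' \<longrightarrow> (\<forall>z\<in>D w'. W w' z s \<longleftrightarrow> K w' z v)"
      using K
    proof
      assume c: "covers U K"
      obtain b where b: "b \<in> D w" "\<And>w' z. w \<preceq> w' \<Longrightarrow> z \<in> D w' \<Longrightarrow> U w' z b \<longleftrightarrow> K w' z v"
        by (rule coversE[OF c w]) blast
      obtain a x where a: "a \<in> D w" "x \<in> D w" "E w x a" by (rule infinity[OF w(1) b(1)])
      have "inh w' a" "\<not> emp w' a" if "w \<preceq> w'" for w'
      proof -
        have "x \<in> D w'" "E w' x a" "w' \<preceq> w'"
          using D_mono[OF that a(2)] E_mono[OF that a(3)] le_refl[OF le_trans[OF w(1) that]] .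
        then show "inh w' a" "\<not> emp w' a" unfolding inh_def emp_def using sub_refl by blast+
      qed
      then show ?thesis using code[OF a(1) b(1)] b(2) unfolding R_def by blast
    next
      assume c: "covers V K"
      obtain b where b: "b \<in> D w" "\<And>w' z. w \<preceq> w' \<Longrightarrow> z \<in> D w' \<Longrightarrow> V w' z b \<longleftrightarrow> K w' z v"
        by (rule coversE[OF c w]) blast
      obtain a where a: "a \<in> D w" "\<And>w' x. w \<preceq> w' \<Longrightarrow> x \<in> D w' \<Longrightarrow> \<not> E w' x a"
        by (rule empty[OF w(1) b(1)]) blast
      have "\<not> inh w' a" "emp w' a" if "w \<preceq> w'" for w'
        using a(2) that le_trans[OF that] unfolding inh_def emp_def by blast+
      then show ?thesis using code[OF a(1) b(1)] b(2) unfolding R_def by blast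
    qed
  qed
  ultimately show ?thesis by blast
qed

text \<open>The family starts from inhabitedness of the code, which supplies the truth values for
  \<open>U_truth\<close>; the formulas of \<open>L\<close> are then merged in one by one.\<close>

lemma universal_family:
  assumes "finite L"
  obtains U where "definable True r (\<lambda>w u. U w (u 0) (u 1))" "covers U (\<lambda>w z v. inh w (v 0))"
    "\<And>A. A \<in> L \<Longrightarrow> covers U (\<lambda>w z v. rforces w z v A)"
proof -
  have "\<exists>U. definable True r (\<lambda>w u. U w (u 0) (u 1)) \<and> covers U (\<lambda>w z v. inh w (v 0)) \<and>
      (\<forall>A\<in>L. covers U (\<lambda>w z v. rforces w z v A))"
    using assms
  proof (induction L)
    case empty
    have "definable True r (\<lambda>w u. inh w (u 1))" by (intro definable_inh tm_var)
    moreover have "covers (\<lambda>w z s. inh w s) (\<lambda>w z v. inh w (v 0))" unfolding covers_def by blast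
    ultimately show ?case by (intro exI[of _ "\<lambda>w z s. inh w s"]) simp
  next
    case (insert A L)
    then obtain U where U: "definable True r (\<lambda>w u. U w (u 0) (u 1))" "covers U (\<lambda>w z v. inh w (v 0))"
      "\<forall>A\<in>L. covers U (\<lambda>w z v. rforces w z v A)" by blast
    obtain V where V: "definable True r (\<lambda>w u. V w (u 0) (u 1))" "covers V (\<lambda>w z v. rforces w z v A)"
      using covers_rforces by blast
    obtain W where "definable True r (\<lambda>w u. W w (u 0) (u 1))" "\<forall>K. covers U K \<or> covers V K \<longrightarrow> covers W K"
      using covers_merge[OF U(1) V(1)] by blast
    then show ?case using U V by (intro exI[of _ W]) blast
  qed
  then show ?thesis using that by blast
qed

theorem SigmaP_conservation_model:
  assumes "prov T A" "T \<subseteq> IKPP \<union> SigmaRefl" "finite T" "SigmaP A" "\<And>i. v i \<in> D r"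
  shows "forces r v A"
proof -
  obtain U where U: "definable True r (\<lambda>w u. U w (u 0) (u 1))" "covers U (\<lambda>w z v. inh w (v 0))"
    "\<And>B. B \<in> \<Union> (sf ` insert A T) \<Longrightarrow> covers U (\<lambda>w z v. rforces w z v B)"
    by (rule universal_family[of "\<Union> (sf ` insert A T)"]) (use assms(3) finite_sf in auto)
  interpret F: forcing le D E r U
  proof
    show "definable True r (\<lambda>w u. U w (u 0) (u 1))" by (rule U(1))
    fix w c assume "r \<preceq> w" "c \<in> D w"
    then obtain s where "s \<in> D w" "\<forall>w'. w \<preceq> w' \<longrightarrow> (\<forall>z\<in>D w'. U w' z s \<longleftrightarrow> inh w' c)"
      using U(2)[unfolded covers_def, rule_format, of w "\<lambda>_. c"] by blast
    then show "\<exists>s\<in>D w. \<forall>w'. w \<preceq> w' \<longrightarrow> (\<forall>z\<in>D w'. U w' z s \<longleftrightarrow> (\<exists>x\<in>D w'. E w' x c))"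
      by (intro bexI[of _ s]) (simp_all add: inh_def sub_refl)
  qed
  have "F.cov B" if "B \<in> \<Union> (sf ` insert A T)" for B
    using U(3)[OF that] unfolding covers_def F.cov_def F.coded_def by blast
  then show ?thesis
    by (intro F.SigmaP_conservation[OF assms(1,2) _ assms(4) _ assms(5)]) auto
qed

end

section \<open>Conservativity\<close>

lemma prov_mono: "prov T A \<Longrightarrow> T \<subseteq> T' \<Longrightarrow> prov T' A"
  by (induction rule: prov.induct) (auto intro: prov.intros)

lemma prov_finite: "prov T A \<Longrightarrow> \<exists>T0. finite T0 \<and> T0 \<subseteq> T \<and> prov T0 A"
proof (induction rule: prov.induct)
  case (ax A)
  then show ?case by (intro exI[of _ "{A}"]) (auto intro: prov.ax)
next
  case (mp A B)
  then obtain T1 T2 where "finite T1" "T1 \<subseteq> T" "prov T1 (Imp A B)" "finite T2" "T2 \<subseteq> T" "prov T2 A"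
    by blast
  then show ?case
    by (intro exI[of _ "T1 \<union> T2"]) (auto intro: prov.mp[of _ A] prov_mono)
next
  case (allI B A)
  then show ?case using prov.allI by blast
next
  case (exE A B)
  then show ?case using prov.exE by blast
qed (intro exI[of _ "{}"], auto intro: prov.intros)+

lemma ren_up_lift1: "ren (up (up \<rho>)) (lift 1 A) = lift 1 (ren (up \<rho>) A)"
proof -
  have "up (up \<rho>) \<circ> lv 1 = lv 1 \<circ> up \<rho>"
    by (auto simp: fun_eq_iff up_def lv_def split: nat.splits)
  then show ?thesis by (simp only: lift_ren ren_ren)
qed

lemma ren_up_lift2: "ren (up (up (up \<rho>))) (lift 2 A) = lift 2 (ren (up (up \<rho>)) A)"
proof -
  have "up (up (up \<rho>)) \<circ> lv 2 = lv 2 \<circ> up (up \<rho>)"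
    by (auto simp: fun_eq_iff up_def lv_def split: nat.splits)
  then show ?thesis by (simp only: lift_ren ren_ren)
qed

lemma renclosed_IKPP: "renclosed IKPP"
proof -
  have "ren \<rho> A \<in> Ext_ax" if A: "A \<in> Ext_ax" for A \<rho>
  proof -
    obtain a b B where "A = Imp (Conj (Eqd a b) (subst 0 a B)) (subst 0 b B)" "delta0 B"
      using A unfolding Ext_ax_def by blast
    then show ?thesis unfolding Ext_ax_def mem_Collect_eq
      by (intro exI[of _ "\<rho> a"] exI[of _ "\<rho> b"] exI[of _ "ren (up \<rho>) B"])
        (simp add: ren_subst0 ren_Eqd delta0_ren)
  qed
  moreover have "ren \<rho> A \<in> Pair_ax" if "A \<in> Pair_ax" for A \<rho>
    using that unfolding Pair_ax_def by auto
  moreover have "ren \<rho> A \<in> Union_ax" if "A \<in> Union_ax" for A \<rho>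
    using that unfolding Union_ax_def by (auto simp: numeral_2_eq_2)
  moreover have "ren \<rho> A \<in> Inf_ax" if "A \<in> Inf_ax" for A \<rho>
    using that unfolding Inf_ax_def by auto
  moreover have "ren \<rho> A \<in> Pow_ax" if "A \<in> Pow_ax" for A \<rho>
    using that unfolding Pow_ax_def by auto
  moreover have "ren \<rho> A \<in> Sep_ax" if A: "A \<in> Sep_ax" for A \<rho>
  proof -
    obtain a B where "A = Ex (All (Iff (Mem 0 1) (Conj (Mem 0 (Suc (Suc a))) (lift 1 B))))" "delta0 B"
      using A unfolding Sep_ax_def by blast
    then show ?thesis unfolding Sep_ax_def
      by (auto simp: Iff_def ren_up_lift1[simplified] delta0_ren
          intro!: exI[of _ "\<rho> a"] exI[of _ "ren (up \<rho>) B"])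
  qed
  moreover have "ren \<rho> A \<in> Coll_ax" if A: "A \<in> Coll_ax" for A \<rho>
  proof -
    obtain a B where "A = Imp (BAll a (Ex B)) (Ex (BAll (Suc a) (BEx 1 (lift 2 B))))" "delta0 B"
      using A unfolding Coll_ax_def by blast
    then show ?thesis unfolding Coll_ax_def
      by (auto simp: ren_up_lift2 delta0_ren
          intro!: exI[of _ "\<rho> a"] exI[of _ "ren (up (up \<rho>)) B"])
  qed
  moreover have "ren \<rho> A \<in> Ind_ax" if A: "A \<in> Ind_ax" for A \<rho>
  proof -
    obtain B where "A = Imp (All (Imp (BAll 0 (lift 1 B)) B)) (All B)"
      using A unfolding Ind_ax_def by blast
    then show ?thesis unfolding Ind_ax_def
      by (auto simp: ren_up_lift1[simplified] intro!: exI[of _ "ren (up \<rho>) B"])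
  qed
  ultimately show ?thesis unfolding renclosed_def IKPP_def by blast
qed

theorem theorem3p29:
  assumes "sentence A" and "SigmaP A" and "prov (IKPP \<union> SigmaRefl) A"
  shows "prov IKPP A"
proof (rule ccontr)
  assume n: "\<not> prov IKPP A"
  interpret canon IKPP by unfold_locales (rule renclosed_IKPP)
  have "fv A = {}" using fv_closed_at[of 0 A] assms(1) unfolding sentence_def by simp
  then obtain r v where k: "kripke wle fst mem r" "\<forall>i. v i \<in> fst r" "\<not> kripke.forces wle fst mem r v A"
    "\<forall>w v B. wle r w \<longrightarrow> (\<forall>i. v i \<in> fst w) \<longrightarrow> B \<in> IKPP \<longrightarrow> kripke.forces wle fst mem w v B"
    using completeness n by blast
  interpret M: ikpp_model wle fst mem r
    by (intro ikpp_model.intro k(1) ikpp_model_axioms.intro) (use k(4) in blast)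
  obtain T where "finite T" "T \<subseteq> IKPP \<union> SigmaRefl" "prov T A" using prov_finite[OF assms(3)] by blast
  then have "M.forces r v A" using M.SigmaP_conservation_model assms(2) k(2) by blast
  then show False using k(3) by blast
qed

end
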